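(* Let $I,J$ be admissible subsets of $\{1,\dots,n-1\}$, let $\eta^*$ be a composition with $\eta^*_i\ge\eta^*_{i+1}$ for all $i\in I$ and $\eta^*_j>\eta^*_{j+1}$ for all $j\in J$, and let $\eta\in W_{I\cup J}(\eta^* )$. Then $$\left\langle S^{(I,J)}_{\eta^*}(z),S^{(I,J)}_{\eta^*}(z)\right\rangle_{q,t}=K_{I,J}(t)\,\frac{\widehat c_{\eta^*\eta}}{a^{(I,J)}_\eta(q^{-1},t^{-1})}\,\left\langle E_\eta(z),E_\eta(z)\right\rangle_{q,t}.$$
   Context: Let $n\ge1$, let $q,t$ be indeterminates and $z=(z_1,\dots,z_n)$. The transposition $s_i$ ($1\le i\le n-1$) acts on functions by exchanging $z_i,z_{i+1}$ and on compositions by exchanging the $i$-th and $(i+1)$-st entries (the symmetric group $S_n$ acts on compositions accordingly). Put $$T_i:=t+\frac{tz_i-z_{i+1}}{z_i-z_{i+1}}(s_i-1),\qquad (\omega_0 f)(z_1,\dots,z_n):=f(qz_n,z_1,\dots,z_{n-1}),$$ $$Y_i:=t^{-n+i}\,T_i\cdots T_{n-1}\,\omega_0\,T_1^{-1}\cdots T_{i-1}^{-1}\qquad(1\le i\le n).$$ A composition is $\eta=(\eta_1,\dots,\eta_n)\in\mathbb Z_{\ge0}^n$; $|\eta|=\sum\eta_i$; $\eta^+$ is the partition obtained by permuting the entries of $\eta$; $l'_\eta(i):=\#\{j<i:\eta_j\ge\eta_i\}+\#\{j>i:\eta_j>\eta_i\}$ and $\overline\eta_i:=q^{\eta_i}t^{-l'_\eta(i)}$.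 For compositions of equal modulus, $\mu<\eta$ iff $\mu\ne\eta$ and $\sum_{i=1}^p(\eta_i-\mu_i)\ge0$ for all $1\le p\le n$; and $\mu\prec\eta$ iff $\mu^+<\eta^+$, or $\mu^+=\eta^+$ and $\mu<\eta$. The nonsymmetric Macdonald polynomial $E_\eta=E_\eta(z;q,t)$ is the unique polynomial with coefficients in $\mathbb Q(q,t)$ of the form $E_\eta=z^\eta+\sum_{\nu\prec\eta}b_{\eta\nu}z^\nu$ with $Y_iE_\eta=\overline\eta_iE_\eta$ for all $i$. Subsets $I,J\subseteq\{1,\dots,n-1\}$ are admissible if they are disjoint, $i\pm1\notin J$ for $i\in I$, and $j\pm1\notin I$ for $j\in J$. Let $W_I,W_J,W_{I\cup J}\subseteq S_n$ be the subgroups generated by the $s_k$ with $k\in I$, $k\in J$, $k\in I\cup J$; every $\omega\in W_{I\cup J}$ is uniquely $\omega=\omega_I\omega_J$ with $\omega_I\in W_I$, $\omega_J\in W_J$. $l(\cdot)$ is the length function on $S_n$; for a reduced word $\sigma=s_{i_l}\cdots s_{i_1}$ put $T_\sigma:=T_{i_l}\cdots T_{i_1}$. Let $$O_{I,J}:=\sum_{\omega\in W_{I\cup J}}\left(-\tfrac1t\right)^{l(\omega_J)}T_\omega .$$ For $\eta^*$ as in the claim, the Macdonald polynomial with prescribed symmetry $S^{(I,J)}_{\eta^*}(z)=S^{(I,J)}_{\eta^*}(z;q,t)$ is the polynomial with coefficient of $z^{\eta^*}$ equal to $1$ such that, for every $\eta\in W_{I\cup J}(\eta^* )$, $$O_{I,J}E_\eta=a^{(I,J)}_\eta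 S^{(I,J)}_{\eta^*},\qquad a^{(I,J)}_\eta=a^{(I,J)}_\eta(q,t)\in\mathbb Q(q,t)\setminus\{0\}.$$ The coefficients $\widehat c_{\eta^*\mu}\in\mathbb Q(q,t)$ are defined by the expansion $S^{(I,J)}_{\eta^*}(z;q,t)=\sum_{\mu\in W_{I\cup J}(\eta^* )}\widehat c_{\eta^*\mu}E_\mu(z;q,t)$. Decompose $I=I_1\cup\dots\cup I_r$ and $J=J_1\cup\dots\cup J_s$ into maximal sets of consecutive integers, put $\widetilde I_i:=I_i\cup\{\max(I_i)+1\}$, $\widetilde J_j:=J_j\cup\{\max(J_j)+1\}$, and $$K_{I,J}(t):=\prod_{j=1}^s[|\widetilde J_j|]_t!\ \prod_{i=1}^r[|\widetilde I_i|]_{t^{-1}}!,\qquad [m]_x:=\frac{1-x^m}{1-x},\quad [m]_x!:=[1]_x[2]_x\cdots[m]_x.$$ The inner product is $\langle f,g\rangle_{q,t}:=\mathrm{CT}\big(f(z;q,t)\,g(z^{-1};q^{-1},t^{-1})\,W(z)\big)$, where $\mathrm{CT}$ is the constant term with respect to $z$, $g(z^{-1};q^{-1},t^{-1})$ is $g$ with all $z_i,q,t$ inverted, and $$W(z)=\prod_{1\le i<j\le n}\frac{(z_i/z_j;q)_\infty\,(qz_j/z_i;q)_\infty}{(tz_i/z_j;q)_\infty\,(qtz_j/z_i;q)_\infty},\qquad (a;q)_\infty=\prod_{m\ge0}(1-aq^m),$$ is regarded as a formal power series in $q,t$ with coefficients Laurent polynomials in $z$. *)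

theory Defs
  imports
    "HOL-Library.Poly_Mapping"
    "HOL-Computational_Algebra.Computational_Algebra"
    "HOL-Computational_Algebra.Field_as_Ring"
    "HOL-Analysis.Infinite_Products"
    "HOL-Algebra.Sym_Groups"
begin

section \<open>The field of rational functions in two indeterminates\<close>

instance fract :: ("{idom, semiring_char_0}") ring_char_0
proof
  show "inj (of_nat :: nat \<Rightarrow> 'a fract)"
    by (rule injI) (simp add: of_nat_fract eq_fract)
qed

instance fract :: ("{idom, semiring_char_0}") field_char_0 ..

text \<open>The outer polynomial variable is \<open>q\<close>, the inner one is \<open>t\<close>.\<close>

type_synonym ratfun = "rat poly poly fract"

definition q_ind :: ratfun where
  "q_ind = to_fract [:0, 1:]"

definition t_ind :: ratfun where
  "t_ind = to_fract [:[:0, 1:]:]"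

text \<open>Substitution \<open>q := x\<close>, \<open>t := y\<close>. It is a field homomorphism when \<open>x\<close> and \<open>y\<close> are
  algebraically independent over the rationals, which is the only way it is used below.\<close>

definition subst_poly :: "'k::field_char_0 \<Rightarrow> 'k \<Rightarrow> rat poly poly \<Rightarrow> 'k" where
  "subst_poly x y p = poly (map_poly (\<lambda>c. poly (map_poly of_rat c) y) p) x"

definition subst_ratfun :: "'k::field_char_0 \<Rightarrow> 'k \<Rightarrow> ratfun \<Rightarrow> 'k" where
  "subst_ratfun x y r =
     subst_poly x y (fst (quot_of_fract r)) / subst_poly x y (snd (quot_of_fract r))"

definition qt_invert :: "ratfun \<Rightarrow> ratfun" where
  "qt_invert = subst_ratfun (inverse q_ind) (inverse t_ind)"


section \<open>Laurent polynomials and compositions\<close>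

text \<open>Exponent vectors, and in particular compositions, are finitely supported functions; the
  ones in \<open>n\<close> variables are supported in \<open>{1..n}\<close>. A Laurent polynomial is a finitely
  supported family of coefficients, with the convolution product of \<^type>\<open>poly_mapping\<close>.\<close>

type_synonym expo = "nat \<Rightarrow>\<^sub>0 int"

type_synonym 'a laurent = "expo \<Rightarrow>\<^sub>0 'a"

definition zmon :: "expo \<Rightarrow> 'a::zero_neq_one laurent" where
  "zmon \<alpha> = Poly_Mapping.single \<alpha> 1"

definition zvar :: "nat \<Rightarrow> 'a::zero_neq_one laurent" where
  "zvar i = zmon (Poly_Mapping.single i 1)"

definition smul :: "'a::comm_ring_1 \<Rightarrow> 'a laurent \<Rightarrow> 'a laurent" where
  "smul c f = Poly_Mapping.single 0 c * f"

definition composition :: "nat \<Rightarrow> expo \<Rightarrow> bool" where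
  "composition n \<eta> \<longleftrightarrow>
     Poly_Mapping.keys \<eta> \<subseteq> {1..n} \<and> (\<forall>i. 0 \<le> Poly_Mapping.lookup \<eta> i)"

definition polynomial_in :: "nat \<Rightarrow> 'a::zero laurent \<Rightarrow> bool" where
  "polynomial_in n f \<longleftrightarrow> (\<forall>\<nu>\<in>Poly_Mapping.keys f. composition n \<nu>)"

definition modulus :: "nat \<Rightarrow> expo \<Rightarrow> int" where
  "modulus n \<eta> = (\<Sum>i=1..n. Poly_Mapping.lookup \<eta> i)"

definition perm_act :: "(nat \<Rightarrow> nat) \<Rightarrow> expo \<Rightarrow> expo" where
  "perm_act \<sigma> \<eta> = Poly_Mapping.map_key (Hilbert_Choice.inv \<sigma>) \<eta>"

definition sorted_composition :: "nat \<Rightarrow> expo \<Rightarrow> expo" where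
  "sorted_composition n \<eta> =
     (THE \<kappa>. (\<exists>\<sigma>. \<sigma> permutes {1..n} \<and> \<kappa> = perm_act \<sigma> \<eta>) \<and>
        (\<forall>i\<in>{1..<n}. Poly_Mapping.lookup \<kappa> (i + 1) \<le> Poly_Mapping.lookup \<kappa> i))"

definition dominance_less :: "nat \<Rightarrow> expo \<Rightarrow> expo \<Rightarrow> bool" where
  "dominance_less n \<mu> \<eta> \<longleftrightarrow> modulus n \<mu> = modulus n \<eta> \<and> \<mu> \<noteq> \<eta> \<and>
     (\<forall>p\<in>{1..n}. 0 \<le> (\<Sum>i=1..p. Poly_Mapping.lookup \<eta> i - Poly_Mapping.lookup \<mu> i))"

definition prec :: "nat \<Rightarrow> expo \<Rightarrow> expo \<Rightarrow> bool" where
  "prec n \<mu> \<eta> \<longleftrightarrow> modulus n \<mu> = modulus n \<eta> \<and>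
     (dominance_less n (sorted_composition n \<mu>) (sorted_composition n \<eta>) \<or>
      sorted_composition n \<mu> = sorted_composition n \<eta> \<and> dominance_less n \<mu> \<eta>)"


section \<open>The symmetric group\<close>

definition simple_refl :: "nat \<Rightarrow> nat \<Rightarrow> nat" where
  "simple_refl k = Transposition.transpose k (k + 1)"

definition parabolic :: "nat \<Rightarrow> nat set \<Rightarrow> (nat \<Rightarrow> nat) set" where
  "parabolic n K = generate (sym_group n) (simple_refl ` K)"

definition orbit_of :: "nat \<Rightarrow> nat set \<Rightarrow> expo \<Rightarrow> expo set" where
  "orbit_of n K \<eta> = (\<lambda>\<sigma>. perm_act \<sigma> \<eta>) ` parabolic n K"

text \<open>The word \<open>[i\<^sub>l, \<dots>, i\<^sub>1]\<close> stands for the product \<open>s\<^bsub>i\<^sub>l\<^esub> \<cdots> s\<^bsub>i\<^sub>1\<^esub>\<close>.\<close>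

definition word_perm :: "nat list \<Rightarrow> nat \<Rightarrow> nat" where
  "word_perm w = foldr (\<lambda>i \<pi>. simple_refl i \<circ> \<pi>) w id"

definition coxeter_length :: "nat \<Rightarrow> (nat \<Rightarrow> nat) \<Rightarrow> nat" where
  "coxeter_length n \<sigma> =
     (LEAST l. \<exists>w. set w \<subseteq> {1..<n} \<and> word_perm w = \<sigma> \<and> length w = l)"

definition reduced_word :: "nat \<Rightarrow> (nat \<Rightarrow> nat) \<Rightarrow> nat list \<Rightarrow> bool" where
  "reduced_word n \<sigma> w \<longleftrightarrow>
     set w \<subseteq> {1..<n} \<and> word_perm w = \<sigma> \<and> length w = coxeter_length n \<sigma>"


section \<open>Hecke and Cherednik operators\<close>

definition swap_vars :: "nat \<Rightarrow> ratfun laurent \<Rightarrow> ratfun laurent" where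
  "swap_vars i f = Poly_Mapping.map_key (perm_act (simple_refl i)) f"

text \<open>The quotient \<open>(s\<^sub>i f - f) / (z\<^sub>i - z\<^sub>i\<^sub>+\<^sub>1)\<close> is a Laurent polynomial, unique because
  Laurent polynomials form an integral domain.\<close>

definition div_diff :: "nat \<Rightarrow> ratfun laurent \<Rightarrow> ratfun laurent" where
  "div_diff i f = (THE g. (zvar i - zvar (i + 1)) * g = swap_vars i f - f)"

definition T_op :: "nat \<Rightarrow> ratfun laurent \<Rightarrow> ratfun laurent" where
  "T_op i f = smul t_ind f + (smul t_ind (zvar i) - zvar (i + 1)) * div_diff i f"

text \<open>On exponents, \<open>f(z\<^sub>1, \<dots>, z\<^sub>n) \<mapsto> f(q z\<^sub>n, z\<^sub>1, \<dots>, z\<^sub>n\<^sub>-\<^sub>1)\<close> sends \<open>(\<alpha>\<^sub>1, \<dots>, \<alpha>\<^sub>n)\<close> to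
  \<open>(\<alpha>\<^sub>2, \<dots>, \<alpha>\<^sub>n, \<alpha>\<^sub>1)\<close> and produces the factor \<open>q\<close> to the power \<open>\<alpha>\<^sub>1\<close>.\<close>

definition next_index :: "nat \<Rightarrow> nat \<Rightarrow> nat" where
  "next_index n i = (if i = n then 1 else if i \<in> {1..<n} then i + 1 else i)"

definition omega0 :: "nat \<Rightarrow> ratfun laurent \<Rightarrow> ratfun laurent" where
  "omega0 n f = (\<Sum>\<alpha>\<in>Poly_Mapping.keys f.
     Poly_Mapping.single (Poly_Mapping.map_key (next_index n) \<alpha>)
       (Poly_Mapping.lookup f \<alpha> * q_ind powi Poly_Mapping.lookup \<alpha> 1))"

definition T_word :: "nat list \<Rightarrow> ratfun laurent \<Rightarrow> ratfun laurent" where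
  "T_word w = foldr (\<lambda>i F. T_op i \<circ> F) w id"

definition T_inv_word :: "nat list \<Rightarrow> ratfun laurent \<Rightarrow> ratfun laurent" where
  "T_inv_word w = foldr (\<lambda>i F. Hilbert_Choice.inv (T_op i) \<circ> F) w id"

definition Y_op :: "nat \<Rightarrow> nat \<Rightarrow> ratfun laurent \<Rightarrow> ratfun laurent" where
  "Y_op n i f = smul (t_ind powi (int i - int n))
     (T_word [i..<n] (omega0 n (T_inv_word [1..<i] f)))"

definition T_perm :: "nat \<Rightarrow> (nat \<Rightarrow> nat) \<Rightarrow> ratfun laurent \<Rightarrow> ratfun laurent" where
  "T_perm n \<sigma> = T_word (SOME w. reduced_word n \<sigma> w)"


section \<open>Nonsymmetric Macdonald polynomials\<close>

definition leg_colength :: "nat \<Rightarrow> expo \<Rightarrow> nat \<Rightarrow> nat" where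
  "leg_colength n \<eta> i =
     card {j \<in> {1..<i}. Poly_Mapping.lookup \<eta> j \<ge> Poly_Mapping.lookup \<eta> i} +
     card {j \<in> {i<..n}. Poly_Mapping.lookup \<eta> j > Poly_Mapping.lookup \<eta> i}"

definition eigenvalue :: "nat \<Rightarrow> expo \<Rightarrow> nat \<Rightarrow> ratfun" where
  "eigenvalue n \<eta> i =
     q_ind powi Poly_Mapping.lookup \<eta> i * t_ind powi (- int (leg_colength n \<eta> i))"

definition nonsymmetric_macdonald :: "nat \<Rightarrow> expo \<Rightarrow> ratfun laurent \<Rightarrow> bool" where
  "nonsymmetric_macdonald n \<eta> f \<longleftrightarrow>
     polynomial_in n f \<and>
     Poly_Mapping.lookup f \<eta> = 1 \<and>
     (\<forall>\<nu>\<in>Poly_Mapping.keys f. \<nu> = \<eta> \<or> prec n \<nu> \<eta>) \<and>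
     (\<forall>i\<in>{1..n}. Y_op n i f = smul (eigenvalue n \<eta> i) f)"


section \<open>Macdonald polynomials with prescribed symmetry\<close>

definition admissible :: "nat \<Rightarrow> nat set \<Rightarrow> nat set \<Rightarrow> bool" where
  "admissible n I J \<longleftrightarrow> I \<subseteq> {1..n - 1} \<and> J \<subseteq> {1..n - 1} \<and> I \<inter> J = {} \<and>
     (\<forall>i\<in>I. i - 1 \<notin> J \<and> i + 1 \<notin> J) \<and> (\<forall>j\<in>J. j - 1 \<notin> I \<and> j + 1 \<notin> I)"

definition J_part :: "nat \<Rightarrow> nat set \<Rightarrow> nat set \<Rightarrow> (nat \<Rightarrow> nat) \<Rightarrow> (nat \<Rightarrow> nat)" where
  "J_part n I J \<omega> =
     (THE \<omega>J. \<omega>J \<in> parabolic n J \<and> (\<exists>\<omega>I\<in>parabolic n I. \<omega> = \<omega>I \<circ> \<omega>J))"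

definition O_op :: "nat \<Rightarrow> nat set \<Rightarrow> nat set \<Rightarrow> ratfun laurent \<Rightarrow> ratfun laurent" where
  "O_op n I J f = (\<Sum>\<omega>\<in>parabolic n (I \<union> J).
     smul ((- 1 / t_ind) ^ coxeter_length n (J_part n I J \<omega>)) (T_perm n \<omega> f))"

text \<open>Here \<open>E\<close> is the family of nonsymmetric Macdonald polynomials and \<open>a\<close> the family of
  proportionality constants, indexed by the orbit of \<open>\<eta>s\<close>.\<close>

definition prescribed_symmetry_macdonald ::
  "nat \<Rightarrow> nat set \<Rightarrow> nat set \<Rightarrow> (expo \<Rightarrow> ratfun laurent) \<Rightarrow> expo
     \<Rightarrow> ratfun laurent \<Rightarrow> (expo \<Rightarrow> ratfun) \<Rightarrow> bool" where
  "prescribed_symmetry_macdonald n I J E \<eta>s S a \<longleftrightarrow>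
     polynomial_in n S \<and>
     Poly_Mapping.lookup S \<eta>s = 1 \<and>
     (\<forall>\<eta>\<in>orbit_of n (I \<union> J) \<eta>s. a \<eta> \<noteq> 0 \<and> O_op n I J (E \<eta>) = smul (a \<eta>) S)"


section \<open>The normalisation constant\<close>

definition maximal_runs :: "nat set \<Rightarrow> nat set set" where
  "maximal_runs K = {A. \<exists>a b. a \<le> b \<and> A = {a..b} \<and> A \<subseteq> K \<and>
     (\<forall>c d. A \<subseteq> {c..d} \<and> {c..d} \<subseteq> K \<longrightarrow> {c..d} = A)}"

definition extend_run :: "nat set \<Rightarrow> nat set" where
  "extend_run A = A \<union> {Max A + 1}"

definition q_number :: "'a::field \<Rightarrow> nat \<Rightarrow> 'a" where
  "q_number x m = (1 - x ^ m) / (1 - x)"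

definition q_factorial :: "'a::field \<Rightarrow> nat \<Rightarrow> 'a" where
  "q_factorial x m = (\<Prod>k=1..m. q_number x k)"

definition K_const :: "nat set \<Rightarrow> nat set \<Rightarrow> ratfun" where
  "K_const I J =
     (\<Prod>A\<in>maximal_runs J. q_factorial t_ind (card (extend_run A))) *
     (\<Prod>A\<in>maximal_runs I. q_factorial (inverse t_ind) (card (extend_run A)))"


section \<open>The inner product\<close>

text \<open>The weight is a formal power series in \<open>q\<close> (outer variable) and \<open>t\<close> (inner variable)
  whose coefficients are Laurent polynomials in \<open>z\<close>.\<close>

type_synonym weight_ring = "rat laurent fps fps"

definition q_ser :: weight_ring where
  "q_ser = fps_X"

definition t_ser :: weight_ring where
  "t_ser = fps_const fps_X"

definition z_ratio :: "nat \<Rightarrow> nat \<Rightarrow> weight_ring" where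
  "z_ratio i j = fps_const (fps_const
     (zmon (Poly_Mapping.single i 1 - Poly_Mapping.single j 1)))"

definition qpoch_inf :: "weight_ring \<Rightarrow> weight_ring" where
  "qpoch_inf a = prodinf (\<lambda>m. 1 - a * q_ser ^ m)"

text \<open>The denominator has constant coefficient \<open>1\<close> with respect to \<open>t\<close>, hence is a unit of the
  power series ring, and the quotient is the unique solution of a linear equation.\<close>

definition weight :: "nat \<Rightarrow> weight_ring" where
  "weight n = (THE w.
     w * (\<Prod>i=1..n. \<Prod>j=i+1..n.
            qpoch_inf (t_ser * z_ratio i j) * qpoch_inf (q_ser * t_ser * z_ratio j i)) =
     (\<Prod>i=1..n. \<Prod>j=i+1..n.
            qpoch_inf (z_ratio i j) * qpoch_inf (q_ser * z_ratio j i)))"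

definition weight_coeff :: "nat \<Rightarrow> expo \<Rightarrow> rat fps fps" where
  "weight_coeff n \<alpha> =
     Abs_fps (\<lambda>a. Abs_fps (\<lambda>b. Poly_Mapping.lookup (fps_nth (fps_nth (weight n) a) b) \<alpha>))"

text \<open>Rational functions in \<open>q\<close>, \<open>t\<close> and power series in \<open>q\<close>, \<open>t\<close> are both embedded in the
  field of fractions of the power series ring, where the inner product takes its values.\<close>

type_synonym scalars = "rat fps fps fract"

definition embed_qt :: "ratfun \<Rightarrow> scalars" where
  "embed_qt = subst_ratfun (to_fract fps_X) (to_fract (fps_const fps_X))"

text \<open>The weight has infinitely many monomials in \<open>z\<close>, but \<open>h\<close> has finitely many, so the constant
  term of their product is a finite sum: \<open>z\<^sup>\<alpha>\<close> in \<open>h\<close> pairs with its inverse in the weight.\<close>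

definition weighted_CT :: "nat \<Rightarrow> ratfun laurent \<Rightarrow> scalars" where
  "weighted_CT n h = (\<Sum>\<alpha>\<in>Poly_Mapping.keys h.
     embed_qt (Poly_Mapping.lookup h \<alpha>) * to_fract (weight_coeff n (- \<alpha>)))"

definition invert_all :: "ratfun laurent \<Rightarrow> ratfun laurent" where
  "invert_all g = Poly_Mapping.map_key uminus (Poly_Mapping.map qt_invert g)"

definition inner_qt :: "nat \<Rightarrow> ratfun laurent \<Rightarrow> ratfun laurent \<Rightarrow> scalars" where
  "inner_qt n f g = weighted_CT n (f * invert_all g)"

end

theory Submission
  imports Defs
begin

text \<open>Each \<open>T\<^sub>i\<close> and \<open>\<omega>\<^sub>0\<close>, hence each \<open>Y\<^sub>i\<close>, is unitary for the inner product, so the \<open>E\<^sub>\<eta>\<close> are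
  orthogonal. The operator \<open>O\<close> satisfies \<open>T\<^sub>i O = t O\<close> for \<open>i \<in> I\<close> and \<open>T\<^sub>j O = - O\<close> for \<open>j \<in> J\<close>, and
  \<open>S\<close> inherits both relations. Moving every \<open>T\<^sub>\<omega>\<close> of \<open>O\<close> to the other side of \<open>\<langle>S, O E\<^sub>\<eta>\<rangle>\<close> therefore
  gives \<open>\<langle>S, O E\<^sub>\<eta>\<rangle> = K \<langle>S, E\<^sub>\<eta>\<rangle>\<close>, where \<open>K\<close> is a product of Poincare polynomials; the left-hand side
  is \<open>\<langle>S, S\<rangle>\<close> times the conjugate of \<open>a\<^sub>\<eta>\<close>, and orthogonality evaluates the right-hand side.

  Unitarity amounts to two identities for the weight. Since a power series in \<open>q\<close>, \<open>t\<close> is determined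
  by its values at \<open>t = q\<^sup>k\<close>, \<open>k \<ge> 1\<close>, they are checked there, where the weight is a finite product.\<close>

text \<open>The coefficients of the polynomials are rational functions, the weight is a power series
  in q and t, and inverting q and t makes no sense on power series. So the inversion is kept on the
  second argument alone: T_i is shown to be symmetric for the bilinear form CT(f g W), and
  separately inverting z, q, t turns T_i into its inverse. Only the first fact involves W. At t =
  q^k the weight is a product of factors 1 - q^d z_i/z_j. The substitution of \<open>omega0\<close>
  permutes these factors, and s_i permutes all but two of them, so both identities become
  bookkeeping on finite index sets. \<open>T_perm\<close> uses an arbitrarily chosen reduced word.
  Factoring T_k out of O therefore rests on Matsumoto's theorem, and on reduced words of elements of
  a parabolic subgroup that stay inside its generators. The two bases in K come from the term of
  omega: conjugation turns its weight into (-t)^l(omega_J), the inverse eigenvalue of T_omega on S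
  is (-1)^l(omega_J) t^(-l(omega_I)), and the signs cancel. This leaves powers of t on the J side
  and of 1/t on the I side.\<close>

lemma lookup_single_mult:
  fixes f :: "'a::ab_group_add \<Rightarrow>\<^sub>0 'b::comm_ring_1"
  shows "Poly_Mapping.lookup (Poly_Mapping.single \<gamma> c * f) \<alpha> = c * Poly_Mapping.lookup f (\<alpha> - \<gamma>)"
proof -
  have eq: "(\<alpha> = \<gamma> + q) = (\<alpha> - \<gamma> = q)" for q
    by (auto simp: algebra_simps)
  have "Poly_Mapping.lookup (Poly_Mapping.single \<gamma> c * f) \<alpha> =
      (\<Sum>l. (c * (\<Sum>q. Poly_Mapping.lookup f q when \<alpha> = \<gamma> + q)) when \<gamma> = l)"
    unfolding lookup_mult lookup_single
    by (rule Sum_any.cong) (auto simp: when_def)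
  also have "\<dots> = c * Poly_Mapping.lookup f (\<alpha> - \<gamma>)"
    by (simp add: eq)
  finally show ?thesis .
qed

section \<open>Specialising t to a power of q\<close>

definition agree :: "nat \<Rightarrow> 'a fps \<Rightarrow> 'a fps \<Rightarrow> bool" where
  "agree N X Y \<longleftrightarrow> (\<forall>i<N. fps_nth X i = fps_nth Y i)"

lemma agree_mult:
  "agree N X Y \<Longrightarrow> agree N X' Y' \<Longrightarrow> agree N (X * X') (Y * Y' :: 'a::comm_ring_1 fps)"
  by (auto simp: agree_def fps_mult_nth intro!: sum.cong)

lemma agree_all: "(\<And>N. agree N X Y) \<Longrightarrow> X = Y"
  by (rule fps_ext) (auto simp: agree_def)

text \<open>The substitution t := q^k, under which q^a t^b becomes q^(a + k b). For k = 0 the index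
  set is infinite and the sum defaults to 0, hence the condition \<open>0 < k\<close> in the
  homomorphism lemmas.\<close>

definition spec :: "nat \<Rightarrow> 'a::comm_ring_1 fps fps \<Rightarrow> 'a fps" where
  "spec k F = Abs_fps (\<lambda>N. \<Sum>(a, b)\<in>{(a, b). a + k * b = N}. fps_nth (fps_nth F a) b)"

lemma finite_spec_index: "0 < k \<Longrightarrow> finite {(a, b). a + k * b = (N::nat)}"
proof -
  assume "0 < k"
  have "{(a, b). a + k * b = N} \<subseteq> {..N} \<times> {..N}"
  proof clarsimp
    fix a b assume "N = a + k * b"
    moreover have "b \<le> k * b" using \<open>0 < k\<close> by simp
    ultimately show "b \<le> a + k * b" by linarith
  qed
  then show ?thesis by (rule finite_subset) simp
qed

lemma spec_add: "spec k (F + G) = spec k F + spec k G"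
  by (rule fps_ext) (simp add: spec_def sum.distrib case_prod_unfold)

lemma spec_diff: "spec k (F - G) = spec k F - spec k G"
  by (rule fps_ext) (simp add: spec_def sum_subtractf case_prod_unfold)

text \<open>Both sides sum over two exponent pairs (a1, b1), (a2, b2) with a1 + a2 + k (b1 + b2) =
  N. The left side groups them by their sum, the right side by M = a1 + k b1; the bijection below
  regroups them.\<close>

lemma spec_mult:
  assumes k: "0 < k"
  shows "spec k (F * G) = spec k F * spec k G"
proof (rule fps_ext)
  fix N
  let ?f = "\<lambda>a b. fps_nth (fps_nth F a) b" and ?g = "\<lambda>a b. fps_nth (fps_nth G a) b"
  let ?S = "\<lambda>N. {(a, b). a + k * b = (N::nat)}"
  note fin = finite_spec_index[OF k]
  have "fps_nth (spec k (F * G)) N =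
      (\<Sum>p\<in>?S N. \<Sum>x\<in>{0..fst p} \<times> {0..snd p}. ?f (fst x) (snd x) * ?g (fst p - fst x) (snd p - snd x))"
    by (simp add: spec_def fps_mult_nth fps_sum_nth case_prod_unfold sum.cartesian_product)
  also have "\<dots> = (\<Sum>y\<in>(SIGMA p:?S N. {0..fst p} \<times> {0..snd p}).
      ?f (fst (snd y)) (snd (snd y)) * ?g (fst (fst y) - fst (snd y)) (snd (fst y) - snd (snd y)))"
    using fin by (subst sum.Sigma) (auto simp: case_prod_unfold)
  also have "\<dots> = (\<Sum>y\<in>(SIGMA M:{0..N}. ?S M \<times> ?S (N - M)).
      ?f (fst (fst (snd y))) (snd (fst (snd y))) * ?g (fst (snd (snd y))) (snd (snd (snd y))))"
  proof (rule sum.reindex_bij_witness[where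
        i = "\<lambda>y. ((fst (fst (snd y)) + fst (snd (snd y)), snd (fst (snd y)) + snd (snd (snd y))), fst (snd y))" and
        j = "\<lambda>y. (fst (snd y) + k * snd (snd y), snd y,
            (fst (fst y) - fst (snd y), snd (fst y) - snd (snd y)))"], goal_cases)
    case (2 y)
    then obtain a b a1 b1 where y: "y = ((a, b), (a1, b1))" "a + k * b = N" "a1 \<le> a" "b1 \<le> b"
      by auto
    obtain a2 b2 where "a = a1 + a2" "b = b1 + b2" using y by (auto simp: le_iff_add)
    then show ?case using y by (auto simp: algebra_simps)
  qed (auto simp: algebra_simps)
  also have "\<dots> = (\<Sum>M=0..N. \<Sum>p\<in>?S M \<times> ?S (N - M). ?f (fst (fst p)) (snd (fst p)) * ?g (fst (snd p)) (snd (snd p)))"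
    using fin by (subst sum.Sigma) (auto simp: case_prod_unfold)
  also have "\<dots> = fps_nth (spec k F * spec k G) N"
    unfolding fps_mult_nth
  proof (rule sum.cong[OF refl])
    fix M
    show "(\<Sum>p\<in>?S M \<times> ?S (N - M). ?f (fst (fst p)) (snd (fst p)) * ?g (fst (snd p)) (snd (snd p))) =
        fps_nth (spec k F) M * fps_nth (spec k G) (N - M)"
      by (simp add: spec_def case_prod_unfold sum_product sum.cartesian_product)
  qed
  finally show "fps_nth (spec k (F * G)) N = fps_nth (spec k F * spec k G) N" .
qed

lemma spec_const: "0 < k \<Longrightarrow> spec k (fps_const (fps_const c)) = fps_const c"
proof (rule fps_ext)
  fix N assume k: "0 < k"
  have "fps_nth (spec k (fps_const (fps_const c))) N =
      (\<Sum>p\<in>{(a, b). a + k * b = N}. if p = (0, 0) then c else 0)"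
    unfolding spec_def fps_nth_Abs_fps by (rule sum.cong) (auto split: if_splits)
  also have "\<dots> = fps_nth (fps_const c) N"
    using finite_spec_index[OF k, of N] by (simp add: sum.delta)
  finally show "fps_nth (spec k (fps_const (fps_const c))) N = fps_nth (fps_const c) N" .
qed

lemma spec_1: "0 < k \<Longrightarrow> spec k 1 = 1"
  using spec_const[of k 1] by simp

lemma spec_X: "0 < k \<Longrightarrow> spec k fps_X = fps_X"
proof (rule fps_ext)
  fix N assume k: "0 < k"
  have "fps_nth (spec k fps_X) N =
      (\<Sum>p\<in>{(a, b). a + k * b = N}. if p = (1, 0) then 1 else 0)"
    unfolding spec_def fps_nth_Abs_fps by (rule sum.cong) (auto split: if_splits)
  also have "\<dots> = fps_nth fps_X N"
    using finite_spec_index[OF k, of N] by (simp add: sum.delta eq_commute)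
  finally show "fps_nth (spec k fps_X) N = fps_nth fps_X N" .
qed

lemma spec_const_X: "0 < k \<Longrightarrow> spec k (fps_const fps_X) = fps_X ^ k"
proof (rule fps_ext)
  fix N assume k: "0 < k"
  have "fps_nth (spec k (fps_const fps_X)) N =
      (\<Sum>p\<in>{(a, b). a + k * b = N}. if p = (0, 1) then 1 else 0)"
    unfolding spec_def fps_nth_Abs_fps by (rule sum.cong) (auto split: if_splits)
  also have "\<dots> = fps_nth (fps_X ^ k) N"
    using finite_spec_index[OF k, of N] by (simp add: sum.delta eq_commute)
  finally show "fps_nth (spec k (fps_const fps_X)) N = fps_nth (fps_X ^ k) N" .
qed

lemma spec_power: "0 < k \<Longrightarrow> spec k (F ^ m) = spec k F ^ m"
  by (induction m) (simp_all add: spec_1 spec_mult)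

lemma spec_prod: "0 < k \<Longrightarrow> spec k (\<Prod>x\<in>A. F x) = (\<Prod>x\<in>A. spec k (F x))"
  by (induction A rule: infinite_finite_induct) (simp_all add: spec_1 spec_mult)

lemma agree_spec: "agree N F G \<Longrightarrow> agree N (spec k F) (spec k G)"
  by (auto simp: agree_def spec_def intro!: sum.cong)

text \<open>If \<open>b\<close> is the lowest power of \<open>t\<close> occurring in \<open>h\<close>, then for large \<open>k\<close> the lowest
  term of \<open>h(q, q\<^sup>k)\<close> comes from the coefficient of \<open>t\<^sup>b\<close> alone.\<close>

lemma spec_eq_0_imp:
  fixes h :: "'a::comm_ring_1 fps fps"
  assumes "\<And>k. 0 < k \<Longrightarrow> spec k h = 0"
  shows "h = 0"
proof (rule ccontr)
  assume "h \<noteq> 0"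
  then obtain a0 b0 where "fps_nth (fps_nth h a0) b0 \<noteq> 0"
    by (metis fps_ext fps_zero_nth)
  then have ex: "\<exists>b. \<exists>a. fps_nth (fps_nth h a) b \<noteq> 0" by blast
  define b where "b = (LEAST b. \<exists>a. fps_nth (fps_nth h a) b \<noteq> 0)"
  have b: "\<exists>a. fps_nth (fps_nth h a) b \<noteq> 0" unfolding b_def by (rule LeastI_ex[OF ex])
  define a where "a = (LEAST a. fps_nth (fps_nth h a) b \<noteq> 0)"
  have a: "fps_nth (fps_nth h a) b \<noteq> 0" unfolding a_def by (rule LeastI_ex[OF b])
  have b_min: "fps_nth (fps_nth h a') b' = 0" if "b' < b" for a' b'
    using not_less_Least[of b' "\<lambda>b. \<exists>a. fps_nth (fps_nth h a) b \<noteq> 0"] that by (auto simp: b_def)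
  define k where "k = Suc a"
  have k: "0 < k" by (simp add: k_def)
  have "fps_nth (spec k h) (a + k * b) =
      (\<Sum>p\<in>{(a', b'). a' + k * b' = a + k * b}. if p = (a, b) then fps_nth (fps_nth h a) b else 0)"
    unfolding spec_def fps_nth_Abs_fps
  proof (rule sum.cong[OF refl], clarify)
    fix a' b' assume eq: "a' + k * b' = a + k * b"
    show "fps_nth (fps_nth h a') b' = (if (a', b') = (a, b) then fps_nth (fps_nth h a) b else 0)"
    proof (cases b' b rule: linorder_cases)
      case less
      then show ?thesis by (simp add: b_min)
    next
      case equal
      then show ?thesis using eq by simp
    next
      case greater
      then have "k * b' \<ge> k * Suc b" by (intro mult_le_mono2) simp
      then have "k * b' \<ge> k * b + k" by simp
      then have False using eq by (simp add: k_def)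
      then show ?thesis ..
    qed
  qed
  also have "\<dots> = fps_nth (fps_nth h a) b"
    using finite_spec_index[OF k, of "a + k * b"] by (simp add: sum.delta)
  finally show False using a assms[OF k] by simp
qed

lemma spec_eq_imp:
  "(\<And>k. 0 < k \<Longrightarrow> spec k g = spec k h) \<Longrightarrow> g = h"
  using spec_eq_0_imp[of "g - h"] by (simp add: spec_diff)

section \<open>The weight at t = q^k\<close>

text \<open>\<open>qpoch_inf\<close> is a topological limit, while all later comparisons are
  coefficientwise. The bridge is that distinct series have distance 2 to the power minus the
  subdegree of their difference.\<close>

lemma fps_tendsto_agree:
  fixes P :: "nat \<Rightarrow> 'a::ring_1 fps"
  assumes "\<And>N n. N \<le> n \<Longrightarrow> agree N (P n) L"
  shows "P \<longlonglongrightarrow> L"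
proof (rule metric_LIMSEQ_I)
  fix r :: real assume r: "0 < r"
  obtain N where N: "(1 / 2) ^ N < r"
    using real_arch_pow_inv[OF r, of "1/2"] by auto
  have "dist (P n) L < r" if "n \<ge> N" for n
  proof (cases "P n = L")
    case True
    then show ?thesis using r by simp
  next
    case False
    have "agree N (P n) L" using assms that .
    then have "N \<le> subdegree (P n - L)"
      using False by (intro subdegree_geI) (auto simp: agree_def)
    then have "(2::real) ^ N \<le> 2 ^ subdegree (P n - L)" by simp
    then have "inverse (2 ^ subdegree (P n - L)) \<le> (1 / 2 :: real) ^ N"
      by (simp add: power_one_over field_simps)
    then show ?thesis using N False by (simp add: dist_fps_def)
  qed
  then show "\<exists>no. \<forall>n\<ge>no. dist (P n) L < r" by blast
qed

text \<open>Later factors are 1 modulo higher powers of q, so every coefficient of the partial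
  products stabilises. The hypothesis makes the constant term 1 - a_0 of the limit nonzero, as
  convergence of an infinite product to a nonzero value requires.\<close>

lemma agree_qpoch_inf:
  assumes "fps_nth a 0 \<noteq> 1"
  shows "agree N (qpoch_inf a) (\<Prod>m<N. 1 - a * q_ser ^ m)"
proof -
  define P where "P n = (\<Prod>m<n. 1 - a * q_ser ^ m)" for n
  have step: "agree n (P (n + d)) (P n)" for n d
  proof (induction d)
    case (Suc d)
    have "agree n (P (n + d) * (1 - a * q_ser ^ (n + d))) (P n * 1)"
      using Suc by (rule agree_mult) (auto simp: agree_def q_ser_def fps_X_power_mult_right_nth)
    then show ?case by (simp add: P_def)
  qed (simp add: agree_def)
  \<comment> \<open>Coefficient i no longer changes once the factors 0, ..., i are present, so the
    limit is read off diagonally.\<close>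
  define L where "L = Abs_fps (\<lambda>i. fps_nth (P (Suc i)) i)"
  have PL: "agree n (P (n + d)) L" for n d
    unfolding agree_def
  proof (intro allI impI)
    fix i assume "i < n"
    then obtain e where "n + d = Suc i + e" by (metis less_natE add.assoc add_Suc_shift plus_nat.simps(2))
    then show "fps_nth (P (n + d)) i = fps_nth L i"
      using step[of "Suc i" e] by (simp add: L_def agree_def)
  qed
  have "(\<lambda>n. P (Suc n)) \<longlonglongrightarrow> L"
  proof (rule fps_tendsto_agree)
    fix N n :: nat assume "N \<le> n"
    then show "agree N (P (Suc n)) L" using PL[of N "Suc n - N"] by simp
  qed
  moreover have "fps_nth L 0 \<noteq> 0" using assms by (simp add: L_def P_def)
  then have "L \<noteq> 0" by auto
  ultimately have "(\<lambda>m. 1 - a * q_ser ^ m) has_prod L"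
    unfolding has_prod_def raw_has_prod_def by (simp add: P_def lessThan_Suc_atMost)
  then have "qpoch_inf a = L" unfolding qpoch_inf_def by (rule has_prod_unique[symmetric])
  then show ?thesis using PL[of N 0] by (auto simp: agree_def P_def)
qed

text \<open>At t = q^k the argument t a becomes q^k a, whose infinite product is that of a without
  its first k factors.\<close>

lemma spec_qpoch_inf:
  assumes k: "0 < k" and a: "fps_nth a 0 \<noteq> 1" and ta: "fps_nth (t_ser * a) 0 \<noteq> 1"
  shows "spec k (qpoch_inf a) = (\<Prod>m<k. 1 - spec k a * fps_X ^ m) * spec k (qpoch_inf (t_ser * a))"
proof (rule agree_all)
  fix N
  have sp: "spec k (1 - b * q_ser ^ m) = 1 - spec k b * fps_X ^ m" for b m
    using k by (simp add: spec_diff spec_1 spec_mult spec_power q_ser_def spec_X)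
  have t: "spec k (t_ser * a) = spec k a * fps_X ^ k"
    using k by (simp add: spec_mult t_ser_def spec_const_X mult.commute)
  \<comment> \<open>Precision N + k is used so that N factors remain after the first k are split
    off.\<close>
  have "agree (N + k) (spec k (qpoch_inf a)) (\<Prod>m<N+k. 1 - spec k a * fps_X ^ m)"
    using agree_spec[OF agree_qpoch_inf[OF a, of "N + k"], of k] k by (simp add: spec_prod sp)
  then have 1: "agree N (spec k (qpoch_inf a)) (\<Prod>m<N+k. 1 - spec k a * fps_X ^ m)"
    by (simp add: agree_def)
  have "(\<Prod>m<k + d. 1 - spec k a * fps_X ^ m) =
      (\<Prod>m<k. 1 - spec k a * fps_X ^ m) * (\<Prod>m<d. 1 - spec k a * fps_X ^ k * fps_X ^ m)" for d
    by (induction d) (simp_all add: power_add mult.assoc)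
  note split = this[of N]
  have 2: "agree N (spec k (qpoch_inf (t_ser * a))) (\<Prod>m<N. 1 - spec k a * fps_X ^ k * fps_X ^ m)"
    using agree_spec[OF agree_qpoch_inf[OF ta, of N], of k] k by (simp add: spec_prod sp t)
  have 3: "agree N ((\<Prod>m<k. 1 - spec k a * fps_X ^ m) * spec k (qpoch_inf (t_ser * a)))
     ((\<Prod>m<k. 1 - spec k a * fps_X ^ m) * (\<Prod>m<N. 1 - spec k a * fps_X ^ k * fps_X ^ m))"
    by (rule agree_mult[OF _ 2]) (simp add: agree_def)
  show "agree N (spec k (qpoch_inf a)) ((\<Prod>m<k. 1 - spec k a * fps_X ^ m) * spec k (qpoch_inf (t_ser * a)))"
    using 1 3 split by (simp add: agree_def add.commute)
qed

lemma zmon_eq_1_iff: "zmon \<alpha> = (1 :: rat laurent) \<longleftrightarrow> \<alpha> = 0"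
proof
  assume "zmon \<alpha> = (1 :: rat laurent)"
  then have "Poly_Mapping.lookup (zmon \<alpha> :: rat laurent) 0 = Poly_Mapping.lookup 1 0" by simp
  then show "\<alpha> = 0" by (simp add: zmon_def lookup_single lookup_one when_def split: if_splits)
qed (simp add: zmon_def single_one)

lemma single_diff_neq_0: "i \<noteq> j \<Longrightarrow> Poly_Mapping.single i (1::int) - Poly_Mapping.single j 1 \<noteq> 0"
  by (metis eq_iff_diff_eq_0 lookup_single_eq lookup_single_not_eq zero_neq_one)

text \<open>This and the next two lemmas provide the hypothesis of \<open>agree_qpoch_inf\<close>
  for every argument in the weight: a ratio of distinct variables is a nontrivial monomial, and
  multiples of t or q have no constant term in that variable.\<close>

lemma z_ratio_nth_0: "i \<noteq> j \<Longrightarrow> fps_nth (z_ratio i j) 0 \<noteq> 1"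
proof
  assume "i \<noteq> j" "fps_nth (z_ratio i j) 0 = 1"
  then have "zmon (Poly_Mapping.single i 1 - Poly_Mapping.single j 1) = (1 :: rat laurent)"
    by (metis fps_nth_fps_const fps_one_nth z_ratio_def)
  then show False using single_diff_neq_0[OF \<open>i \<noteq> j\<close>] by (simp add: zmon_eq_1_iff)
qed

lemma t_ser_mult_nth_0: "fps_nth (t_ser * a) 0 \<noteq> 1"
proof
  assume "fps_nth (t_ser * a) 0 = 1"
  then have "fps_nth (fps_nth (t_ser * a) 0) 0 = 1" by simp
  then show False by (simp add: t_ser_def)
qed

lemma q_ser_mult_nth_0: "fps_nth (q_ser * a) 0 \<noteq> 1"
  by (simp add: q_ser_def)

lemma qpoch_inf_nth_0: "fps_nth a 0 \<noteq> 1 \<Longrightarrow> fps_nth (qpoch_inf a) 0 = 1 - fps_nth a 0"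
  using agree_qpoch_inf[of a 1] by (simp add: agree_def)

lemma fps_nth_0_prod: "fps_nth (\<Prod>x\<in>A. F x) 0 = (\<Prod>x\<in>A. fps_nth (F x) 0 :: 'a::comm_ring_1)"
  by (induction A rule: infinite_finite_induct) auto

definition weight_den :: "nat \<Rightarrow> weight_ring" where
  "weight_den n = (\<Prod>i=1..n. \<Prod>j=i+1..n.
            qpoch_inf (t_ser * z_ratio i j) * qpoch_inf (q_ser * t_ser * z_ratio j i))"

definition weight_num :: "nat \<Rightarrow> weight_ring" where
  "weight_num n = (\<Prod>i=1..n. \<Prod>j=i+1..n.
            qpoch_inf (z_ratio i j) * qpoch_inf (q_ser * z_ratio j i))"

lemma weight_den_nth_0: "fps_nth (fps_nth (weight_den n) 0) 0 = 1"
proof -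
  have 1: "fps_nth (fps_nth (qpoch_inf (t_ser * b)) 0) 0 = 1" for b
    by (simp add: qpoch_inf_nth_0[OF t_ser_mult_nth_0]) (simp add: t_ser_def)
  have 2: "fps_nth (fps_nth (qpoch_inf (q_ser * t_ser * b)) 0) 0 = 1" for b
    using 1[of "q_ser * b"] by (simp add: mult_ac)
  show ?thesis unfolding weight_den_def by (simp add: fps_nth_0_prod 1 2)
qed

text \<open>The Laurent polynomials are no field, so the denominator is inverted in two stages
  starting from its constant term 1: first its q^0 coefficient as a series in t, then the whole
  series in q. Uniqueness is cancellation in a domain.\<close>

lemma weight_eq: "weight n * weight_den n = weight_num n"
proof -
  define u where "u = fps_right_inverse (fps_nth (weight_den n) 0) 1"
  have "fps_nth (weight_den n) 0 * u = 1"
    unfolding u_def by (rule fps_right_inverse) (simp add: weight_den_nth_0)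
  then have inv: "weight_den n * fps_right_inverse (weight_den n) u = 1"
    by (rule fps_right_inverse)
  have "weight_den n \<noteq> 0" using inv by auto
  then have "\<exists>!w. w * weight_den n = weight_num n"
  proof (intro ex1I)
    show "weight_num n * fps_right_inverse (weight_den n) u * weight_den n = weight_num n"
      using inv by (metis mult.assoc mult.commute mult.right_neutral)
    then show "w = weight_num n * fps_right_inverse (weight_den n) u" if "w * weight_den n = weight_num n" for w
      using that \<open>weight_den n \<noteq> 0\<close> by (metis mult_right_cancel)
  qed
  from theI'[OF this] show ?thesis
    unfolding weight_def weight_den_def weight_num_def .
qed

text \<open>For \<open>t = q\<^sup>k\<close> the infinite products telescope to a Laurent polynomial. The factors for
  \<open>(i, j)\<close> and \<open>(j, i)\<close> differ by a shift of the power of \<open>q\<close>, recorded in the last component.\<close>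

definition factor_index :: "nat \<Rightarrow> nat \<Rightarrow> (nat \<times> nat \<times> nat) set" where
  "factor_index n k = {(i, j, m). i \<in> {1..n} \<and> j \<in> {1..n} \<and> i \<noteq> j \<and> m < k}"

definition root_of :: "nat \<times> nat \<times> nat \<Rightarrow> expo" where
  "root_of = (\<lambda>(i, j, m). Poly_Mapping.single i 1 - Poly_Mapping.single j 1)"

definition shift_of :: "nat \<times> nat \<times> nat \<Rightarrow> nat" where
  "shift_of = (\<lambda>(i, j, m). m + (if j < i then 1 else 0))"

definition binom :: "expo \<Rightarrow> nat \<Rightarrow> rat laurent fps" where
  "binom \<gamma> d = 1 - fps_const (zmon \<gamma>) * fps_X ^ d"

lemma finite_factor_index: "finite (factor_index n k)"
  by (rule finite_subset[of _ "{1..n} \<times> {1..n} \<times> {..<k}"]) (auto simp: factor_index_def)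

text \<open>Each numerator product is k explicit factors times the matching denominator product. The
  denominators cancel because their specialisation has constant term 1.\<close>

lemma spec_weight:
  assumes k: "0 < k"
  shows "spec k (weight n) = (\<Prod>x\<in>factor_index n k. binom (root_of x) (shift_of x))"
proof -
  \<comment> \<open>\<open>root_of\<close> ignores its last component, so m is a dummy here and is
    later instantiated by \<open>undefined\<close>.\<close>
  have z: "spec k (z_ratio i j) = fps_const (zmon (root_of (i, j, m)))" for i j m
    using k by (simp add: z_ratio_def spec_const root_of_def)
  have q: "spec k (q_ser * z_ratio i j) = fps_const (zmon (root_of (i, j, m))) * fps_X" for i j m
    using k by (simp add: spec_mult z[of _ _ m] q_ser_def spec_X mult.commute)
  have f1: "spec k (qpoch_inf (z_ratio i j)) = (\<Prod>m<k. binom (root_of (i, j, m)) (shift_of (i, j, m))) *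
      spec k (qpoch_inf (t_ser * z_ratio i j))" if "i < j" for i j
    using that by (subst spec_qpoch_inf[OF k z_ratio_nth_0 t_ser_mult_nth_0])
      (auto simp: binom_def shift_of_def z[of _ _ undefined] root_of_def)
  have f2: "spec k (qpoch_inf (q_ser * z_ratio j i)) = (\<Prod>m<k. binom (root_of (j, i, m)) (shift_of (j, i, m))) *
      spec k (qpoch_inf (q_ser * t_ser * z_ratio j i))" if "i < j" for i j
    using that by (subst spec_qpoch_inf[OF k q_ser_mult_nth_0 t_ser_mult_nth_0])
      (auto simp: binom_def shift_of_def q[of _ _ undefined] root_of_def mult_ac)
  let ?b = "\<lambda>i j. \<Prod>m<k. binom (root_of (i, j, m)) (shift_of (i, j, m))"
  have "spec k (weight n) * spec k (weight_den n) = spec k (weight_num n)"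
    by (simp add: weight_eq flip: spec_mult[OF k])
  also have "spec k (weight_num n) = (\<Prod>i=1..n. \<Prod>j=i+1..n. (?b i j * ?b j i) *
      (spec k (qpoch_inf (t_ser * z_ratio i j)) * spec k (qpoch_inf (q_ser * t_ser * z_ratio j i))))"
    unfolding weight_num_def spec_prod[OF k] spec_mult[OF k]
    by (intro prod.cong refl) (simp add: f1 f2 mult_ac del: prod.distrib)
  also have "\<dots> = (\<Prod>i=1..n. \<Prod>j=i+1..n. ?b i j * ?b j i) * spec k (weight_den n)"
    unfolding weight_den_def spec_prod[OF k] spec_mult[OF k] by (simp only: prod.distrib)
  finally have "spec k (weight n) * spec k (weight_den n) =
     (\<Prod>i=1..n. \<Prod>j=i+1..n. ?b i j * ?b j i) * spec k (weight_den n)" .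
  moreover have "spec k (weight_den n) \<noteq> 0"
  proof -
    have "{(a, b). a + k * b = (0::nat)} = {(0, 0)}" using k by auto
    then have "fps_nth (spec k (weight_den n)) 0 = 1"
      by (simp add: spec_def weight_den_nth_0)
    then show ?thesis by auto
  qed
  ultimately have "spec k (weight n) = (\<Prod>i=1..n. \<Prod>j=i+1..n. ?b i j * ?b j i)" by simp
  also have "\<dots> = (\<Prod>i=1..n. \<Prod>j=i+1..n. ?b i j) * (\<Prod>i=1..n. \<Prod>j=i+1..n. ?b j i)"
    by (simp add: prod.distrib)
  also have "(\<Prod>i=1..n. \<Prod>j=i+1..n. ?b i j) =
      (\<Prod>x\<in>{(i, j, m). i \<in> {1..n} \<and> j \<in> {1..n} \<and> i < j \<and> m < k}. binom (root_of x) (shift_of x))"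
    by (simp add: prod.Sigma)
       (rule prod.reindex_bij_witness[where i = "\<lambda>(i, j, m). (i, j, m)" and j = "\<lambda>(i, j, m). (i, j, m)"], auto)
  also have "(\<Prod>i=1..n. \<Prod>j=i+1..n. ?b j i) =
      (\<Prod>x\<in>{(i, j, m). i \<in> {1..n} \<and> j \<in> {1..n} \<and> j < i \<and> m < k}. binom (root_of x) (shift_of x))"
    by (simp add: prod.Sigma)
       (rule prod.reindex_bij_witness[where i = "\<lambda>(i, j, m). (j, i, m)" and j = "\<lambda>(i, j, m). (j, i, m)"], auto)
  also have "(\<Prod>x\<in>{(i, j, m). i \<in> {1..n} \<and> j \<in> {1..n} \<and> i < j \<and> m < k}. binom (root_of x) (shift_of x)) *
      (\<Prod>x\<in>{(i, j, m). i \<in> {1..n} \<and> j \<in> {1..n} \<and> j < i \<and> m < k}. binom (root_of x) (shift_of x)) =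
      (\<Prod>x\<in>factor_index n k. binom (root_of x) (shift_of x))"
    by (subst prod.union_disjoint[symmetric])
      (auto simp: factor_index_def intro!: prod.cong finite_subset[OF _ finite_factor_index[of n k]])
  finally show ?thesis .
qed

text \<open>Coefficients extended by 0 to negative powers of q. Shifts by integers such as an entry
  of an exponent vector then need no case distinction.\<close>

definition coeff_at :: "rat laurent fps \<Rightarrow> int \<Rightarrow> expo \<Rightarrow> rat" where
  "coeff_at X N \<alpha> = (if N < 0 then 0 else Poly_Mapping.lookup (fps_nth X (nat N)) \<alpha>)"

lemma coeff_at_binom:
  "coeff_at (binom \<gamma> d * X) N \<alpha> = coeff_at X N \<alpha> - coeff_at X (N - int d) (\<alpha> - \<gamma>)"
proof (cases "N < 0")
  case False
  then obtain M where N: "N = int M" by (metis nat_0_le not_less)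
  have "binom \<gamma> d * X = X - fps_X ^ d * (fps_const (zmon \<gamma>) * X)"
    by (simp add: binom_def algebra_simps)
  then have "fps_nth (binom \<gamma> d * X) M =
      fps_nth X M - (if M < d then 0 else zmon \<gamma> * fps_nth X (M - d))"
    by (simp add: fps_X_power_mult_nth)
  then show ?thesis
    by (simp add: coeff_at_def N zmon_def lookup_minus lookup_single_mult nat_diff_distrib')
qed (simp add: coeff_at_def)

lemma coeff_at_1: "coeff_at 1 N \<alpha> = (if N = 0 \<and> \<alpha> = 0 then 1 else 0)"
  by (auto simp: coeff_at_def lookup_one when_def)

text \<open>The substitution \<open>z\<^sup>\<alpha> \<mapsto> q\<^bsup>lam \<alpha>\<^esup> z\<^bsup>phi \<alpha>\<^esup>\<close> acts on products of binomials factor by factor.\<close>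

lemma coeff_at_prod_binom_subst:
  assumes phi: "\<And>\<alpha> \<beta>. phi (\<alpha> - \<beta>) = phi \<alpha> - phi \<beta>" "\<And>\<alpha>. phi \<alpha> = 0 \<Longrightarrow> \<alpha> = 0"
    and lam: "\<And>\<alpha> \<beta>. lam (\<alpha> - \<beta>) = lam \<alpha> - lam \<beta>"
    and d: "\<And>x. x \<in> F \<Longrightarrow> int (d' x) = int (d x) + lam (\<gamma> x)"
  shows "coeff_at (\<Prod>x\<in>F. binom (phi (\<gamma> x)) (d' x)) (N + lam \<alpha>) (phi \<alpha>) =
    coeff_at (\<Prod>x\<in>F. binom (\<gamma> x) (d x)) N \<alpha>"
  using d
proof (induction F arbitrary: N \<alpha> rule: infinite_finite_induct)
  case (insert x F)
  have eq: "N + lam \<alpha> - int (d' x) = (N - int (d x)) + lam (\<alpha> - \<gamma> x)"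
    using insert.prems by (simp add: lam)
  have IH: "coeff_at (\<Prod>x\<in>F. binom (phi (\<gamma> x)) (d' x)) (N + lam \<alpha>) (phi \<alpha>) =
      coeff_at (\<Prod>x\<in>F. binom (\<gamma> x) (d x)) N \<alpha>" for N \<alpha>
    using insert.IH insert.prems by blast
  show ?case
    unfolding prod.insert[OF insert.hyps] coeff_at_binom phi(1)[symmetric] eq IH ..
next
  case empty
  have "lam 0 = 0" "phi 0 = 0" using lam[of 0 0] phi(1)[of 0 0] by auto
  then show ?case by (cases "\<alpha> = 0") (auto simp: coeff_at_1 dest: phi(2))
next
  case (infinite F)
  have "lam 0 = 0" "phi 0 = 0" using lam[of 0 0] phi(1)[of 0 0] by auto
  then show ?case using infinite by (cases "\<alpha> = 0") (auto simp: coeff_at_1 dest: phi(2))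
qed

text \<open>Extracting a coefficient in z commutes with t := q^k; this carries identities for the
  specialised weight over to \<open>weight_coeff\<close>.\<close>

lemma spec_weight_coeff:
  "fps_nth (spec k (weight_coeff n \<alpha>)) N = coeff_at (spec k (weight n)) (int N) \<alpha>"
  by (simp add: spec_def weight_coeff_def coeff_at_def lookup_sum case_prod_unfold)

section \<open>Invariance of the weight under the cyclic shift of the variables\<close>

definition prev_index :: "nat \<Rightarrow> nat \<Rightarrow> nat" where
  "prev_index n i = (if i = 1 then n else i - 1)"

text \<open>\<open>prev_index n\<close> inverts \<open>next_index n\<close> on \<open>{1..n}\<close>
  only; outside that range the map is the identity and is its own inverse.\<close>

lemma inj_next_index:
  assumes "1 \<le> n"
  shows "inj (next_index n)"
proof (rule inj_on_inverseI)
  fix i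
  show "(if next_index n i \<in> {1..n} then prev_index n (next_index n i) else next_index n i) = i"
    using assms by (cases "i = n") (auto simp: next_index_def prev_index_def)
qed

definition rot :: "nat \<Rightarrow> expo \<Rightarrow> expo" where
  "rot n = Poly_Mapping.map_key (next_index n)"

lemma lookup_rot: "1 \<le> n \<Longrightarrow> Poly_Mapping.lookup (rot n \<alpha>) i = Poly_Mapping.lookup \<alpha> (next_index n i)"
  by (simp add: rot_def map_key.rep_eq inj_next_index)

lemma rot_single:
  "i \<in> {1..n} \<Longrightarrow> rot n (Poly_Mapping.single i c) = Poly_Mapping.single (prev_index n i) c"
proof -
  assume i: "i \<in> {1..n}"
  then have "next_index n (prev_index n i) = i" by (auto simp: next_index_def prev_index_def)
  then show ?thesis using map_key_single[OF inj_next_index, of n "prev_index n i" c] i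
    by (simp add: rot_def)
qed

lemma rot_diff: "1 \<le> n \<Longrightarrow> rot n (\<alpha> - \<beta>) = rot n \<alpha> - rot n \<beta>"
  by (rule poly_mapping_eqI) (simp add: lookup_rot lookup_minus)

lemma rot_add: "1 \<le> n \<Longrightarrow> rot n (\<alpha> + \<beta>) = rot n \<alpha> + rot n \<beta>"
  by (rule poly_mapping_eqI) (simp add: lookup_rot lookup_add)

lemma rot_eq_0: "1 \<le> n \<Longrightarrow> rot n \<alpha> = 0 \<Longrightarrow> \<alpha> = 0"
proof (rule poly_mapping_eqI)
  fix i assume n: "1 \<le> n" and "rot n \<alpha> = 0"
  have "next_index n (if i \<in> {1..n} then prev_index n i else i) = i"
    using n by (auto simp: next_index_def prev_index_def)
  then show "Poly_Mapping.lookup \<alpha> i = Poly_Mapping.lookup 0 i"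
    using lookup_rot[OF n, of \<alpha> "if i \<in> {1..n} then prev_index n i else i"] \<open>rot n \<alpha> = 0\<close> by simp
qed

text \<open>W(q z_n, z_1, ..., z_(n-1)) = W(z), read on coefficients. Cyclic relabelling permutes
  the factors. Moving index 1 to position n reverses its order relative to all other indices, and
  the resulting change of \<open>shift_of\<close> is exactly the power of q produced by the
  substitution.\<close>

lemma coeff_at_weight_rot:
  assumes n: "1 \<le> n" and k: "0 < k"
  shows "coeff_at (spec k (weight n)) (N + Poly_Mapping.lookup \<alpha> 1) (rot n \<alpha>) =
    coeff_at (spec k (weight n)) N \<alpha>"
proof -
  define f where "f = (\<lambda>(i, j, m::nat). (prev_index n i, prev_index n j, m))"
  define g where "g = (\<lambda>(i, j, m::nat). (next_index n i, next_index n j, m))"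
  let ?lam = "\<lambda>\<alpha>::expo. Poly_Mapping.lookup \<alpha> 1"
  have pn: "prev_index n (next_index n i) = i" "next_index n (prev_index n i) = i"
    "prev_index n i \<in> {1..n}" "next_index n i \<in> {1..n}" if "i \<in> {1..n}" for i
    using that by (auto simp: next_index_def prev_index_def)
  have f_in: "f x \<in> factor_index n k" and g_in: "g x \<in> factor_index n k" and gf: "g (f x) = x"
    and fg: "f (g x) = x" and root_f: "root_of (f x) = rot n (root_of x)"
    and shift_f: "int (shift_of (f x)) = int (shift_of x) + ?lam (root_of x)"
    if x: "x \<in> factor_index n k" for x
  proof -
    obtain i j m where x_eq: "x = (i, j, m)" by (cases x) auto
    have ij: "i \<in> {1..n}" "j \<in> {1..n}" "i \<noteq> j" "m < k"
      using x by (auto simp: factor_index_def x_eq)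
    have ne: "prev_index n i \<noteq> prev_index n j" "next_index n i \<noteq> next_index n j"
      using ij pn by metis+
    show "f x \<in> factor_index n k" "g x \<in> factor_index n k"
      using pn[OF ij(1)] pn[OF ij(2)] ne ij(4) by (simp_all add: f_def g_def x_eq factor_index_def)
    show "g (f x) = x" "f (g x) = x"
      using pn[OF ij(1)] pn[OF ij(2)] by (simp_all add: f_def g_def x_eq)
    show "root_of (f x) = rot n (root_of x)"
      using ij n by (simp add: f_def x_eq root_of_def rot_diff rot_single)
    show "int (shift_of (f x)) = int (shift_of x) + ?lam (root_of x)"
      using ij by (auto simp: f_def x_eq root_of_def shift_of_def prev_index_def lookup_minus lookup_single when_def)
  qed
  have "(\<Prod>x\<in>factor_index n k. binom (root_of x) (shift_of x)) =
      (\<Prod>x\<in>factor_index n k. binom (root_of (f x)) (shift_of (f x)))"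
    by (rule prod.reindex_bij_witness[where i = f and j = g]) (simp_all add: f_in g_in fg gf)
  also have "\<dots> = (\<Prod>x\<in>factor_index n k. binom (rot n (root_of x)) (shift_of (f x)))"
    by (rule prod.cong) (simp_all add: root_f)
  finally have eq: "(\<Prod>x\<in>factor_index n k. binom (root_of x) (shift_of x)) =
      (\<Prod>x\<in>factor_index n k. binom (rot n (root_of x)) (shift_of (f x)))" .
  have "coeff_at (\<Prod>x\<in>factor_index n k. binom (rot n (root_of x)) (shift_of (f x))) (N + ?lam \<alpha>) (rot n \<alpha>) =
      coeff_at (\<Prod>x\<in>factor_index n k. binom (root_of x) (shift_of x)) N \<alpha>"
    by (rule coeff_at_prod_binom_subst[where lam = ?lam])
      (use n in \<open>auto simp: rot_diff rot_eq_0 lookup_minus shift_f\<close>)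
  then show ?thesis using eq by (simp add: spec_weight[OF k])
qed

text \<open>Power series admit no negative powers of q, so the invariance is stated once for each
  sign of the first entry.\<close>

lemma weight_coeff_rot_nonneg:
  assumes n: "1 \<le> n" and a: "0 \<le> Poly_Mapping.lookup \<alpha> 1"
  shows "weight_coeff n (rot n \<alpha>) = fps_X ^ nat (Poly_Mapping.lookup \<alpha> 1) * weight_coeff n \<alpha>"
proof (rule spec_eq_imp, rule fps_ext)
  fix k N assume k: "0 < (k::nat)"
  show "fps_nth (spec k (weight_coeff n (rot n \<alpha>))) N =
      fps_nth (spec k (fps_X ^ nat (Poly_Mapping.lookup \<alpha> 1) * weight_coeff n \<alpha>)) N"
    using coeff_at_weight_rot[OF n k, of "int N - Poly_Mapping.lookup \<alpha> 1" \<alpha>] a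
    by (auto simp: spec_mult k spec_power spec_X fps_X_power_mult_nth spec_weight_coeff of_nat_diff coeff_at_def)
qed

lemma weight_coeff_rot_nonpos:
  assumes n: "1 \<le> n" and a: "Poly_Mapping.lookup \<alpha> 1 \<le> 0"
  shows "fps_X ^ nat (- Poly_Mapping.lookup \<alpha> 1) * weight_coeff n (rot n \<alpha>) = weight_coeff n \<alpha>"
proof (rule spec_eq_imp, rule fps_ext)
  fix k N assume k: "0 < (k::nat)"
  show "fps_nth (spec k (fps_X ^ nat (- Poly_Mapping.lookup \<alpha> 1) * weight_coeff n (rot n \<alpha>))) N =
      fps_nth (spec k (weight_coeff n \<alpha>)) N"
    using coeff_at_weight_rot[OF n k, of "int N" \<alpha>] a
    unfolding spec_mult[OF k] spec_power[OF k] spec_X[OF k] fps_X_power_mult_nth spec_weight_coeff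
    by (auto simp: of_nat_diff coeff_at_def nat_less_iff split: if_splits)
qed

section \<open>The weight under an exchange of neighbouring variables\<close>

definition swap_expo :: "nat \<Rightarrow> expo \<Rightarrow> expo" where
  "swap_expo i = perm_act (simple_refl i)"

lemma simple_refl_involutive [simp]: "simple_refl i (simple_refl i j) = j"
  by (simp add: simple_refl_def)

lemma inv_simple_refl [simp]: "Hilbert_Choice.inv (simple_refl i) = simple_refl i"
  by (rule inv_equality) auto

lemma inj_simple_refl [simp]: "inj (simple_refl i)"
  by (metis injI simple_refl_involutive)

lemma lookup_swap_expo: "Poly_Mapping.lookup (swap_expo i \<alpha>) j = Poly_Mapping.lookup \<alpha> (simple_refl i j)"
  by (simp add: swap_expo_def perm_act_def map_key.rep_eq)

lemma swap_expo_involutive [simp]: "swap_expo i (swap_expo i \<alpha>) = \<alpha>"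
  by (rule poly_mapping_eqI) (simp add: lookup_swap_expo)

lemma swap_expo_add: "swap_expo i (\<alpha> + \<beta>) = swap_expo i \<alpha> + swap_expo i \<beta>"
  by (rule poly_mapping_eqI) (simp add: lookup_swap_expo lookup_add)

lemma swap_expo_diff: "swap_expo i (\<alpha> - \<beta>) = swap_expo i \<alpha> - swap_expo i \<beta>"
  by (rule poly_mapping_eqI) (simp add: lookup_swap_expo lookup_minus)

lemma swap_expo_uminus: "swap_expo i (- \<alpha>) = - swap_expo i \<alpha>"
  by (rule poly_mapping_eqI) (simp add: lookup_swap_expo)

lemma swap_expo_0 [simp]: "swap_expo i 0 = 0"
  by (rule poly_mapping_eqI) (simp add: lookup_swap_expo)

lemma swap_expo_eq_0: "swap_expo i \<alpha> = 0 \<Longrightarrow> \<alpha> = 0"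
  by (metis swap_expo_0 swap_expo_involutive)

lemma swap_expo_single: "swap_expo i (Poly_Mapping.single j c) = Poly_Mapping.single (simple_refl i j) c"
  by (rule poly_mapping_eqI) (auto simp: lookup_swap_expo lookup_single when_def)

text \<open>Removing the two factors \<open>1 - z\<^sub>i/z\<^sub>i\<^sub>+\<^sub>1\<close> and \<open>1 - q\<^sup>k z\<^sub>i\<^sub>+\<^sub>1/z\<^sub>i\<close> leaves a product
  that is symmetric in \<open>z\<^sub>i, z\<^sub>i\<^sub>+\<^sub>1\<close>.\<close>

lemma spec_weight_factor:
  assumes i: "i \<in> {1..<n}" and k: "0 < k"
  obtains X where "\<And>N \<alpha>. coeff_at X N (swap_expo i \<alpha>) = coeff_at X N \<alpha>"
    "spec k (weight n) = binom (Poly_Mapping.single i 1 - Poly_Mapping.single (i + 1) 1) 0 *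
      (binom (Poly_Mapping.single (i + 1) 1 - Poly_Mapping.single i 1) k * X)"
proof
  define F where "F = factor_index n k - {(i, i + 1, 0), (i + 1, i, k - 1)}"
  \<comment> \<open>The factor with index (i, i+1, m) carries q^m, as does the one with index (i+1,
    i, m-1), so the swap pairs these two. The two removed indices are those whose partner would have
    m = -1 or m = k. All other pairs keep their order under the transposition.\<close>
  define f where "f = (\<lambda>(a, b, m). (simple_refl i a, simple_refl i b,
    (if a = i \<and> b = i + 1 then m - 1 else if a = i + 1 \<and> b = i then m + 1 else m::nat)))"
  let ?X = "\<Prod>x\<in>F. binom (root_of x) (shift_of x)"
  have finF: "finite F" by (simp add: F_def finite_factor_index)
  have s: "simple_refl i a = (if a = i then i + 1 else if a = i + 1 then i else a)" for a
    by (auto simp: simple_refl_def transpose_def)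
  have f_in: "f x \<in> F" and f_f: "f (f x) = x" and root_f: "root_of (f x) = swap_expo i (root_of x)"
    and shift_f: "shift_of (f x) = shift_of x" if x: "x \<in> F" for x
  proof -
    obtain a b m where x_eq: "x = (a, b, m)" by (cases x) auto
    have ab: "a \<in> {1..n}" "b \<in> {1..n}" "a \<noteq> b" "m < k" using x by (auto simp: F_def factor_index_def x_eq)
    have m1: "0 < m" if "a = i" "b = i + 1" using x that by (auto simp: F_def x_eq intro: gr0I)
    have m2: "m + 1 < k" if "a = i + 1" "b = i" using x that ab by (auto simp: F_def x_eq)
    show "f x \<in> F" using ab m1 m2 i k by (auto simp: F_def f_def x_eq factor_index_def s split: if_splits)
    show "f (f x) = x" using ab m1 m2 by (auto simp: f_def x_eq s)
    show "root_of (f x) = swap_expo i (root_of x)"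
      by (auto simp: f_def x_eq root_of_def swap_expo_diff swap_expo_single)
    show "shift_of (f x) = shift_of x" using ab m1 m2 by (auto simp: f_def x_eq shift_of_def s)
  qed
  have "?X = (\<Prod>x\<in>F. binom (root_of (f x)) (shift_of (f x)))"
    by (rule prod.reindex_bij_witness[where i = f and j = f]) (auto simp: f_in f_f)
  also have "\<dots> = (\<Prod>x\<in>F. binom (swap_expo i (root_of x)) (shift_of x))"
    by (rule prod.cong) (auto simp: root_f shift_f)
  finally have X: "?X = (\<Prod>x\<in>F. binom (swap_expo i (root_of x)) (shift_of x))" .
  show "coeff_at ?X N (swap_expo i \<alpha>) = coeff_at ?X N \<alpha>" for N \<alpha>
    using coeff_at_prod_binom_subst[of "swap_expo i" "\<lambda>_. 0" F shift_of shift_of root_of N \<alpha>]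
    by (simp add: swap_expo_diff swap_expo_eq_0 X[symmetric])
  have "factor_index n k = insert (i, i + 1, 0) (insert (i + 1, i, k - 1) F)"
    using i k by (auto simp: F_def factor_index_def)
  moreover have F_notin: "(i, Suc i, 0) \<notin> F" "(Suc i, i, k - Suc 0) \<notin> F" by (auto simp: F_def)
  ultimately show "spec k (weight n) = binom (Poly_Mapping.single i 1 - Poly_Mapping.single (i + 1) 1) 0 *
      (binom (Poly_Mapping.single (i + 1) 1 - Poly_Mapping.single i 1) k * ?X)"
    using k finF by (simp add: spec_weight F_notin) (simp add: root_of_def shift_of_def)
qed

text \<open>This says that (t z_i - z_(i+1)) W is antisymmetric in the two variables. At t = q^k it
  equals (t z_i - z_(i+1)) (z_i - t z_(i+1)) (z_(i+1) - z_i) / (z_i z_(i+1)) times a symmetric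
  factor; the first two factors together are symmetric, the third is antisymmetric.\<close>

lemma weight_coeff_swap:
  assumes i: "i \<in> {1..<n}"
  defines "ei \<equiv> Poly_Mapping.single i 1" and "ej \<equiv> Poly_Mapping.single (i + 1) 1"
  shows "fps_const fps_X * (weight_coeff n (\<beta> - ei) + weight_coeff n (swap_expo i \<beta> - ei)) =
    weight_coeff n (\<beta> - ej) + weight_coeff n (swap_expo i \<beta> - ej)"
proof (rule spec_eq_imp, rule fps_ext)
  fix k N assume k: "0 < (k::nat)"
  obtain X where sym: "\<And>N \<alpha>. coeff_at X N (swap_expo i \<alpha>) = coeff_at X N \<alpha>"
    and W: "spec k (weight n) = binom (ei - ej) 0 * (binom (ej - ei) k * X)"
    using spec_weight_factor[OF i k] unfolding ei_def ej_def by metis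
  define p where "p = coeff_at X"
  define x where "x = ei - ej"
  define y where "y = \<beta> - ei"
  define u where "u = swap_expo i y"
  let ?c = "coeff_at (spec k (weight n))"
  have mx: "\<alpha> - (ej - ei) = \<alpha> + x" for \<alpha> by (simp add: x_def)
  have W': "spec k (weight n) = binom x 0 * (binom (ej - ei) k * X)" using W by (simp add: x_def)
  have c: "?c M \<alpha> = (p M \<alpha> - p (M - k) (\<alpha> + x)) - (p M (\<alpha> - x) - p (M - k) \<alpha>)" for M \<alpha>
    unfolding W' coeff_at_binom mx p_def by simp
  have sx: "swap_expo i x = - x"
    by (simp add: x_def ei_def ej_def swap_expo_diff swap_expo_single) (simp add: simple_refl_def)
  have sp: "p M (swap_expo i \<alpha>) = p M \<alpha>" for M \<alpha> by (simp add: p_def sym)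
  \<comment> \<open>Symmetry of \<open>X\<close> moves every coefficient at a reflected exponent
    back to the line through y in direction x, where the claim is a linear identity.\<close>
  have pu: "p M u = p M y" "p M (u - x) = p M (y + x)" "p M (u + x) = p M (y - x)"
    "p M (u - x - x) = p M (y + x + x)" for M
    using sp[of M y] sp[of M "y + x"] sp[of M "y - x"] sp[of M "y + x + x"]
    unfolding swap_expo_add swap_expo_diff sx u_def[symmetric] by simp_all
  have \<beta>: "\<beta> - ei = y" "\<beta> - ej = y + x" "swap_expo i \<beta> - ei = u - x" "swap_expo i \<beta> - ej = u"
  proof -
    have si: "swap_expo i ei = ej"
      by (simp add: ei_def ej_def swap_expo_single) (simp add: simple_refl_def)
    have "\<beta> = y + ei" by (simp add: y_def)
    then have "swap_expo i \<beta> = u + ej" by (simp add: u_def swap_expo_add si)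
    then show "\<beta> - ei = y" "\<beta> - ej = y + x" "swap_expo i \<beta> - ei = u - x" "swap_expo i \<beta> - ej = u"
      by (simp_all add: y_def x_def)
  qed
  have "?c (int N - k) (\<beta> - ei) + ?c (int N - k) (swap_expo i \<beta> - ei) =
    ?c (int N) (\<beta> - ej) + ?c (int N) (swap_expo i \<beta> - ej)"
    unfolding \<beta> c pu by (simp add: pu)
  then show "fps_nth (spec k (fps_const fps_X * (weight_coeff n (\<beta> - ei) + weight_coeff n (swap_expo i \<beta> - ei)))) N =
    fps_nth (spec k (weight_coeff n (\<beta> - ej) + weight_coeff n (swap_expo i \<beta> - ej))) N"
    by (auto simp: spec_mult k spec_const_X spec_add fps_X_power_mult_nth spec_weight_coeff of_nat_diff coeff_at_def)
qed

section \<open>Substitution homomorphisms\<close>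

definition field_hom :: "('a::field \<Rightarrow> 'b::field) \<Rightarrow> bool" where
  "field_hom h \<longleftrightarrow> h 1 = 1 \<and> (\<forall>x y. h (x + y) = h x + h y) \<and> (\<forall>x y. h (x * y) = h x * h y)"

lemma field_hom_simps:
  assumes "field_hom h"
  shows "h 0 = 0" "h 1 = 1" "h (x + y) = h x + h y" "h (x * y) = h x * h y" "h (- x) = - h x"
    "h (x - y) = h x - h y" "h (inverse x) = inverse (h x)" "h (x / y) = h x / h y" "h (x ^ k) = h x ^ k"
    "h (x powi m) = h x powi m" "h (sum f A) = (\<Sum>a\<in>A. h (f a))" "h (prod f A) = (\<Prod>a\<in>A. h (f a))"
    "h x = 0 \<longleftrightarrow> x = 0"
proof -
  show 1: "h 1 = 1" and add: "h (x + y) = h x + h y" and mult: "h (x * y) = h x * h y" for x y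
    using assms by (auto simp: field_hom_def)
  show 0: "h 0 = 0" using add[of 0 0] by (metis add_0_right add_left_cancel)
  show uminus: "h (- x) = - h x" for x using add[of "- x" x] 0 by (simp add: eq_neg_iff_add_eq_0)
  show "h (x - y) = h x - h y" using add[of x "- y"] by (simp add: uminus)
  have nz: "h x \<noteq> 0" if "x \<noteq> 0" for x using mult[of x "inverse x"] that 1 by auto
  show inv: "h (inverse x) = inverse (h x)" for x
  proof (cases "x = 0")
    case False
    then have "h x * h (inverse x) = 1" using mult[of x "inverse x"] 1 by simp
    then show ?thesis by (simp add: inverse_unique)
  qed (simp add: 0)
  show "h (x / y) = h x / h y" using mult[of x "inverse y"] by (simp add: inv divide_inverse)
  show pow: "h (x ^ k) = h x ^ k" for x k by (induction k) (simp_all add: 1 mult)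
  show "h (x powi m) = h x powi m" by (simp add: power_int_def pow inv)
  show "h (sum f A) = (\<Sum>a\<in>A. h (f a))" by (induction A rule: infinite_finite_induct) (simp_all add: 0 add)
  show "h (prod f A) = (\<Prod>a\<in>A. h (f a))" by (induction A rule: infinite_finite_induct) (simp_all add: 1 mult)
  show "h x = 0 \<longleftrightarrow> x = 0" using nz 0 by auto
qed

text \<open>Applied twice in \<open>subst_poly_hom\<close>, once for each layer of the nested
  polynomials.\<close>

lemma poly_map_poly_hom:
  fixes h :: "'a::comm_ring_1 \<Rightarrow> 'b::comm_ring_1"
  assumes h: "h 0 = 0" "h 1 = 1" "\<And>x y. h (x + y) = h x + h y" "\<And>x y. h (x * y) = h x * h y"
  shows "poly (map_poly h (p + q)) x = poly (map_poly h p) x + poly (map_poly h q) x"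
    "poly (map_poly h (p * q)) x = poly (map_poly h p) x * poly (map_poly h q) x"
proof -
  have pc: "poly (map_poly h (pCons a p)) x = h a + x * poly (map_poly h p) x" for a p
    by (simp add: map_poly_pCons h)
  show add: "poly (map_poly h (p + q)) x = poly (map_poly h p) x + poly (map_poly h q) x" for p q
    by (induction p q rule: poly_induct2) (simp_all add: pc h algebra_simps)
  have smult: "poly (map_poly h (smult c p)) x = h c * poly (map_poly h p) x" for c p
    by (induction p) (simp_all add: pc h algebra_simps)
  show "poly (map_poly h (p * q)) x = poly (map_poly h p) x * poly (map_poly h q) x"
    by (induction p) (simp_all add: pc h add smult algebra_simps)
qed

lemma subst_poly_hom:
  "subst_poly x y 1 = 1"
  "subst_poly x y (p + q) = subst_poly x y p + subst_poly x y q"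
  "subst_poly x y (p * q) = subst_poly x y p * subst_poly x y q"
proof -
  note inner = poly_map_poly_hom[of "of_rat", OF of_rat_0 of_rat_1 of_rat_add of_rat_mult, of _ _ y]
  note outer = poly_map_poly_hom[of "\<lambda>c. poly (map_poly of_rat c) y" _ _ x,
      OF _ _ inner(1) inner(2)]
  show "subst_poly x y 1 = 1" by (simp add: subst_poly_def map_poly_1')
  show "subst_poly x y (p + q) = subst_poly x y p + subst_poly x y q"
    unfolding subst_poly_def by (rule outer) (simp_all add: map_poly_1')
  show "subst_poly x y (p * q) = subst_poly x y p * subst_poly x y q"
    unfolding subst_poly_def by (rule outer) (simp_all add: map_poly_1')
qed

text \<open>\<open>subst_ratfun\<close> evaluates the normalised fraction. Two representations agree
  after cross multiplication, and by independence no denominator evaluates to 0, so every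
  representation gives the same value; the homomorphism laws then follow from the formulas for
  fractions.\<close>

lemma subst_ratfun_Fract:
  assumes indep: "\<And>p. subst_poly x y p = 0 \<Longrightarrow> p = 0" and b: "b \<noteq> 0"
  shows "subst_ratfun x y (Fract a b) = subst_poly x y a / subst_poly x y b"
proof -
  obtain a' b' where ab': "quot_of_fract (Fract a b) = (a', b')" by fastforce
  have b': "b' \<noteq> 0" using snd_quot_of_fract_nonzero[of "Fract a b"] ab' by simp
  have "Fract a' b' = Fract a b" using Fract_quot_of_fract[of "Fract a b"] ab' by simp
  then have "a' * b = a * b'" using b b' by (simp add: eq_fract)
  then have "subst_poly x y a' * subst_poly x y b = subst_poly x y a * subst_poly x y b'"
    by (metis subst_poly_hom(3))
  moreover have "subst_poly x y b \<noteq> 0" "subst_poly x y b' \<noteq> 0" using indep b b' by blast+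
  ultimately show ?thesis by (simp add: subst_ratfun_def ab' frac_eq_eq)
qed

lemma field_hom_subst_ratfun:
  assumes indep: "\<And>p. subst_poly x y p = 0 \<Longrightarrow> p = 0"
  shows "field_hom (subst_ratfun x y)"
  unfolding field_hom_def
proof (intro conjI allI)
  note F = subst_ratfun_Fract[OF indep]
  show "subst_ratfun x y 1 = 1" by (simp add: One_fract_def F subst_poly_hom)
  fix r s
  obtain a b c d :: "rat poly poly" where r: "r = Fract a b" "b \<noteq> 0" and s: "s = Fract c d" "d \<noteq> 0"
    by (metis (full_types) Fract_cases)
  have nz: "subst_poly x y b \<noteq> 0" "subst_poly x y d \<noteq> 0" using indep r s by auto
  show "subst_ratfun x y (r + s) = subst_ratfun x y r + subst_ratfun x y s"
    using r s nz by (simp add: F subst_poly_hom add_frac_eq)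
  show "subst_ratfun x y (r * s) = subst_ratfun x y r * subst_ratfun x y s"
    using r s nz by (simp add: F subst_poly_hom)
qed

lemma subst_ratfun_q_t:
  assumes indep: "\<And>p. subst_poly x y p = 0 \<Longrightarrow> p = 0"
  shows "subst_ratfun x y q_ind = x" "subst_ratfun x y t_ind = y"
proof -
  have "subst_ratfun x y (to_fract p) = subst_poly x y p" for p
    by (simp add: subst_ratfun_def quot_of_fract_to_fract subst_poly_hom)
  then show "subst_ratfun x y q_ind = x" "subst_ratfun x y t_ind = y"
    by (simp_all add: q_ind_def t_ind_def) (simp_all add: subst_poly_def map_poly_pCons map_poly_1')
qed

section \<open>Algebraic independence of the substituted values\<close>

lemma poly_eq_sum_le: "degree p \<le> d \<Longrightarrow> poly p x = (\<Sum>i\<le>d. coeff p i * x ^ i)"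
  for p :: "'a::comm_semiring_1 poly"
  unfolding poly_altdef by (rule sum.mono_neutral_left) (auto simp: coeff_eq_0)

lemma subst_poly_sum:
  assumes D: "\<And>i. degree (coeff p i) \<le> D"
  shows "subst_poly x y p = (\<Sum>i\<le>degree p. \<Sum>j\<le>D. of_rat (coeff (coeff p i) j) * y ^ j * x ^ i)"
proof -
  have inner: "poly (map_poly of_rat c) y = (\<Sum>j\<le>D. of_rat (coeff c j) * y ^ j)"
    if "degree c \<le> D" for c :: "rat poly"
    by (subst poly_eq_sum_le[OF order.trans[OF map_poly_degree_leq that]]) (simp add: coeff_map_poly)
  show ?thesis
    unfolding subst_poly_def
    by (subst poly_eq_sum_le[OF map_poly_degree_leq]) (simp add: coeff_map_poly inner[OF D] sum_distrib_right)
qed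

lemma degree_coeff_bound:
  obtains D where "\<And>i. degree (coeff p i) \<le> D"
proof
  fix i
  show "degree (coeff p i) \<le> Max ((\<lambda>i. degree (coeff p i)) ` {..degree p})"
    by (cases "i \<le> degree p") (auto simp: coeff_eq_0)
qed

text \<open>The rationals are a prime field. This identifies \<open>of_rat\<close> with the
  embedding of constants in both fraction fields.\<close>

lemma field_hom_rat_unique:
  fixes h :: "rat \<Rightarrow> 'a::field_char_0"
  assumes "field_hom h"
  shows "h r = of_rat r"
proof (cases r)
  case (Fract a b)
  note h = field_hom_simps[OF assms]
  have nat: "h (of_nat m) = of_nat m" for m by (induction m) (simp_all add: h)
  have int: "h (of_int m) = of_int m" for m
    by (cases m rule: int_cases2) (simp_all add: h nat)
  have "r = of_int a / of_int b" by (simp add: Fract Fract_of_int_quotient)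
  then show ?thesis by (simp add: h int of_rat_divide)
qed

lemma to_fract_power: "to_fract x ^ k = to_fract (x ^ k)"
  by (induction k) simp_all

lemma of_rat_ratfun: "of_rat r = (to_fract [:[:r:]:] :: ratfun)"
proof (rule field_hom_rat_unique[symmetric])
  show "field_hom (\<lambda>r. to_fract [:[:r:]:] :: ratfun)"
    by (simp add: field_hom_def one_pCons[symmetric] to_fract_add[symmetric] to_fract_mult[symmetric] del: to_fract_add to_fract_mult)
qed

lemma of_rat_scalars: "of_rat r = (to_fract (fps_const (fps_const r)) :: scalars)"
proof (rule field_hom_rat_unique[symmetric])
  show "field_hom (\<lambda>r. to_fract (fps_const (fps_const r)) :: scalars)"
    by (simp add: field_hom_def to_fract_add[symmetric] to_fract_mult[symmetric] del: to_fract_add to_fract_mult)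
qed

lemma to_fract_monom_monom:
  "to_fract (monom (monom r j) i) = of_rat r * t_ind ^ j * q_ind ^ i"
proof -
  have 1: "[:[:0, 1:]:] ^ j = [:monom (1::rat) j:]"
    by (induction j) (simp_all add: monom_altdef one_pCons)
  have 2: "[:0, 1:] ^ i = monom (1 :: rat poly) i" by (simp add: monom_altdef)
  have "[:[:r:]:] * [:[:0, 1:]:] ^ j * [:0, 1:] ^ i = monom (monom r j) i"
    unfolding 1 2 by (simp add: smult_monom)
  then show ?thesis
    unfolding of_rat_ratfun q_ind_def t_ind_def to_fract_power to_fract_mult[symmetric] by simp
qed

text \<open>Clearing denominators turns a vanishing \<open>p(1/q, 1/t)\<close> into the vanishing of the
  polynomial with reversed coefficients.\<close>

lemma inverse_indep:
  assumes "subst_poly (inverse q_ind) (inverse t_ind) p = (0 :: ratfun)"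
  shows "p = 0"
proof -
  define d where "d = degree p"
  obtain D where D: "\<And>i. degree (coeff p i) \<le> D" by (rule degree_coeff_bound[of p]) blast
  let ?c = "\<lambda>i j. coeff (coeff p i) j"
  have qt: "q_ind \<noteq> 0" "t_ind \<noteq> 0" by (simp_all add: q_ind_def t_ind_def)
  \<comment> \<open>\<open>R\<close> is q^d t^D p(1/q, 1/t). \<open>D\<close> bounds all inner
    degrees at once, so a single power of t clears every denominator.\<close>
  define R where "R = (\<Sum>i\<le>d. \<Sum>j\<le>D. monom (monom (?c i j) (D - j)) (d - i))"
  have "to_fract R = (\<Sum>i\<le>d. \<Sum>j\<le>D. of_rat (?c i j) * t_ind ^ (D - j) * q_ind ^ (d - i))"
    by (simp add: R_def to_fract_sum to_fract_monom_monom)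
  also have "\<dots> = q_ind ^ d * t_ind ^ D * (\<Sum>i\<le>d. \<Sum>j\<le>D. of_rat (?c i j) * inverse t_ind ^ j * inverse q_ind ^ i)"
    unfolding sum_distrib_left
    by (intro sum.cong refl) (simp add: qt power_diff power_inverse divide_inverse mult_ac)
  also have "\<dots> = 0"
    using assms by (simp add: subst_poly_sum[OF D] d_def)
  finally have R: "R = 0" by simp
  show "p = 0"
  proof (rule poly_eqI, rule poly_eqI)
    fix i j
    show "?c i j = coeff (coeff 0 i) j"
    proof (cases "i \<le> d \<and> j \<le> D")
      case True
      have "coeff (coeff R (d - i)) (D - j) =
          (\<Sum>i'\<le>d. \<Sum>j'\<le>D. if i' = i \<and> j' = j then ?c i j else 0)"
        unfolding R_def coeff_sum using True by (intro sum.cong refl) (auto simp: eq_diff_iff)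
      also have "\<dots> = (\<Sum>i'\<le>d. if i' = i then \<Sum>j'\<le>D. if j' = j then ?c i j else 0 else 0)"
        by (intro sum.cong refl) simp
      also have "\<dots> = ?c i j" using True by simp
      finally show ?thesis using R by simp
    next
      case False
      then show ?thesis using D[of i] by (auto simp: d_def coeff_eq_0)
    qed
  qed
qed

text \<open>\<open>R\<close> is p read as a power series in q and t, with the same
  coefficients.\<close>

lemma embed_indep:
  assumes "subst_poly (to_fract fps_X) (to_fract (fps_const fps_X)) p = (0 :: scalars)"
  shows "p = 0"
proof -
  obtain D where D: "\<And>i. degree (coeff p i) \<le> D" by (rule degree_coeff_bound[of p]) blast
  let ?c = "\<lambda>i j. coeff (coeff p i) j"
  define R where "R = (\<Sum>i\<le>degree p. \<Sum>j\<le>D. fps_const (fps_const (?c i j) * fps_X ^ j) * fps_X ^ i)"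
  have "to_fract R = (0 :: scalars)"
    using assms unfolding subst_poly_sum[OF D] R_def of_rat_scalars to_fract_power
    by (simp add: to_fract_sum fps_const_power flip: to_fract_mult fps_const_mult)
  then have R: "R = 0" by simp
  show "p = 0"
  proof (rule poly_eqI, rule poly_eqI)
    fix i j
    show "?c i j = coeff (coeff 0 i) j"
    proof (cases "i \<le> degree p \<and> j \<le> D")
      case True
      have "fps_nth (fps_nth R i) j =
          (\<Sum>i'\<le>degree p. \<Sum>j'\<le>D. if i' = i \<and> j' = j then ?c i j else 0)"
        unfolding R_def fps_sum_nth by (intro sum.cong refl) auto
      also have "\<dots> = (\<Sum>i'\<le>degree p. if i' = i then \<Sum>j'\<le>D. if j' = j then ?c i j else 0 else 0)"
        by (intro sum.cong refl) simp
      also have "\<dots> = ?c i j" using True by simp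
      finally show ?thesis using R by simp
    next
      case False
      then show ?thesis using D[of i] by (auto simp: coeff_eq_0)
    qed
  qed
qed

lemma field_hom_qt_invert: "field_hom qt_invert"
  unfolding qt_invert_def by (rule field_hom_subst_ratfun[OF inverse_indep])

lemma field_hom_embed_qt: "field_hom embed_qt"
  unfolding embed_qt_def by (rule field_hom_subst_ratfun[OF embed_indep])

lemmas qt_invert_simps = field_hom_simps[OF field_hom_qt_invert]
lemmas embed_qt_simps = field_hom_simps[OF field_hom_embed_qt]

lemma qt_invert_q_t: "qt_invert q_ind = inverse q_ind" "qt_invert t_ind = inverse t_ind"
  unfolding qt_invert_def by (rule subst_ratfun_q_t, erule inverse_indep)+

lemma embed_qt_q_t: "embed_qt q_ind = to_fract fps_X" "embed_qt t_ind = to_fract (fps_const fps_X)"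
  unfolding embed_qt_def by (rule subst_ratfun_q_t, erule embed_indep)+

lemma qt_nonzero: "q_ind \<noteq> 0" "t_ind \<noteq> 0"
  by (simp_all add: q_ind_def t_ind_def)

section \<open>Operators on Laurent polynomials\<close>

lemma laurent_as_sum: "f = (\<Sum>\<alpha>\<in>Poly_Mapping.keys f. Poly_Mapping.single \<alpha> (Poly_Mapping.lookup f \<alpha>))"
  for f :: "'k \<Rightarrow>\<^sub>0 'a::comm_monoid_add"
  by (rule poly_mapping_eqI) (auto simp: lookup_sum lookup_single when_def in_keys_iff)

lemma laurent_induct [case_names add single]:
  fixes f :: "'k \<Rightarrow>\<^sub>0 'a::comm_monoid_add"
  assumes add: "\<And>f g. P f \<Longrightarrow> P g \<Longrightarrow> P (f + g)" and single: "\<And>\<alpha> c. P (Poly_Mapping.single \<alpha> c)"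
  shows "P f"
proof -
  have "P 0" using single[of _ 0] by simp
  then have "P (\<Sum>\<alpha>\<in>A. Poly_Mapping.single \<alpha> (Poly_Mapping.lookup f \<alpha>))" for A
    by (induction A rule: infinite_finite_induct) (auto intro: add single)
  then show ?thesis by (metis laurent_as_sum)
qed

text \<open>Cancellation can make the support of f + g smaller than the union of the supports; since
  \<open>G\<close> vanishes at coefficient 0, all three sums may run over that union.\<close>

lemma sum_keys_add:
  fixes f g :: "'k \<Rightarrow>\<^sub>0 'a::comm_monoid_add" and G :: "'k \<Rightarrow> 'a \<Rightarrow> 'b::comm_monoid_add"
  assumes G: "\<And>\<alpha>. G \<alpha> 0 = 0" "\<And>\<alpha> c d. G \<alpha> (c + d) = G \<alpha> c + G \<alpha> d"
  shows "(\<Sum>\<alpha>\<in>Poly_Mapping.keys (f + g). G \<alpha> (Poly_Mapping.lookup (f + g) \<alpha>)) =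
    (\<Sum>\<alpha>\<in>Poly_Mapping.keys f. G \<alpha> (Poly_Mapping.lookup f \<alpha>)) +
    (\<Sum>\<alpha>\<in>Poly_Mapping.keys g. G \<alpha> (Poly_Mapping.lookup g \<alpha>))"
proof -
  let ?K = "Poly_Mapping.keys f \<union> Poly_Mapping.keys g"
  have ext: "(\<Sum>\<alpha>\<in>Poly_Mapping.keys h. G \<alpha> (Poly_Mapping.lookup h \<alpha>)) = (\<Sum>\<alpha>\<in>?K. G \<alpha> (Poly_Mapping.lookup h \<alpha>))"
    if "Poly_Mapping.keys h \<subseteq> ?K" for h
    using that by (intro sum.mono_neutral_left) (auto simp: in_keys_iff G)
  have "Poly_Mapping.keys (f + g) \<subseteq> ?K" by (rule Poly_Mapping.keys_add)
  then have "(\<Sum>\<alpha>\<in>Poly_Mapping.keys (f + g). G \<alpha> (Poly_Mapping.lookup (f + g) \<alpha>)) =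
      (\<Sum>\<alpha>\<in>?K. G \<alpha> (Poly_Mapping.lookup (f + g) \<alpha>))" by (rule ext)
  then show ?thesis unfolding lookup_add G sum.distrib by (simp add: ext)
qed

text \<open>\<open>psi\<close> may depend on the exponent because \<open>omega0\<close> multiplies
  the monomial of \<alpha> by a power of q given by its first entry.\<close>

lemma laurent_mult_hom:
  fixes h :: "('k::ab_group_add \<Rightarrow>\<^sub>0 'a::comm_ring_1) \<Rightarrow> ('k \<Rightarrow>\<^sub>0 'b::comm_ring_1)"
  assumes add: "\<And>f g. h (f + g) = h f + h g"
    and h_single: "\<And>\<alpha> c. h (Poly_Mapping.single \<alpha> c) = Poly_Mapping.single (phi \<alpha>) (psi \<alpha> c)"
    and phi: "\<And>\<alpha> \<beta>. phi (\<alpha> + \<beta>) = phi \<alpha> + phi \<beta>"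
    and psi: "\<And>\<alpha> \<beta> c d. psi (\<alpha> + \<beta>) (c * d) = psi \<alpha> c * psi \<beta> d"
  shows "h (f * g) = h f * h g"
proof (induction f rule: laurent_induct)
  case (single \<alpha> c)
  show ?case
    by (induction g rule: laurent_induct) (simp_all add: distrib_left add h_single phi psi mult_single)
qed (simp add: add distrib_right)

lemma lookup_swap_vars: "Poly_Mapping.lookup (swap_vars i f) \<alpha> = Poly_Mapping.lookup f (swap_expo i \<alpha>)"
proof -
  have "inj (swap_expo i)" by (metis injI swap_expo_involutive)
  then show ?thesis
    unfolding swap_vars_def swap_expo_def[symmetric] by (simp add: map_key.rep_eq)
qed

lemma swap_vars_add: "swap_vars i (f + g) = swap_vars i f + swap_vars i g"
  by (rule poly_mapping_eqI) (simp add: lookup_swap_vars lookup_add)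

lemma swap_vars_diff: "swap_vars i (f - g) = swap_vars i f - swap_vars i g"
  by (rule poly_mapping_eqI) (simp add: lookup_swap_vars lookup_minus)

lemma swap_vars_uminus: "swap_vars i (- f) = - swap_vars i f"
  by (rule poly_mapping_eqI) (simp add: lookup_swap_vars)

lemma swap_vars_single:
  "swap_vars i (Poly_Mapping.single \<alpha> c) = Poly_Mapping.single (swap_expo i \<alpha>) c"
  by (rule poly_mapping_eqI) (auto simp: lookup_swap_vars lookup_single when_def)

lemma swap_vars_mult: "swap_vars i (f * g) = swap_vars i f * swap_vars i g"
  by (rule laurent_mult_hom[where phi = "swap_expo i" and psi = "\<lambda>_ c. c"])
    (simp_all add: swap_vars_add swap_vars_single swap_expo_add)

lemma swap_vars_involutive [simp]: "swap_vars i (swap_vars i f) = f"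
  by (rule poly_mapping_eqI) (simp add: lookup_swap_vars)

text \<open>Writing scalars as constant Laurent polynomials turns operator identities into
  identities in a single commutative ring.\<close>

definition lconst :: "ratfun \<Rightarrow> ratfun laurent" where
  "lconst c = Poly_Mapping.single 0 c"

lemma smul_eq: "smul c f = lconst c * f"
  by (simp add: smul_def lconst_def)

lemma lconst_simps:
  "lconst 0 = 0" "lconst 1 = 1" "lconst (c + d) = lconst c + lconst d" "lconst (c * d) = lconst c * lconst d"
  "lconst (- c) = - lconst c" "lconst (c - d) = lconst c - lconst d"
  by (simp_all add: lconst_def single_add single_uminus single_diff mult_single)

lemma lconst_eq_0_iff: "lconst c = 0 \<longleftrightarrow> c = 0"
  by (metis lconst_def lconst_simps(1) lookup_single_eq lookup_zero)

lemma swap_vars_lconst [simp]: "swap_vars i (lconst c) = lconst c"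
  by (simp add: lconst_def swap_vars_single)

lemma swap_vars_zvar: "swap_vars i (zvar j) = zvar (simple_refl i j)"
  by (simp add: zvar_def zmon_def swap_vars_single swap_expo_single)

lemmas swap_simps = swap_vars_add swap_vars_diff swap_vars_uminus swap_vars_mult swap_vars_lconst swap_vars_zvar
  swap_vars_involutive

lemma zvar_diff_neq_0: "i \<noteq> j \<Longrightarrow> zvar i - zvar j \<noteq> (0 :: ratfun laurent)"
proof
  assume "i \<noteq> j" "zvar i - zvar j = (0 :: ratfun laurent)"
  then have "Poly_Mapping.lookup (zvar i :: ratfun laurent) (Poly_Mapping.single i 1) =
      Poly_Mapping.lookup (zvar j :: ratfun laurent) (Poly_Mapping.single i 1)" by simp
  moreover have "Poly_Mapping.single j (1::int) \<noteq> Poly_Mapping.single i 1"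
    using \<open>i \<noteq> j\<close> single_diff_neq_0[of j i] by auto
  ultimately show False by (simp add: zvar_def zmon_def lookup_single when_def)
qed

text \<open>The f with this property are closed under sums and products. The exponents whose
  monomials have it form a subgroup containing all unit vectors, hence contain every
  exponent.\<close>

lemma swap_diff_dvd: "zvar i - zvar (i + 1) dvd swap_vars i f - f"
proof -
  let ?V = "zvar i - zvar (i + 1) :: ratfun laurent"
  have s: "simple_refl i i = i + 1" "simple_refl i (i + 1) = i" by (simp_all add: simple_refl_def)
  have mult: "?V dvd swap_vars i (f * g) - f * g" if "?V dvd swap_vars i f - f" "?V dvd swap_vars i g - g" for f g
  proof -
    have "swap_vars i (f * g) - f * g = (swap_vars i f - f) * swap_vars i g + f * (swap_vars i g - g)"
      by (simp add: swap_vars_mult algebra_simps)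
    then show ?thesis using that by simp
  qed
  have one: "?V dvd swap_vars i 1 - 1"
    using swap_vars_lconst[of i 1] by (simp add: lconst_simps)
  have var: "?V dvd swap_vars i (zvar j) - zvar j" for j
  proof (cases "j = i \<or> j = i + 1")
    case True
    then show ?thesis using s dvd_refl[of ?V] minus_diff_eq[of "zvar i" "zvar (i + 1) :: ratfun laurent"]
      by (metis dvd_minus_iff swap_vars_zvar)
  next
    case False
    then show ?thesis by (simp add: swap_vars_zvar simple_refl_def)
  qed
  have zmon_add: "zmon (\<alpha> + \<beta>) = (zmon \<alpha> * zmon \<beta> :: ratfun laurent)" for \<alpha> \<beta>
    by (simp add: zmon_def mult_single)
  have zmon_0: "zmon 0 = (1 :: ratfun laurent)" by (simp add: zmon_def single_one)
  define D where "D \<alpha> \<longleftrightarrow> ?V dvd swap_vars i (zmon \<alpha>) - zmon \<alpha>" for \<alpha> :: expo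
  have D_add: "D (\<alpha> + \<beta>)" if "D \<alpha>" "D \<beta>" for \<alpha> \<beta>
    using mult[OF that[unfolded D_def]] by (simp add: D_def zmon_add)
  have D_0: "D 0" using one by (simp add: D_def zmon_0)
  have D_uminus: "D (- \<alpha>)" if "D \<alpha>" for \<alpha>
  proof -
    have inv: "zmon (- \<alpha>) * zmon \<alpha> = (1 :: ratfun laurent)"
      by (simp add: zmon_add[symmetric] zmon_0)
    then have inv': "swap_vars i (zmon (- \<alpha>)) * swap_vars i (zmon \<alpha>) = 1"
      using swap_vars_lconst[of i 1] by (simp add: lconst_simps swap_vars_mult[symmetric])
    \<comment> \<open>For an invertible monomial M this is s(1/M) - 1/M = - (s(M) - M) / (M s(M)),
      with s = s_i.\<close>
    have "swap_vars i (zmon (- \<alpha>)) - zmon (- \<alpha>) =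
        (- zmon (- \<alpha>) * swap_vars i (zmon (- \<alpha>))) * (swap_vars i (zmon \<alpha>) - zmon \<alpha>)"
      using inv inv' by algebra
    then show ?thesis using that by (simp add: D_def)
  qed
  have D_single: "D (Poly_Mapping.single j m)" for j m
  proof -
    have nat: "D (Poly_Mapping.single j (int k))" for k
    proof (induction k)
      case (Suc k)
      have "D (Poly_Mapping.single j 1)" using var[of j] by (simp add: D_def zvar_def)
      then have "D (Poly_Mapping.single j 1 + Poly_Mapping.single j (int k))" using Suc by (rule D_add)
      then show ?case by (simp add: single_add[symmetric])
    qed (simp add: D_0)
    show ?thesis
    proof (cases m rule: int_cases2)
      case (nonpos k)
      then show ?thesis using D_uminus[OF nat[of k]] by (simp add: single_uminus[symmetric])
    qed (simp add: nat)
  qed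
  \<comment> \<open>Exponents are themselves finitely supported functions, so the induction rule for
    Laurent polynomials also applies to them.\<close>
  have D: "D \<alpha>" for \<alpha> by (induction \<alpha> rule: laurent_induct) (auto intro: D_add D_single)
  show ?thesis
  proof (induction f rule: laurent_induct)
    case (add f g)
    then have "?V dvd (swap_vars i f - f) + (swap_vars i g - g)" by (rule dvd_add)
    then show ?case by (simp add: swap_vars_add algebra_simps)
  next
    case (single \<alpha> c)
    have "Poly_Mapping.single \<alpha> c = lconst c * zmon \<alpha>" by (simp add: lconst_def zmon_def mult_single)
    moreover have "?V dvd swap_vars i (lconst c) - lconst c" by simp
    ultimately show ?case using mult D[of \<alpha>] by (simp add: D_def del: swap_vars_lconst)
  qed
qed

section \<open>The Hecke algebra relations\<close>

lemma div_diff_eq: "(zvar i - zvar (i + 1)) * div_diff i f = swap_vars i f - f"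
proof -
  obtain g where g: "swap_vars i f - f = (zvar i - zvar (i + 1)) * g"
    using swap_diff_dvd[of i f] by (auto elim: dvdE)
  then have "\<exists>!g. (zvar i - zvar (i + 1)) * g = swap_vars i f - f"
    using zvar_diff_neq_0[of i "i + 1"] by (intro ex1I[of _ g]) auto
  from theI'[OF this] show ?thesis unfolding div_diff_def .
qed

abbreviation tt :: "ratfun laurent" where "tt \<equiv> lconst t_ind"

text \<open>T_i with its denominator cleared. The relations below are proved by multiplying with
  such denominators, comparing in the Laurent ring, and cancelling.\<close>

lemma T_op_eq:
  "(zvar i - zvar (i + 1)) * T_op i f =
    (1 - tt) * zvar (i + 1) * f + (tt * zvar i - zvar (i + 1)) * swap_vars i f"
proof -
  have "(zvar i - zvar (i + 1)) * T_op i f = (zvar i - zvar (i + 1)) * (tt * f) +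
      (tt * zvar i - zvar (i + 1)) * ((zvar i - zvar (i + 1)) * div_diff i f)"
    by (simp add: T_op_def smul_eq algebra_simps)
  then show ?thesis unfolding div_diff_eq by (simp add: algebra_simps)
qed

lemma zvar_diff_cancel: "i \<noteq> j \<Longrightarrow> (zvar i - zvar j) * f = (zvar i - zvar j) * g \<Longrightarrow> f = (g :: ratfun laurent)"
  using zvar_diff_neq_0[of i j] by auto

lemma T_op_add: "T_op i (f + g) = T_op i f + T_op i g"
proof (rule zvar_diff_cancel[of i "i + 1"])
  show "(zvar i - zvar (i + 1)) * T_op i (f + g) = (zvar i - zvar (i + 1)) * (T_op i f + T_op i g)"
    unfolding distrib_left T_op_eq swap_vars_add by (simp add: algebra_simps)
qed simp

lemma T_op_mult_lconst: "T_op i (lconst c * f) = lconst c * T_op i f"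
proof (rule zvar_diff_cancel[of i "i + 1"])
  have "(zvar i - zvar (i + 1)) * (lconst c * T_op i f) = lconst c * ((zvar i - zvar (i + 1)) * T_op i f)"
    by (simp add: algebra_simps)
  then show "(zvar i - zvar (i + 1)) * T_op i (lconst c * f) = (zvar i - zvar (i + 1)) * (lconst c * T_op i f)"
    unfolding T_op_eq swap_simps by (simp add: algebra_simps)
qed simp

lemma T_op_sum: "T_op i (\<Sum>x\<in>A. f x) = (\<Sum>x\<in>A. T_op i (f x))"
proof -
  have "T_op i 0 = 0" using T_op_add[of i 0 0] by simp
  then show ?thesis by (induction A rule: infinite_finite_induct) (simp_all add: T_op_add)
qed

lemma swap_T_op:
  "(zvar (i + 1) - zvar i) * swap_vars i (T_op i f) =
    (1 - tt) * zvar i * swap_vars i f + (tt * zvar (i + 1) - zvar i) * f"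
proof -
  have s: "simple_refl i i = i + 1" "simple_refl i (i + 1) = i" by (simp_all add: simple_refl_def)
  have one: "swap_vars i 1 = 1" using swap_vars_lconst[of i 1] by (simp add: lconst_simps)
  from arg_cong[OF T_op_eq[of i f], of "swap_vars i"] show ?thesis
    unfolding swap_simps s one .
qed

text \<open>The Hecke relation (T_i - t)(T_i + 1) = 0. Applying T_i twice requires s_i(T_i f), which
  \<open>swap_T_op\<close> provides.\<close>

lemma T_op_quadratic: "T_op i (T_op i f) = (tt - 1) * T_op i f + tt * f"
proof -
  let ?V = "zvar i - zvar (i + 1) :: ratfun laurent"
  have nz: "?V \<noteq> 0" by (rule zvar_diff_neq_0) simp
  have "?V * (?V * T_op i (T_op i f)) = ?V * (?V * ((tt - 1) * T_op i f + tt * f))"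
    using T_op_eq[of i "T_op i f"] swap_T_op[of i f] T_op_eq[of i f] by algebra
  then show ?thesis using nz by simp
qed

lemma simple_refl_commute:
  "i + 1 < j \<Longrightarrow> simple_refl i (simple_refl j k) = simple_refl j (simple_refl i k)"
  by (auto simp: simple_refl_def Transposition.transpose_def)

lemma simple_refl_braid:
  "simple_refl i (simple_refl (i + 1) (simple_refl i k)) = simple_refl (i + 1) (simple_refl i (simple_refl (i + 1) k))"
  by (auto simp: simple_refl_def Transposition.transpose_def)

lemma T_op_commute:
  assumes "i + 1 < j"
  shows "T_op i (T_op j f) = T_op j (T_op i f)"
proof -
  let ?V = "zvar i - zvar (i + 1) :: ratfun laurent" and ?U = "zvar j - zvar (j + 1) :: ratfun laurent"
  have nz: "?V \<noteq> 0" "?U \<noteq> 0" by (rule zvar_diff_neq_0; simp)+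
  have si: "simple_refl i j = j" "simple_refl i (j + 1) = j + 1" "simple_refl j i = i" "simple_refl j (i + 1) = i + 1"
    using assms by (simp_all add: simple_refl_def)
  have one: "swap_vars i 1 = 1" for i using swap_vars_lconst[of i 1] by (simp add: lconst_simps)
  have "swap_expo i (swap_expo j \<alpha>) = swap_expo j (swap_expo i \<alpha>)" for \<alpha>
    using simple_refl_commute[OF assms] by (intro poly_mapping_eqI) (simp add: lookup_swap_expo)
  then have ss: "swap_vars i (swap_vars j f) = swap_vars j (swap_vars i f)"
    by (intro poly_mapping_eqI) (simp add: lookup_swap_vars)
  have e1: "?U * swap_vars i (T_op j f) = (1 - tt) * zvar (j + 1) * swap_vars i f +
      (tt * zvar j - zvar (j + 1)) * swap_vars i (swap_vars j f)"
    using arg_cong[OF T_op_eq[of j f], of "swap_vars i"] unfolding swap_simps si one .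
  have e2: "?V * swap_vars j (T_op i f) = (1 - tt) * zvar (i + 1) * swap_vars j f +
      (tt * zvar i - zvar (i + 1)) * swap_vars j (swap_vars i f)"
    using arg_cong[OF T_op_eq[of i f], of "swap_vars j"] unfolding swap_simps si one .
  have "?V * ?U * T_op i (T_op j f) = ?V * ?U * T_op j (T_op i f)"
    using T_op_eq[of i "T_op j f"] T_op_eq[of j "T_op i f"] T_op_eq[of i f] T_op_eq[of j f] e1 e2 ss
    by algebra
  then show ?thesis using nz by simp
qed


text \<open>The braid relation with the operators eliminated. Digits record applied reflections, as
  in f12 = s_1 s_2 f; one side is a = T_1 f, b = T_2 a, c = T_1 b, the other d = T_2 f, e = T_1 d, g
  = T_2 e. The six images of f are treated as independent unknowns, and both sides are compared over
  the common denominator \<open>?P\<close>.\<close>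

lemma braid_relation_idom:
  fixes x y z t :: "'a::idom"
  assumes nz: "x \<noteq> y" "y \<noteq> z" "x \<noteq> z"
    and a: "(x - y) * a = (1 - t) * y * f + (t * x - y) * f1"
    and a2: "(x - z) * a2 = (1 - t) * z * f2 + (t * x - z) * f21"
    and a1: "(y - x) * a1 = (1 - t) * x * f1 + (t * y - x) * f"
    and a12: "(y - z) * a12 = (1 - t) * z * f12 + (t * y - z) * f121"
    and b: "(y - z) * b = (1 - t) * z * a + (t * y - z) * a2"
    and b1: "(x - z) * b1 = (1 - t) * z * a1 + (t * x - z) * a12"
    and c: "(x - y) * c = (1 - t) * y * b + (t * x - y) * b1"
    and d: "(y - z) * d = (1 - t) * z * f + (t * y - z) * f2"
    and d1: "(x - z) * d1 = (1 - t) * z * f1 + (t * x - z) * f12"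
    and d2: "(z - y) * d2 = (1 - t) * y * f2 + (t * z - y) * f"
    and d21: "(x - y) * d21 = (1 - t) * y * f21 + (t * x - y) * f121"
    and e: "(x - y) * e = (1 - t) * y * d + (t * x - y) * d1"
    and e2: "(x - z) * e2 = (1 - t) * z * d2 + (t * x - z) * d21"
    and g: "(y - z) * g = (1 - t) * z * e + (t * y - z) * e2"
  shows "c = g"
proof -
  have b': "(x - y) * (x - z) * (y - z) * b = (1 - t) * z * (x - z) * ((1 - t) * y * f + (t * x - y) * f1) +
      (t * y - z) * (x - y) * ((1 - t) * z * f2 + (t * x - z) * f21)"
    using a a2 b by algebra
  have b1': "(x - y) * (x - z) * (y - z) * b1 = - (1 - t) * z * (y - z) * ((1 - t) * x * f1 + (t * y - x) * f) +
      (t * x - z) * (x - y) * ((1 - t) * z * f12 + (t * y - z) * f121)"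
    using a1 a12 b1 by algebra
  have e': "(x - y) * (x - z) * (y - z) * e = (1 - t) * y * (x - z) * ((1 - t) * z * f + (t * y - z) * f2) +
      (t * x - y) * (y - z) * ((1 - t) * z * f1 + (t * x - z) * f12)"
    using d d1 e by algebra
  have e2': "(x - y) * (x - z) * (y - z) * e2 = - (1 - t) * z * (x - y) * ((1 - t) * y * f2 + (t * z - y) * f) +
      (t * x - z) * (y - z) * ((1 - t) * y * f21 + (t * x - y) * f121)"
    using d2 d21 e2 by algebra
  let ?P = "(x - y) * (x - z) * (y - z)"
  have "(x - y) * (y - z) * (?P * c) = (y - z) * ((1 - t) * y * (?P * b) + (t * x - y) * (?P * b1))"
    using c by algebra
  also have "\<dots> = (x - y) * ((1 - t) * z * (?P * e) + (t * y - z) * (?P * e2))"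
    unfolding b' b1' e' e2' by algebra
  also have "\<dots> = (x - y) * (y - z) * (?P * g)"
    using g by algebra
  finally show ?thesis using nz by simp
qed

lemma T_op_braid: "T_op i (T_op (i + 1) (T_op i f)) = T_op (i + 1) (T_op i (T_op (i + 1) f))"
proof -
  let ?s1 = "swap_vars i" and ?s2 = "swap_vars (i + 1)"
  let ?x = "zvar i :: ratfun laurent" and ?y = "zvar (i + 1) :: ratfun laurent" and ?z = "zvar (i + 2) :: ratfun laurent"
  have one: "swap_vars i 1 = 1" for i using swap_vars_lconst[of i 1] by (simp add: lconst_simps)
  have s: "simple_refl i i = i + 1" "simple_refl i (i + 1) = i" "simple_refl i (i + 2) = i + 2"
    "simple_refl (i + 1) i = i" "simple_refl (i + 1) (i + 1) = i + 2" "simple_refl (i + 1) (i + 2) = i + 1"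
    by (simp_all add: simple_refl_def)
  note ss = swap_vars_add swap_vars_diff swap_vars_mult swap_vars_lconst swap_vars_zvar swap_vars_involutive s one
  have i2: "i + 1 + 1 = i + 2" by simp
  have nz: "?x \<noteq> ?y" "?y \<noteq> ?z" "?x \<noteq> ?z"
    using zvar_diff_neq_0[of i "i + 1"] zvar_diff_neq_0[of "i + 1" "i + 2"] zvar_diff_neq_0[of i "i + 2"] by auto
  note T1 = T_op_eq[of i] and T2 = T_op_eq[of "i + 1", unfolded i2]
  note sT1 = T1[THEN arg_cong[where f = ?s1], unfolded ss] and s2T1 = T1[THEN arg_cong[where f = ?s2], unfolded ss]
    and sT2 = T2[THEN arg_cong[where f = ?s1], unfolded ss] and s2T2 = T2[THEN arg_cong[where f = ?s2], unfolded ss]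
  have "swap_expo i (swap_expo (i + 1) (swap_expo i \<alpha>)) = swap_expo (i + 1) (swap_expo i (swap_expo (i + 1) \<alpha>))" for \<alpha>
    by (intro poly_mapping_eqI) (simp only: lookup_swap_expo simple_refl_braid)
  then have br: "?s1 (?s2 (?s1 f)) = ?s2 (?s1 (?s2 f))"
    by (intro poly_mapping_eqI) (simp only: lookup_swap_vars)
  note s12T1 = s2T1[THEN arg_cong[where f = ?s1], unfolded ss]
  \<comment> \<open>The image f121 arises as s_1 s_2 s_1 f on one side and as s_2 s_1 s_2 f on the
    other; \<open>br\<close> makes them the same unknown.\<close>
  note s21T2 = sT2[THEN arg_cong[where f = ?s2], unfolded ss br[symmetric]]
  show ?thesis
    by (rule braid_relation_idom[OF nz, where t = tt])
      (rule T1 T2 sT1 s2T1 sT2 s2T2 s12T1[of f] s21T2[of f] s21T2[of f, unfolded br[symmetric]])+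
qed

section \<open>Unitarity\<close>

lemma lookup_invert_all: "Poly_Mapping.lookup (invert_all g) \<alpha> = qt_invert (Poly_Mapping.lookup g (- \<alpha>))"
  by (simp add: invert_all_def map_key.rep_eq map.rep_eq when_def qt_invert_simps)

lemma invert_all_add: "invert_all (f + g) = invert_all f + invert_all g"
  by (rule poly_mapping_eqI) (simp add: lookup_invert_all lookup_add qt_invert_simps)

lemma invert_all_diff: "invert_all (f - g) = invert_all f - invert_all g"
  by (rule poly_mapping_eqI) (simp add: lookup_invert_all lookup_minus qt_invert_simps)

lemma invert_all_single: "invert_all (Poly_Mapping.single \<alpha> c) = Poly_Mapping.single (- \<alpha>) (qt_invert c)"
  by (rule poly_mapping_eqI) (auto simp: lookup_invert_all lookup_single when_def qt_invert_simps)

lemma invert_all_mult: "invert_all (f * g) = invert_all f * invert_all g"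
  by (rule laurent_mult_hom[where phi = uminus and psi = "\<lambda>_. qt_invert"])
    (simp_all add: invert_all_add invert_all_single qt_invert_simps)

lemma invert_all_lconst: "invert_all (lconst c) = lconst (qt_invert c)"
  by (simp add: lconst_def invert_all_single)

lemma invert_all_swap: "invert_all (swap_vars i f) = swap_vars i (invert_all f)"
  by (rule poly_mapping_eqI) (simp add: lookup_invert_all lookup_swap_vars swap_expo_uminus)

text \<open>Conjugating T_i by the inversion of z, q, t gives the inverse of T_i. This part of
  unitarity does not involve the weight.\<close>

lemma T_op_invert_all_T_op: "T_op i (invert_all (T_op i g)) = invert_all g"
proof -
  let ?x = "zvar i :: ratfun laurent" and ?y = "zvar (i + 1) :: ratfun laurent"
  define G where "G = invert_all g"
  define K where "K = invert_all (T_op i g)"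
  define X where "X = invert_all ?x"
  define Y where "Y = invert_all ?y"
  define u where "u = lconst (inverse t_ind)"
  have X: "?x * X = 1" and Y: "?y * Y = 1"
    by (simp_all add: X_def Y_def zvar_def zmon_def invert_all_single mult_single qt_invert_simps single_one)
  have u: "tt * u = 1" by (simp add: u_def lconst_simps(4)[symmetric] qt_nonzero lconst_simps)
  have one: "invert_all 1 = 1" using invert_all_lconst[of 1] by (simp add: lconst_simps qt_invert_simps)
  have e: "(X - Y) * K = (1 - u) * Y * G + (u * X - Y) * swap_vars i G"
    using arg_cong[OF T_op_eq[of i g], of invert_all]
    unfolding invert_all_add invert_all_diff invert_all_mult invert_all_lconst invert_all_swap one
      qt_invert_q_t G_def K_def X_def Y_def u_def .
  \<comment> \<open>Equation \<open>e\<close> multiplied by t z_i z_(i+1), which removes all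
    inverses.\<close>
  have e': "tt * (?y - ?x) * K = (tt - 1) * ?x * G + (?y - tt * ?x) * swap_vars i G"
    using e X Y u by algebra
  have s: "simple_refl i i = i + 1" "simple_refl i (i + 1) = i" by (simp_all add: simple_refl_def)
  have one': "swap_vars i 1 = 1" using swap_vars_lconst[of i 1] by (simp add: lconst_simps)
  have se': "tt * (?x - ?y) * swap_vars i K = (tt - 1) * ?y * swap_vars i G + (?x - tt * ?y) * G"
    using arg_cong[OF e', of "swap_vars i"] unfolding swap_simps s one' .
  have nz: "?x - ?y \<noteq> 0" "tt \<noteq> 0"
    using zvar_diff_neq_0[of i "i + 1"] by (simp_all add: lconst_eq_0_iff qt_nonzero)
  have "tt * (?x - ?y) * ((?x - ?y) * T_op i K) = tt * (?x - ?y) * ((?x - ?y) * G)"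
    using T_op_eq[of i K] e' se' by algebra
  then show ?thesis using nz by (simp add: K_def G_def)
qed

lemma weighted_CT_add: "weighted_CT n (f + g) = weighted_CT n f + weighted_CT n g"
  unfolding weighted_CT_def
  by (rule sum_keys_add[where G = "\<lambda>\<alpha> c. embed_qt c * to_fract (weight_coeff n (- \<alpha>))"])
    (simp_all add: embed_qt_simps algebra_simps)

lemma weighted_CT_single:
  "weighted_CT n (Poly_Mapping.single \<alpha> c) = embed_qt c * to_fract (weight_coeff n (- \<alpha>))"
  by (simp add: weighted_CT_def embed_qt_simps)

lemma weighted_CT_uminus: "weighted_CT n (- f) = - weighted_CT n f"
proof -
  have "weighted_CT n (- f) + weighted_CT n f = weighted_CT n 0"
    by (simp add: weighted_CT_add[symmetric])
  then show ?thesis by (simp add: weighted_CT_def eq_neg_iff_add_eq_0)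
qed

lemma weighted_CT_diff: "weighted_CT n (f - g) = weighted_CT n f - weighted_CT n g"
  using weighted_CT_add[of n f "- g"] by (simp add: weighted_CT_uminus)

lemma weighted_CT_lconst: "weighted_CT n (lconst c * f) = embed_qt c * weighted_CT n f"
  by (induction f rule: laurent_induct)
    (simp_all add: distrib_left weighted_CT_add lconst_def mult_single weighted_CT_single embed_qt_simps mult.assoc)

text \<open>Against W the factor t z_i - z_(i+1) becomes antisymmetric, so its product with a
  symmetric polynomial has no constant term. On monomials this is
  \<open>weight_coeff_swap\<close>.\<close>

lemma weighted_CT_antisymmetric:
  assumes i: "i \<in> {1..<n}"
  shows "weighted_CT n ((tt * zvar i - zvar (i + 1)) * (h + swap_vars i h)) = 0"
proof (induction h rule: laurent_induct)
  case (add f g)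
  have "(tt * zvar i - zvar (i + 1)) * (f + g + swap_vars i (f + g)) =
      (tt * zvar i - zvar (i + 1)) * (f + swap_vars i f) + (tt * zvar i - zvar (i + 1)) * (g + swap_vars i g)"
    by (simp add: swap_vars_add algebra_simps)
  then show ?case using add by (simp only: weighted_CT_add add_0)
next
  case (single \<alpha> c)
  let ?i = "Poly_Mapping.single i (1::int)" and ?j = "Poly_Mapping.single (i + 1) (1::int)"
  have A: "(tt * zvar i - zvar (i + 1)) * Poly_Mapping.single \<beta> c =
      Poly_Mapping.single (\<beta> + ?i) (t_ind * c) - Poly_Mapping.single (\<beta> + ?j) c" for \<beta>
    by (simp add: lconst_def zvar_def zmon_def left_diff_distrib mult_single add.commute)
  let ?w = "weight_coeff n"
  have neg: "- (\<beta> + \<gamma>) = - \<beta> - \<gamma>" for \<beta> \<gamma> :: expo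
    by (simp only: minus_add_distrib add_uminus_conv_diff)
  have w: "to_fract (fps_const fps_X) * (to_fract (?w (- \<alpha> - ?i)) + to_fract (?w (- swap_expo i \<alpha> - ?i))) =
      to_fract (?w (- \<alpha> - ?j)) + to_fract (?w (- swap_expo i \<alpha> - ?j))"
    using arg_cong[OF weight_coeff_swap[OF i, of "- \<alpha>"], of to_fract]
    by (simp add: swap_expo_uminus)
  have "weighted_CT n ((tt * zvar i - zvar (i + 1)) * (Poly_Mapping.single \<alpha> c + swap_vars i (Poly_Mapping.single \<alpha> c))) =
    embed_qt c * (to_fract (fps_const fps_X) * (to_fract (?w (- \<alpha> - ?i)) + to_fract (?w (- swap_expo i \<alpha> - ?i))) -
      (to_fract (?w (- \<alpha> - ?j)) + to_fract (?w (- swap_expo i \<alpha> - ?j))))"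
    unfolding distrib_left swap_vars_single A weighted_CT_add weighted_CT_diff weighted_CT_single
      embed_qt_simps embed_qt_q_t neg by algebra
  then show ?case unfolding w by simp
qed

lemma weighted_CT_symmetric_eq_0:
  assumes i: "i \<in> {1..<n}" and h: "swap_vars i h = h"
  shows "weighted_CT n ((tt * zvar i - zvar (i + 1)) * h) = 0"
proof -
  have "weighted_CT n ((tt * zvar i - zvar (i + 1)) * h) + weighted_CT n ((tt * zvar i - zvar (i + 1)) * h) = 0"
    using weighted_CT_antisymmetric[OF i, of h] unfolding h distrib_left weighted_CT_add .
  then show ?thesis by (simp only: mult_2[symmetric]) simp
qed

text \<open>In T_i f g - f T_i g the terms with the scalar t cancel. What remains is t z_i - z_(i+1)
  times h, and h is symmetric because its product with z_i - z_(i+1) is antisymmetric.\<close>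

lemma weighted_CT_T_op:
  assumes i: "i \<in> {1..<n}"
  shows "weighted_CT n (T_op i f * g) = weighted_CT n (f * T_op i g)"
proof -
  let ?V = "zvar i - zvar (i + 1) :: ratfun laurent"
  define h where "h = div_diff i f * g - f * div_diff i g"
  have Vh: "?V * h = swap_vars i f * g - f * swap_vars i g"
  proof -
    have "?V * h = (?V * div_diff i f) * g - f * (?V * div_diff i g)" by (simp add: h_def algebra_simps)
    then show ?thesis unfolding div_diff_eq by (simp add: algebra_simps)
  qed
  have s: "simple_refl i i = i + 1" "simple_refl i (i + 1) = i" by (simp_all add: simple_refl_def)
  have "(zvar (i + 1) - zvar i) * swap_vars i h = f * swap_vars i g - swap_vars i f * g"
    using arg_cong[OF Vh, of "swap_vars i"] unfolding swap_simps s .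
  then have "?V * swap_vars i h = ?V * h" using Vh by algebra
  then have "swap_vars i h = h" by (rule zvar_diff_cancel[rotated]) simp
  from weighted_CT_symmetric_eq_0[OF i this]
  have "weighted_CT n (T_op i f * g - f * T_op i g) = 0"
    by (simp add: h_def T_op_def smul_eq algebra_simps)
  then show ?thesis by (simp add: weighted_CT_diff)
qed

section \<open>The operator \<open>omega0\<close> and the inner product\<close>

lemma omega0_add: "omega0 n (f + g) = omega0 n f + omega0 n g"
  unfolding omega0_def
  by (rule sum_keys_add[where G = "\<lambda>\<alpha> c. Poly_Mapping.single (Poly_Mapping.map_key (next_index n) \<alpha>)
       (c * q_ind powi Poly_Mapping.lookup \<alpha> 1)"]) (simp_all add: algebra_simps single_add)

lemma omega0_single:
  "omega0 n (Poly_Mapping.single \<alpha> c) = Poly_Mapping.single (rot n \<alpha>) (c * q_ind powi Poly_Mapping.lookup \<alpha> 1)"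
  by (simp add: omega0_def rot_def)

lemma omega0_mult: "1 \<le> n \<Longrightarrow> omega0 n (f * g) = omega0 n f * omega0 n g"
  by (rule laurent_mult_hom[where phi = "rot n" and psi = "\<lambda>\<alpha> c. c * q_ind powi Poly_Mapping.lookup \<alpha> 1"])
    (simp_all add: omega0_add omega0_single rot_add lookup_add power_int_add qt_nonzero)

lemma rot_uminus: "1 \<le> n \<Longrightarrow> rot n (- \<alpha>) = - rot n \<alpha>"
  by (rule poly_mapping_eqI) (simp add: lookup_rot)

lemma invert_all_omega0: "1 \<le> n \<Longrightarrow> invert_all (omega0 n f) = omega0 n (invert_all f)"
  by (induction f rule: laurent_induct)
    (simp_all add: invert_all_add omega0_add omega0_single invert_all_single rot_uminus qt_invert_simps
      qt_invert_q_t power_int_minus power_int_inverse)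

lemma weighted_CT_omega0: "1 \<le> n \<Longrightarrow> weighted_CT n (omega0 n f) = weighted_CT n f"
proof (induction f rule: laurent_induct)
  case (add f g)
  then show ?case by (simp add: omega0_add weighted_CT_add)
next
  case (single \<alpha> c)
  let ?X = "to_fract fps_X :: scalars" and ?a = "Poly_Mapping.lookup \<alpha> 1"
  have X: "?X \<noteq> 0" by simp
  have "?X powi ?a * to_fract (weight_coeff n (rot n (- \<alpha>))) = to_fract (weight_coeff n (- \<alpha>))"
  \<comment> \<open>The weight is paired at the exponent - \<alpha>, so a nonnegative entry of
    \<alpha> calls for the nonpositive version of the invariance.\<close>
  proof (cases "?a \<ge> 0")
    case True
    then have "fps_X ^ nat ?a * weight_coeff n (rot n (- \<alpha>)) = weight_coeff n (- \<alpha>)"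
      using weight_coeff_rot_nonpos[of n "- \<alpha>"] single by simp
    from arg_cong[OF this, of to_fract] show ?thesis
      using True by (simp add: power_int_def to_fract_power)
  next
    case False
    then have "weight_coeff n (rot n (- \<alpha>)) = fps_X ^ nat (- ?a) * weight_coeff n (- \<alpha>)"
      using weight_coeff_rot_nonneg[of n "- \<alpha>"] single by simp
    from arg_cong[OF this, of to_fract] show ?thesis
      using False X by (simp add: power_int_def to_fract_power[symmetric] power_inverse)
  qed
  then show ?case using single
    by (simp add: omega0_single weighted_CT_single embed_qt_simps embed_qt_q_t rot_uminus mult.assoc)
qed

section \<open>Sesquilinearity and unitary operators\<close>

lemma inner_qt_add: "inner_qt n (f + g) h = inner_qt n f h + inner_qt n g h"
  "inner_qt n h (f + g) = inner_qt n h f + inner_qt n h g"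
  by (simp_all add: inner_qt_def distrib_left distrib_right invert_all_add weighted_CT_add)

lemma inner_qt_smul: "inner_qt n (smul c f) g = embed_qt c * inner_qt n f g"
  "inner_qt n f (smul c g) = embed_qt (qt_invert c) * inner_qt n f g"
proof -
  show "inner_qt n (smul c f) g = embed_qt c * inner_qt n f g"
    by (simp add: inner_qt_def smul_eq mult.assoc weighted_CT_lconst)
  have "f * invert_all (smul c g) = lconst (qt_invert c) * (f * invert_all g)"
    unfolding smul_eq invert_all_mult invert_all_lconst by (rule mult.left_commute)
  then show "inner_qt n f (smul c g) = embed_qt (qt_invert c) * inner_qt n f g"
    by (simp only: inner_qt_def weighted_CT_lconst)
qed

lemma inner_qt_sum: "inner_qt n (\<Sum>x\<in>A. f x) h = (\<Sum>x\<in>A. inner_qt n (f x) h)"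
  "inner_qt n h (\<Sum>x\<in>A. f x) = (\<Sum>x\<in>A. inner_qt n h (f x))"
proof -
  have "inner_qt n 0 h = 0" "inner_qt n h 0 = 0"
    using inner_qt_add(1)[of n 0 0 h] inner_qt_add(2)[of n h 0 0]
    by (metis add_0_right add_left_cancel)+
  then show "inner_qt n (\<Sum>x\<in>A. f x) h = (\<Sum>x\<in>A. inner_qt n (f x) h)"
    "inner_qt n h (\<Sum>x\<in>A. f x) = (\<Sum>x\<in>A. inner_qt n h (f x))"
    by (induction A rule: infinite_finite_induct) (simp_all add: inner_qt_add)
qed

definition unitary :: "nat \<Rightarrow> (ratfun laurent \<Rightarrow> ratfun laurent) \<Rightarrow> bool" where
  "unitary n U \<longleftrightarrow> (\<forall>f g. inner_qt n (U f) (U g) = inner_qt n f g)"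

lemma unitary_id: "unitary n id"
  by (simp add: unitary_def)

lemma unitary_comp: "unitary n U \<Longrightarrow> unitary n V \<Longrightarrow> unitary n (U \<circ> V)"
  by (simp add: unitary_def)

text \<open>The left T_i is moved across by \<open>weighted_CT_T_op\<close> and meets the inverted
  T_i g, where \<open>T_op_invert_all_T_op\<close> cancels both.\<close>

lemma unitary_T_op: "i \<in> {1..<n} \<Longrightarrow> unitary n (T_op i)"
  by (simp add: unitary_def inner_qt_def weighted_CT_T_op T_op_invert_all_T_op)

lemma unitary_omega0: "1 \<le> n \<Longrightarrow> unitary n (omega0 n)"
  by (simp add: unitary_def inner_qt_def invert_all_omega0 omega0_mult[symmetric] weighted_CT_omega0)

text \<open>The preimage is (T_i + 1 - t) f / t, the inverse given by the quadratic relation.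
  Surjectivity is what gives \<open>Hilbert_Choice.inv\<close> inside \<open>Y_op\<close> its
  meaning as a right inverse.\<close>

lemma T_op_surj: "surj (T_op i)"
proof (rule surjI)
  fix f
  have tu: "tt * lconst (inverse t_ind) = 1" by (simp add: lconst_simps(4)[symmetric] qt_nonzero lconst_simps)
  have "T_op i (lconst (inverse t_ind) * (T_op i f + lconst (1 - t_ind) * f)) =
      lconst (inverse t_ind) * (((tt - 1) * T_op i f + tt * f) + (1 - tt) * T_op i f)"
    by (simp add: T_op_mult_lconst T_op_add T_op_quadratic) (simp add: lconst_simps)
  also have "\<dots> = f" using tu by algebra
  finally show "T_op i (lconst (inverse t_ind) * (T_op i f + lconst (1 - t_ind) * f)) = f" .
qed

lemma unitary_inv_T_op:
  assumes "i \<in> {1..<n}"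
  shows "unitary n (Hilbert_Choice.inv (T_op i))"
  using unitary_T_op[OF assms] by (metis unitary_def surj_f_inv_f[OF T_op_surj])

lemma unitary_T_word: "set w \<subseteq> {1..<n} \<Longrightarrow> unitary n (T_word w)"
  by (induction w) (simp_all add: T_word_def unitary_id unitary_comp unitary_T_op)

lemma unitary_T_inv_word: "set w \<subseteq> {1..<n} \<Longrightarrow> unitary n (T_inv_word w)"
  by (induction w) (simp_all add: T_inv_word_def unitary_id unitary_comp unitary_inv_T_op)

lemma unitary_Y_op:
  assumes "i \<in> {1..n}"
  shows "unitary n (Y_op n i)"
proof -
  have s: "unitary n (smul (t_ind powi m))" for m
    by (simp add: unitary_def inner_qt_smul qt_invert_simps qt_invert_q_t embed_qt_simps embed_qt_q_t
        power_int_inverse)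
  have Y: "Y_op n i = smul (t_ind powi (int i - int n)) \<circ> (T_word [i..<n] \<circ> (omega0 n \<circ> T_inv_word [1..<i]))"
    by (rule ext) (simp add: Y_op_def)
  show ?thesis
    unfolding Y using assms by (intro unitary_comp s unitary_T_word unitary_omega0 unitary_T_inv_word) auto
qed

lemma eigenvalue_invert: "qt_invert (eigenvalue n \<eta> i) = inverse (eigenvalue n \<eta> i)"
  by (simp add: eigenvalue_def qt_invert_simps qt_invert_q_t power_int_inverse inverse_mult_distrib)

section \<open>Eigenvalues and orthogonality\<close>

lemma q_t_powi_eq_imp:
  assumes "q_ind powi a * t_ind powi b = q_ind powi c * t_ind powi d"
  shows "a = c"
proof -
  \<comment> \<open>Shifts large enough to make all exponents nonnegative, so that monomials of the
    polynomial ring can be compared.\<close>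
  define N where "N = \<bar>a\<bar> + \<bar>c\<bar>"
  define M where "M = \<bar>b\<bar> + \<bar>d\<bar>"
  have nn: "0 \<le> N + a" "0 \<le> N + c" "0 \<le> M + b" "0 \<le> M + d" by (auto simp: N_def M_def)
  have "q_ind powi (N + a) * t_ind powi (M + b) = q_ind powi (N + c) * t_ind powi (M + d)"
    using assms by (simp add: power_int_add qt_nonzero algebra_simps)
  then have "t_ind ^ nat (M + b) * q_ind ^ nat (N + a) = t_ind ^ nat (M + d) * q_ind ^ nat (N + c)"
    using nn by (simp add: power_int_def mult.commute)
  then have "to_fract (monom (monom 1 (nat (M + b))) (nat (N + a))) = to_fract (monom (monom (1::rat) (nat (M + d))) (nat (N + c)))"
    unfolding to_fract_monom_monom by simp
  then have "monom (monom 1 (nat (M + b))) (nat (N + a)) = monom (monom (1::rat) (nat (M + d))) (nat (N + c))"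
    by simp
  then have "degree (monom (monom (1::rat) (nat (M + b))) (nat (N + a))) = degree (monom (monom (1::rat) (nat (M + d))) (nat (N + c)))"
    by (rule arg_cong)
  then have "nat (N + a) = nat (N + c)" by (simp add: degree_monom_eq)
  then show ?thesis by (auto simp: N_def)
qed

lemma eigenvalue_eq_imp:
  "eigenvalue n \<mu> i = eigenvalue n \<eta> i \<Longrightarrow> Poly_Mapping.lookup \<mu> i = Poly_Mapping.lookup \<eta> i"
  unfolding eigenvalue_def by (rule q_t_powi_eq_imp)

text \<open>At an index where the compositions differ, already the power of q separates the
  eigenvalues m and e. Since e conjugates to its inverse, unitarity of Y_i gives <F, G> = (m / e)
  <F, G> with m / e different from 1.\<close>

lemma nonsymmetric_macdonald_orthogonal:
  assumes \<mu>: "nonsymmetric_macdonald n \<mu> F" "composition n \<mu>"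
    and \<eta>: "nonsymmetric_macdonald n \<eta> G" "composition n \<eta>"
    and ne: "\<mu> \<noteq> \<eta>"
  shows "inner_qt n F G = 0"
proof -
  obtain i where i: "Poly_Mapping.lookup \<mu> i \<noteq> Poly_Mapping.lookup \<eta> i"
    using ne by (metis poly_mapping_eqI)
  then have "i \<in> Poly_Mapping.keys \<mu> \<union> Poly_Mapping.keys \<eta>" by (auto simp: in_keys_iff)
  then have i_in: "i \<in> {1..n}" using \<mu> \<eta> by (auto simp: composition_def)
  let ?m = "eigenvalue n \<mu> i" and ?e = "eigenvalue n \<eta> i"
  have nz: "?e \<noteq> 0" by (simp add: eigenvalue_def qt_nonzero)
  have "inner_qt n F G = inner_qt n (Y_op n i F) (Y_op n i G)"
    using unitary_Y_op[OF i_in] by (simp add: unitary_def)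
  also have "\<dots> = embed_qt (?m / ?e) * inner_qt n F G"
    using \<mu> \<eta> i_in by (simp add: nonsymmetric_macdonald_def inner_qt_smul eigenvalue_invert embed_qt_simps divide_inverse)
  finally have "(embed_qt (?m / ?e) - embed_qt 1) * inner_qt n F G = 0"
    by (simp add: embed_qt_simps left_diff_distrib)
  moreover have "?m / ?e - 1 \<noteq> 0" using i nz eigenvalue_eq_imp[of n \<mu> i \<eta>] by auto
  then have "embed_qt (?m / ?e) - embed_qt 1 \<noteq> 0"
    by (metis embed_qt_simps(6) embed_qt_simps(13))
  ultimately show ?thesis by simp
qed

section \<open>Words in the symmetric group\<close>

lemma word_perm_simps [simp]:
  "word_perm [] = id" "word_perm (i # w) = simple_refl i \<circ> word_perm w"
  by (simp_all add: word_perm_def)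

lemma word_perm_append: "word_perm (v @ w) = word_perm v \<circ> word_perm w"
  by (induction v) (simp_all add: comp_assoc)

lemma simple_refl_comp_self [simp]: "simple_refl i \<circ> simple_refl i = id" "simple_refl i \<circ> (simple_refl i \<circ> f) = f"
  by (rule ext, simp)+

lemma word_perm_rev: "word_perm (rev w) \<circ> word_perm w = id" "word_perm w \<circ> word_perm (rev w) = id"
proof (induction w)
  case (Cons i w)
  show "word_perm (rev (i # w)) \<circ> word_perm (i # w) = id"
    using Cons(1) by (simp add: word_perm_append fun_eq_iff)
  show "word_perm (i # w) \<circ> word_perm (rev (i # w)) = id"
    using Cons(2) by (simp add: word_perm_append fun_eq_iff)
qed simp_all

lemma inv_word_perm: "Hilbert_Choice.inv (word_perm w) = word_perm (rev w)"
  using word_perm_rev[of w] by (intro inv_equality) (simp_all add: fun_eq_iff)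

lemma bij_word_perm: "bij (word_perm w)"
  using word_perm_rev[of w] by (intro o_bij)

lemma simple_refl_apply:
  "simple_refl i x = (if x = i then i + 1 else if x = i + 1 then i else x)"
  by (simp add: simple_refl_def Transposition.transpose_def)

lemma simple_refl_comp_cancel: "simple_refl i \<circ> f = simple_refl i \<circ> g \<longleftrightarrow> f = g"
  by (metis simple_refl_comp_self(2))

definition refl_group :: "nat set \<Rightarrow> (nat \<Rightarrow> nat) set" where
  "refl_group K = word_perm ` lists K"

lemma refl_groupI: "set w \<subseteq> K \<Longrightarrow> word_perm w \<in> refl_group K"
  by (auto simp: refl_group_def)

lemma refl_groupE:
  assumes "\<sigma> \<in> refl_group K"
  obtains w where "set w \<subseteq> K" "\<sigma> = word_perm w"
  using assms by (auto simp: refl_group_def)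

lemma refl_group_mono: "K \<subseteq> L \<Longrightarrow> refl_group K \<subseteq> refl_group L"
  by (auto simp: refl_group_def)

lemma refl_group_comp: "\<sigma> \<in> refl_group K \<Longrightarrow> \<tau> \<in> refl_group K \<Longrightarrow> \<sigma> \<circ> \<tau> \<in> refl_group K"
  by (metis refl_groupE refl_groupI word_perm_append set_append Un_least)

lemma refl_group_inv: "\<sigma> \<in> refl_group K \<Longrightarrow> Hilbert_Choice.inv \<sigma> \<in> refl_group K"
  by (metis inv_word_perm refl_groupE refl_groupI set_rev)

lemma refl_group_bij: "\<sigma> \<in> refl_group K \<Longrightarrow> bij \<sigma>"
  by (metis bij_word_perm refl_groupE)

lemma refl_group_simple: "i \<in> K \<Longrightarrow> simple_refl i \<in> refl_group K"
  using refl_groupI[of "[i]" K] by simp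

lemma id_refl_group: "id \<in> refl_group K"
  using refl_groupI[of "[]" K] by simp

lemma simple_refl_permutes: "i \<in> {1..<n} \<Longrightarrow> simple_refl i permutes {1..n}"
  unfolding simple_refl_def by (rule permutes_swap_id) auto

lemma word_perm_permutes: "set w \<subseteq> {1..<n} \<Longrightarrow> word_perm w permutes {1..n}"
proof (induction w)
  case (Cons i w)
  then have "word_perm w permutes {1..n}" "simple_refl i permutes {1..n}"
    using simple_refl_permutes[of i n] by auto
  then show ?case unfolding word_perm_simps by (rule permutes_compose)
qed (simp only: word_perm_simps permutes_id)

lemma parabolic_eq_refl_group:
  assumes K: "K \<subseteq> {1..<n}"
  shows "parabolic n K = refl_group K"
proof
  have carrier: "simple_refl k \<in> carrier (sym_group n)" if "k \<in> K" for k
    using simple_refl_permutes[of k n] that K by (auto simp: sym_group_def)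
  show "parabolic n K \<subseteq> refl_group K"
  proof
    fix \<sigma> assume "\<sigma> \<in> parabolic n K"
    then show "\<sigma> \<in> refl_group K"
      unfolding parabolic_def
    proof (induction rule: generate.induct)
      case one
      then show ?case using id_refl_group[of K] by (simp add: sym_group_def id_def)
    next
      case (incl h)
      then show ?case by (auto intro: refl_group_simple)
    next
      case (inv h)
      then obtain k where k: "k \<in> K" "h = simple_refl k" by auto
      have "inv\<^bsub>sym_group n\<^esub> h = h"
        using carrier[OF k(1)] k(2)
        by (intro group.inv_equality sym_group_is_group) (simp_all add: sym_group_def)
      then show ?case using k by (simp add: refl_group_simple)
    next
      case (eng g h)
      have "g \<otimes>\<^bsub>sym_group n\<^esub> h = g \<circ> h" by (simp add: sym_group_def)
      then show ?case using refl_group_comp eng(3,4) by metis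
    qed
  qed
  show "refl_group K \<subseteq> parabolic n K"
  proof
    fix \<sigma> assume "\<sigma> \<in> refl_group K"
    then obtain w where "set w \<subseteq> K" "\<sigma> = word_perm w" by (rule refl_groupE)
    then show "\<sigma> \<in> parabolic n K"
    proof (induction w arbitrary: \<sigma>)
      case Nil
      have "word_perm [] = \<one>\<^bsub>sym_group n\<^esub>" by (simp add: sym_group_def)
      then show ?case unfolding parabolic_def Nil(2) by (simp only: generate.one)
    next
      case (Cons k w)
      have "simple_refl k \<in> generate (sym_group n) (simple_refl ` K)"
        using Cons.prems by (auto intro: generate.incl)
      moreover have "word_perm w \<in> generate (sym_group n) (simple_refl ` K)"
        using Cons by (simp add: parabolic_def)
      moreover have "simple_refl k \<otimes>\<^bsub>sym_group n\<^esub> word_perm w = word_perm (k # w)"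
        by (simp add: sym_group_def)
      ultimately show ?case
        unfolding parabolic_def Cons.prems(2) by (metis generate.eng)
    qed
  qed
qed

lemma finite_refl_group:
  assumes "K \<subseteq> {1..<n}"
  shows "finite (refl_group K)"
proof (rule finite_subset)
  show "refl_group K \<subseteq> {p. p permutes {1..n}}"
  proof
    fix \<sigma> assume "\<sigma> \<in> refl_group K"
    then obtain w where "set w \<subseteq> K" "\<sigma> = word_perm w" by (rule refl_groupE)
    then show "\<sigma> \<in> {p. p permutes {1..n}}" using word_perm_permutes assms by blast
  qed
qed (simp add: finite_permutations)

section \<open>Exchange condition and length\<close>

lemma transpose_conj: "inj f \<Longrightarrow> f (Transposition.transpose a b x) = Transposition.transpose (f a) (f b) (f x)"
  by (auto simp: Transposition.transpose_def dest: injD)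

text \<open>The strong exchange condition. Pulling the transposition past a first letter j replaces
  (a, b) by their images under s_j. The order of the pair is first reversed when a = j and b = j +
  1, and there the transposition cancels that letter. General a < b are needed for this
  induction.\<close>

lemma exchange:
  assumes "a < b" "Hilbert_Choice.inv (word_perm w) b < Hilbert_Choice.inv (word_perm w) a"
  shows "\<exists>v. set v \<subseteq> set w \<and> length w = Suc (length v) \<and> Transposition.transpose a b \<circ> word_perm w = word_perm v"
  using assms
proof (induction w arbitrary: a b)
  case (Cons j w)
  let ?a = "simple_refl j a" and ?b = "simple_refl j b"
  have inv: "Hilbert_Choice.inv (word_perm (j # w)) x = Hilbert_Choice.inv (word_perm w) (simple_refl j x)" for x
    by (simp only: inv_word_perm rev.simps word_perm_append) simp
  show ?case
  proof (cases "?a < ?b")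
    case True
    have "Hilbert_Choice.inv (word_perm w) ?b < Hilbert_Choice.inv (word_perm w) ?a"
      using Cons.prems(2) by (simp only: inv)
    from Cons.IH[OF True this] obtain v where v: "set v \<subseteq> set w" "length w = Suc (length v)"
      "Transposition.transpose ?a ?b \<circ> word_perm w = word_perm v" by blast
    have "Transposition.transpose a b \<circ> word_perm (j # w) = simple_refl j \<circ> (Transposition.transpose ?a ?b \<circ> word_perm w)"
      using transpose_conj[OF inj_simple_refl, of j ?a ?b] by (simp add: fun_eq_iff)
    also have "\<dots> = word_perm (j # v)" by (simp add: v)
    finally have eq: "Transposition.transpose a b \<circ> word_perm (j # w) = word_perm (j # v)" .
    show ?thesis by (intro exI[of _ "j # v"] conjI eq) (use v in auto)
  next
    case False
    then have "a = j" "b = j + 1" using Cons.prems(1) by (auto simp: simple_refl_apply split: if_splits)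
    then have "Transposition.transpose a b = simple_refl j" by (simp add: simple_refl_def)
    then show ?thesis by (intro exI[of _ w]) auto
  qed
qed simp

lemma coxeter_length_le: "set w \<subseteq> {1..<n} \<Longrightarrow> coxeter_length n (word_perm w) \<le> length w"
  unfolding coxeter_length_def by (rule Least_le) blast

lemma reduced_word_exists:
  assumes "\<sigma> \<in> refl_group {1..<n}"
  shows "\<exists>w. reduced_word n \<sigma> w"
proof -
  have "\<exists>l w. set w \<subseteq> {1..<n} \<and> word_perm w = \<sigma> \<and> length w = l"
    using assms by (auto elim: refl_groupE)
  from LeastI_ex[OF this] show ?thesis
    unfolding reduced_word_def coxeter_length_def by blast
qed

text \<open>Left descents: the generators s_i for which s_i \<sigma> is shorter than \<sigma>, read
  off from the inverse permutation.\<close>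

abbreviation descent :: "(nat \<Rightarrow> nat) \<Rightarrow> nat \<Rightarrow> bool" where
  "descent \<sigma> i \<equiv> Hilbert_Choice.inv \<sigma> (i + 1) < Hilbert_Choice.inv \<sigma> i"

lemma inv_simple_refl_comp:
  "bij \<sigma> \<Longrightarrow> Hilbert_Choice.inv (simple_refl i \<circ> \<sigma>) x = Hilbert_Choice.inv \<sigma> (simple_refl i x)"
proof -
  assume "bij \<sigma>"
  moreover have "bij (simple_refl i)" using bij_word_perm[of "[i]"] by simp
  ultimately show ?thesis by (simp add: o_inv_distrib)
qed

lemma descent_simple_refl_comp:
  assumes "bij \<sigma>"
  shows "descent (simple_refl i \<circ> \<sigma>) i \<longleftrightarrow> \<not> descent \<sigma> i"
proof -
  have "Hilbert_Choice.inv \<sigma> (i + 1) \<noteq> Hilbert_Choice.inv \<sigma> i"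
    using assms by (metis bij_inv_eq_iff n_not_Suc_n Suc_eq_plus1)
  then show ?thesis by (auto simp: inv_simple_refl_comp[OF assms] simple_refl_apply)
qed

lemma coxeter_length_descent:
  assumes \<sigma>: "\<sigma> \<in> refl_group {1..<n}" and i: "i \<in> {1..<n}" and d: "descent \<sigma> i"
  shows "coxeter_length n \<sigma> = Suc (coxeter_length n (simple_refl i \<circ> \<sigma>))"
proof (rule antisym)
  obtain u where u: "set u \<subseteq> {1..<n}" "word_perm u = \<sigma>" "length u = coxeter_length n \<sigma>"
    using reduced_word_exists[OF \<sigma>] by (auto simp: reduced_word_def)
  obtain v where v: "set v \<subseteq> set u" "length u = Suc (length v)" "simple_refl i \<circ> \<sigma> = word_perm v"
    using exchange[of i "i + 1" u] d u(2) by (auto simp: simple_refl_def)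
  show "Suc (coxeter_length n (simple_refl i \<circ> \<sigma>)) \<le> coxeter_length n \<sigma>"
    using coxeter_length_le[of v n] u v(2,3) subset_trans[OF v(1) u(1)] by simp
  have "simple_refl i \<circ> \<sigma> \<in> refl_group {1..<n}"
    using \<sigma> i by (simp add: refl_group_comp refl_group_simple)
  then obtain w where w: "set w \<subseteq> {1..<n}" "word_perm w = simple_refl i \<circ> \<sigma>"
      "length w = coxeter_length n (simple_refl i \<circ> \<sigma>)"
    using reduced_word_exists by (fastforce simp: reduced_word_def)
  have "word_perm (i # w) = \<sigma>" by (simp add: w)
  then show "coxeter_length n \<sigma> \<le> Suc (coxeter_length n (simple_refl i \<circ> \<sigma>))"
    using coxeter_length_le[of "i # w" n] w i by simp
qed

lemma coxeter_length_ascent: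
  assumes \<sigma>: "\<sigma> \<in> refl_group {1..<n}" and i: "i \<in> {1..<n}" and d: "\<not> descent \<sigma> i"
  shows "coxeter_length n (simple_refl i \<circ> \<sigma>) = Suc (coxeter_length n \<sigma>)"
proof -
  have "descent (simple_refl i \<circ> \<sigma>) i"
    using d descent_simple_refl_comp[OF refl_group_bij[OF \<sigma>]] by blast
  from coxeter_length_descent[OF _ i this] show ?thesis
    using \<sigma> i by (simp add: refl_group_comp refl_group_simple)
qed

text \<open>Exchange only deletes letters, so a word in K can be shortened to one of minimal length
  in the whole symmetric group without leaving K.\<close>

lemma reduced_word_exists_parabolic:
  assumes K: "K \<subseteq> {1..<n}" and \<sigma>: "\<sigma> \<in> refl_group K"
  shows "\<exists>u. set u \<subseteq> K \<and> reduced_word n \<sigma> u"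
proof -
  obtain w where "set w \<subseteq> K" "\<sigma> = word_perm w" using \<sigma> by (rule refl_groupE)
  then show ?thesis
  proof (induction w arbitrary: \<sigma>)
    case Nil
    have "reduced_word n \<sigma> []"
      using coxeter_length_le[of "[]" n] unfolding reduced_word_def Nil(2) by simp
    then show ?case by (metis Nil.prems(1))
  next
    case (Cons i w)
    then obtain u where u: "set u \<subseteq> K" "reduced_word n (word_perm w) u" by auto
    have i: "i \<in> K" "i \<in> {1..<n}" using Cons.prems K by auto
    have w: "word_perm w \<in> refl_group {1..<n}" using Cons.prems K by (auto intro!: refl_groupI)
    show ?case
    proof (cases "descent (word_perm w) i")
      case True
      obtain v where v: "set v \<subseteq> set u" "length u = Suc (length v)" "simple_refl i \<circ> word_perm w = word_perm v"
        using exchange[of i "i + 1" u] True u(2) by (auto simp: simple_refl_def reduced_word_def)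
      then have "reduced_word n \<sigma> v"
        using coxeter_length_descent[OF w i(2) True] Cons.prems u K by (auto simp: reduced_word_def)
      then show ?thesis using v u by blast
    next
      case False
      have "reduced_word n \<sigma> (i # u)"
        using coxeter_length_ascent[OF w i(2) False] u i unfolding Cons.prems(2) by (simp add: reduced_word_def)
      then show ?thesis using u(1) i(1) by (intro exI[of _ "i # u"]) simp
    qed
  qed
qed

lemma reduced_word_Cons:
  assumes "reduced_word n \<sigma> (i # u)"
  shows "reduced_word n (simple_refl i \<circ> \<sigma>) u" "descent \<sigma> i" "i \<in> {1..<n}"
    "\<sigma> \<in> refl_group {1..<n}" "coxeter_length n \<sigma> = Suc (length u)"
proof -
  have u: "set u \<subseteq> {1..<n}" and i: "i \<in> {1..<n}" and \<sigma>: "\<sigma> = simple_refl i \<circ> word_perm u"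
    and l: "coxeter_length n \<sigma> = Suc (length u)"
    using assms by (auto simp: reduced_word_def)
  have g: "\<sigma> \<in> refl_group {1..<n}" using refl_groupI[of "i # u" "{1..<n}"] u i by (simp add: \<sigma>)
  have si: "simple_refl i \<circ> \<sigma> = word_perm u" by (simp add: \<sigma>)
  show d: "descent \<sigma> i"
  proof (rule ccontr)
    assume "\<not> descent \<sigma> i"
    then show False using coxeter_length_ascent[OF g i] coxeter_length_le[OF u] l by (simp add: si)
  qed
  show "reduced_word n (simple_refl i \<circ> \<sigma>) u"
    using coxeter_length_descent[OF g i d] u l by (simp add: reduced_word_def si)
  show "i \<in> {1..<n}" "\<sigma> \<in> refl_group {1..<n}" "coxeter_length n \<sigma> = Suc (length u)" by fact+
qed

lemma reduced_word_ConsI: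
  assumes \<sigma>: "\<sigma> \<in> refl_group {1..<n}" and i: "i \<in> {1..<n}" and d: "descent \<sigma> i"
    and u: "reduced_word n (simple_refl i \<circ> \<sigma>) u"
  shows "reduced_word n \<sigma> (i # u)"
  using coxeter_length_descent[OF \<sigma> i d] u i by (auto simp: reduced_word_def)

section \<open>Matsumoto's theorem\<close>

lemma simple_refl_comp_commute:
  "i + 1 < j \<Longrightarrow> simple_refl i \<circ> (simple_refl j \<circ> f) = simple_refl j \<circ> (simple_refl i \<circ> f)"
  by (auto simp: fun_eq_iff simple_refl_apply)

lemma simple_refl_comp_braid:
  "simple_refl i \<circ> (simple_refl (i + 1) \<circ> (simple_refl i \<circ> f)) =
    simple_refl (i + 1) \<circ> (simple_refl i \<circ> (simple_refl (i + 1) \<circ> f))"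
  by (auto simp: fun_eq_iff simple_refl_apply)

text \<open>If \<open>i\<close> and \<open>j\<close> are both descents, then \<open>\<sigma>\<close> has reduced words starting with either side of the
  braid relation for \<open>i\<close> and \<open>j\<close>, and the induction hypothesis applies to the tails.\<close>

lemma matsumoto:
  fixes F :: "nat \<Rightarrow> 'x \<Rightarrow> 'x"
  assumes comm: "\<And>i j x. i + 1 < j \<Longrightarrow> F i (F j x) = F j (F i x)"
    and braid: "\<And>i x. F i (F (i + 1) (F i x)) = F (i + 1) (F i (F (i + 1) x))"
    and u: "reduced_word n \<sigma> u" and v: "reduced_word n \<sigma> v"
  shows "foldr F u x = foldr F v x"
  using u v
proof (induction "length u" arbitrary: u v \<sigma> rule: less_induct)
  case less
  have len: "length u = length v" using less.prems by (simp add: reduced_word_def)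
  \<comment> \<open>Stated for arbitrary first letters i < j and arbitrary tails, so that the two
    words can be inserted in either order.\<close>
  have main: "foldr F (i # u') x = foldr F (j # v') x"
    if u: "reduced_word n \<sigma> (i # u')" and v: "reduced_word n \<sigma> (j # v')" and ij: "i < j"
      and l: "length u = Suc (length u')" for i j u' v'
  proof -
    note i = reduced_word_Cons[OF u] and j = reduced_word_Cons[OF v]
    have l': "length u = Suc (length v')" using i(5) j(5) l by simp
    have bij: "bij \<sigma>" using i(4) by (rule refl_group_bij)
    have IH: "foldr F u' x = foldr F w x" if "reduced_word n (simple_refl i \<circ> \<sigma>) w" for w
      using less.hyps[OF _ i(1) that] l by simp
    have IH': "foldr F v' x = foldr F w x" if "reduced_word n (simple_refl j \<circ> \<sigma>) w" for w
      using less.hyps[OF _ j(1) that] l' by simp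
    have grp: "simple_refl k \<circ> \<tau> \<in> refl_group {1..<n}" if "\<tau> \<in> refl_group {1..<n}" "k = i \<or> k = j" for k \<tau>
      using that i(3) j(3) refl_group_comp refl_group_simple by blast
    have inv: "Hilbert_Choice.inv (simple_refl k \<circ> \<tau>) x = Hilbert_Choice.inv \<tau> (simple_refl k x)"
      if "\<tau> \<in> refl_group {1..<n}" for k \<tau> x using inv_simple_refl_comp[OF refl_group_bij[OF that]] .
    show ?thesis
    proof (cases "j = i + 1")
      case False
      then have far: "i + 1 < j" using ij by simp
      let ?\<tau> = "simple_refl j \<circ> (simple_refl i \<circ> \<sigma>)"
      have \<tau>: "?\<tau> = simple_refl i \<circ> (simple_refl j \<circ> \<sigma>)" using simple_refl_comp_commute[OF far] by metis
      have "?\<tau> \<in> refl_group {1..<n}" using grp i(4) by blast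
      then obtain w where w: "reduced_word n ?\<tau> w" using reduced_word_exists by blast
      have "reduced_word n (simple_refl i \<circ> \<sigma>) (j # w)"
        by (rule reduced_word_ConsI[OF _ j(3) _ w])
          (use i j far grp inv[OF i(4)] in \<open>auto simp: simple_refl_apply\<close>)
      moreover have "reduced_word n (simple_refl j \<circ> \<sigma>) (i # w)"
        by (rule reduced_word_ConsI[OF _ i(3) _ w[unfolded \<tau>]])
          (use i j far grp inv[OF i(4)] in \<open>auto simp: simple_refl_apply\<close>)
      ultimately show ?thesis using IH IH' comm[OF far] by simp
    next
      case True
      let ?a = "simple_refl i" and ?b = "simple_refl j"
      \<comment> \<open>\<sigma> with the longest element of the group generated by s_i and s_j
        stripped off. Prefixing one reduced word of it with i j i or with j i j gives reduced words
        of \<sigma>.\<close>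
      let ?\<tau> = "?a \<circ> (?b \<circ> (?a \<circ> \<sigma>))"
      have \<tau>: "?\<tau> = ?b \<circ> (?a \<circ> (?b \<circ> \<sigma>))" using simple_refl_comp_braid[of i \<sigma>] True by simp
      have grps: "?a \<circ> \<sigma> \<in> refl_group {1..<n}" "?b \<circ> \<sigma> \<in> refl_group {1..<n}"
        "?b \<circ> (?a \<circ> \<sigma>) \<in> refl_group {1..<n}" "?a \<circ> (?b \<circ> \<sigma>) \<in> refl_group {1..<n}"
        "?\<tau> \<in> refl_group {1..<n}"
        using grp i(4) by auto
      obtain w where w: "reduced_word n ?\<tau> w" using reduced_word_exists[OF grps(5)] by blast
      note invs = inv[OF i(4)] inv[OF grps(1)] inv[OF grps(2)]
      have "reduced_word n (?b \<circ> (?a \<circ> \<sigma>)) (i # w)"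
        by (rule reduced_word_ConsI[OF grps(3) i(3) _ w]) (use i(2) j(2) True in \<open>simp add: invs simple_refl_apply\<close>)
      then have "reduced_word n (?a \<circ> \<sigma>) (j # i # w)"
        by (rule reduced_word_ConsI[OF grps(1) j(3), rotated]) (use i(2) j(2) True in \<open>simp add: invs simple_refl_apply\<close>)
      moreover have "reduced_word n (?a \<circ> (?b \<circ> \<sigma>)) (j # w)"
      proof (rule reduced_word_ConsI[OF grps(4) j(3) _ w[unfolded \<tau>]])
        show "descent (?a \<circ> (?b \<circ> \<sigma>)) j"
          unfolding invs using i(2) j(2) True by (simp add: simple_refl_apply)
      qed
      then have "reduced_word n (?b \<circ> \<sigma>) (i # j # w)"
        by (rule reduced_word_ConsI[OF grps(2) i(3), rotated]) (use i(2) j(2) True in \<open>simp add: invs simple_refl_apply\<close>)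
      ultimately show ?thesis using IH IH' braid[of i] True by simp
    qed
  qed
  show ?case
  proof (cases u)
    case Nil
    then show ?thesis using len by simp
  next
    case (Cons i u')
    then obtain j v' where v': "v = j # v'" using len by (cases v) auto
    note prems = less.prems[unfolded Cons v']
    consider "i = j" | "i < j" | "j < i" by linarith
    then show ?thesis
    proof cases
      case 1
      have "foldr F u' x = foldr F v' x"
        using less.hyps[OF _ reduced_word_Cons(1)[OF prems(1)]] reduced_word_Cons(1)[OF prems(2)] 1 Cons by simp
      then show ?thesis by (simp add: Cons v' 1)
    next
      case 2
      then show ?thesis using main[OF prems] Cons v' by simp
    next
      case 3
      then show ?thesis using main[OF prems(2,1)] Cons v' len by simp
    qed
  qed
qed

section \<open>Poincare polynomials of parabolic subgroups\<close>

definition poincare :: "nat \<Rightarrow> nat set \<Rightarrow> 'a::comm_semiring_1 \<Rightarrow> 'a" where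
  "poincare n K x = (\<Sum>\<sigma>\<in>refl_group K. x ^ coxeter_length n \<sigma>)"

lemma word_perm_fixes:
  assumes "set w \<subseteq> K" "p \<notin> K" "\<And>k. k \<in> K \<Longrightarrow> p \<noteq> k + 1"
  shows "word_perm w p = p"
  using assms(1)
proof (induction w)
  case (Cons k w)
  then have "k \<in> K" by simp
  then have "p \<noteq> k" "p \<noteq> k + 1" using assms by auto
  then show ?case using Cons by (simp add: simple_refl_apply)
qed simp

lemma word_perm_le:
  assumes "set w \<subseteq> {..<m}" "p \<le> m"
  shows "word_perm w p \<le> m"
  using assms(1)
proof (induction w)
  case (Cons k w)
  then have "word_perm w p \<le> m" "k < m" by auto
  then show ?case by (auto simp: simple_refl_apply)
qed (simp add: assms)

text \<open>The minimal coset representative \<open>s\<^sub>j s\<^sub>j\<^sub>+\<^sub>1 \<cdots> s\<^sub>m\<close>.\<close>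

definition coset_rep :: "nat \<Rightarrow> nat \<Rightarrow> nat \<Rightarrow> nat" where
  "coset_rep m j p = (if p = m + 1 then j else if j \<le> p \<and> p \<le> m then p + 1 else p)"

lemma coset_rep_last: "coset_rep m (m + 1) = id"
  by (auto simp: coset_rep_def fun_eq_iff)

text \<open>A generator multiplied from the left commutes past s_j ... s_m, or lengthens it, or
  shortens it, or passes through with its index lowered by one (a braid move). The right factor u is
  carried along to allow rewriting inside compositions.\<close>

lemma simple_refl_coset_rep:
  assumes "j \<le> m + 1" "k \<le> m"
  shows "simple_refl k \<circ> (coset_rep m j \<circ> u) =
    (if k + 1 < j then coset_rep m j \<circ> (simple_refl k \<circ> u) else
     if k + 1 = j then coset_rep m k \<circ> u else
     if k = j then coset_rep m (j + 1) \<circ> u else coset_rep m j \<circ> (simple_refl (k - 1) \<circ> u))"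
proof -
  note defs = simple_refl_apply coset_rep_def
  have 1: "simple_refl k (coset_rep m j y) = coset_rep m j (simple_refl k y)" if "k + 1 < j" for y
  proof -
    consider "y = k" | "y = k + 1" | "y < j" "y \<noteq> k" "y \<noteq> k + 1" | "j \<le> y" "y \<le> m" | "y = m + 1" | "m + 1 < y"
      by linarith
    then show ?thesis by cases (use that assms in \<open>simp_all add: defs\<close>)
  qed
  have 2: "simple_refl k (coset_rep m (k + 1) y) = coset_rep m k y" for y
  proof -
    consider "y = k" | "y < k" | "k < y" "y \<le> m" | "y = m + 1" | "m + 1 < y" by linarith
    then show ?thesis by cases (use assms in \<open>simp_all add: defs\<close>)
  qed
  have 3: "simple_refl k (coset_rep m k y) = coset_rep m (k + 1) y" for y
    using 2[of y] by (metis simple_refl_involutive)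
  have 4: "simple_refl k (coset_rep m j y) = coset_rep m j (simple_refl (k - 1) y)" if jk: "j < k" for y
  proof -
    obtain l where l: "k = Suc l" using jk by (cases k) auto
    show ?thesis
    proof (cases "j \<le> y \<and> y \<le> m")
      case True
      consider "y < l" | "y = l" | "y = Suc l" | "Suc l < y" by linarith
      then show ?thesis by cases (use True that assms l in \<open>simp_all add: defs\<close>)
    next
      case False
      then consider "y < j" | "y = m + 1" | "m + 1 < y" by linarith
      then show ?thesis by cases (use that assms l in \<open>simp_all add: defs\<close>)
    qed
  qed
  have c1: "simple_refl k \<circ> (coset_rep m j \<circ> u) = coset_rep m j \<circ> (simple_refl k \<circ> u)" if "k + 1 < j"
    by (rule ext) (simp only: comp_apply 1[OF that])
  have c2: "simple_refl k \<circ> (coset_rep m j \<circ> u) = coset_rep m k \<circ> u" if "k + 1 = j"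
    by (rule ext) (simp only: comp_apply that[symmetric] 2)
  have c3: "simple_refl k \<circ> (coset_rep m j \<circ> u) = coset_rep m (j + 1) \<circ> u" if "k = j"
    by (rule ext) (simp only: comp_apply that[symmetric] 3)
  have c4: "simple_refl k \<circ> (coset_rep m j \<circ> u) = coset_rep m j \<circ> (simple_refl (k - 1) \<circ> u)" if "j < k"
    by (rule ext) (simp only: comp_apply 4[OF that])
  consider "k + 1 < j" | "k + 1 = j" | "k = j" | "j < k" by linarith
  then show ?thesis
  proof cases
    case 1
    then show ?thesis unfolding if_P[OF 1] by (rule c1)
  next
    case 2
    then have "\<not> k + 1 < j" by simp
    then show ?thesis unfolding if_not_P[OF \<open>\<not> k + 1 < j\<close>] if_P[OF 2] by (intro c2 2)
  next
    case 3
    then have "\<not> k + 1 < j" "k + 1 \<noteq> j" by simp_all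
    then show ?thesis unfolding if_not_P[OF \<open>\<not> k + 1 < j\<close>] if_not_P[OF \<open>k + 1 \<noteq> j\<close>] if_P[OF 3] by (intro c3 3)
  next
    case 4
    then have "\<not> k + 1 < j" "k + 1 \<noteq> j" "k \<noteq> j" by simp_all
    then show ?thesis
      unfolding if_not_P[OF \<open>\<not> k + 1 < j\<close>] if_not_P[OF \<open>k + 1 \<noteq> j\<close>] if_not_P[OF \<open>k \<noteq> j\<close>] by (intro c4 4)
  qed
qed

text \<open>The set of these products is closed under left multiplication by generators, by
  \<open>simple_refl_coset_rep\<close>.\<close>

lemma refl_group_cosets:
  assumes K0: "\<And>k. k \<in> K0 \<Longrightarrow> k + 1 < a" and am: "a \<le> m"
  shows "refl_group (K0 \<union> {a..m}) =
    (\<lambda>(j, u). coset_rep m j \<circ> u) ` ({a..m + 1} \<times> refl_group (K0 \<union> {a..<m}))"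
proof
  let ?K' = "K0 \<union> {a..<m}"
  show "refl_group (K0 \<union> {a..m}) \<subseteq> (\<lambda>(j, u). coset_rep m j \<circ> u) ` ({a..m + 1} \<times> refl_group ?K')"
  proof
    fix \<sigma> assume "\<sigma> \<in> refl_group (K0 \<union> {a..m})"
    then obtain w where "set w \<subseteq> K0 \<union> {a..m}" "\<sigma> = word_perm w" by (rule refl_groupE)
    then show "\<sigma> \<in> (\<lambda>(j, u). coset_rep m j \<circ> u) ` ({a..m + 1} \<times> refl_group ?K')"
    proof (induction w arbitrary: \<sigma>)
      case Nil
      then have "\<sigma> = coset_rep m (m + 1) \<circ> id" by (simp only: coset_rep_last word_perm_simps id_comp)
      then show ?case using am id_refl_group[of ?K'] by (intro image_eqI[of _ _ "(m + 1, id)"]) simp_all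
    next
      case (Cons k w)
      then obtain j u where ju: "word_perm w = coset_rep m j \<circ> u" "j \<in> {a..m + 1}" "u \<in> refl_group ?K'"
        by fastforce
      have k: "k \<in> K0 \<union> {a..m}" using Cons.prems by simp
      then have km: "k \<le> m" using K0 am by fastforce
      have comp: "simple_refl i \<circ> u \<in> refl_group ?K'" if "i \<in> ?K'" for i
        using that ju(3) by (intro refl_group_comp refl_group_simple)
      have eq: "\<sigma> = simple_refl k \<circ> (coset_rep m j \<circ> u)" unfolding Cons.prems(2) word_perm_simps ju(1) ..
      consider "k + 1 < j" | "k + 1 = j" | "k = j" | "j < k" by linarith
      then show ?case
      proof cases
        case 1
        then have "k \<in> ?K'" using k ju(2) by auto
        then show ?thesis using eq simple_refl_coset_rep[OF _ km, of j u] 1 ju(2) comp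
          by (intro image_eqI[of _ _ "(j, simple_refl k \<circ> u)"]) auto
      next
        case 2
        \<comment> \<open>A letter of K0 satisfies k + 1 < a and so cannot precede j, which is at
          least a.\<close>
        then have "a \<le> k" using k K0 ju(2) by fastforce
        then show ?thesis using eq simple_refl_coset_rep[OF _ km, of j u] 2 ju km
          by (intro image_eqI[of _ _ "(k, u)"]) auto
      next
        case 3
        then show ?thesis using eq simple_refl_coset_rep[OF _ km, of j u] ju km
          by (intro image_eqI[of _ _ "(j + 1, u)"]) auto
      next
        case 4
        then have "k - 1 \<in> ?K'" using km ju(2) by auto
        then show ?thesis using eq simple_refl_coset_rep[OF _ km, of j u] 4 ju(2) comp
          by (intro image_eqI[of _ _ "(j, simple_refl (k - 1) \<circ> u)"]) auto
      qed
    qed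
  qed
  have rep: "coset_rep m j \<in> refl_group (K0 \<union> {a..m})" if "j \<in> {a..m + 1}" for j
  proof -
    have "j \<le> m + 1" using that by simp
    then show ?thesis using that
    proof (induction j rule: inc_induct)
      case base
      then show ?case by (simp only: coset_rep_last id_refl_group)
    next
      case (step j)
      have "coset_rep m j = simple_refl j \<circ> (coset_rep m (j + 1) \<circ> id)"
        using simple_refl_coset_rep[of "j + 1" m j id] step by simp
      then have "coset_rep m j = simple_refl j \<circ> coset_rep m (j + 1)" by (simp only: comp_id)
      moreover have "simple_refl j \<in> refl_group (K0 \<union> {a..m})" using step by (intro refl_group_simple) simp
      moreover have "coset_rep m (j + 1) \<in> refl_group (K0 \<union> {a..m})" using step by simp
      ultimately show ?case using refl_group_comp by metis
    qed
  qed
  show "(\<lambda>(j, u). coset_rep m j \<circ> u) ` ({a..m + 1} \<times> refl_group ?K') \<subseteq> refl_group (K0 \<union> {a..m})"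
  proof clarify
    fix j u assume "j \<in> {a..m + 1}" "u \<in> refl_group ?K'"
    then show "coset_rep m j \<circ> u \<in> refl_group (K0 \<union> {a..m})"
      using rep[of j] refl_group_mono[of ?K' "K0 \<union> {a..m}"] ivl_subset[of a m] by (intro refl_group_comp) fastforce+
  qed
qed

text \<open>Elements u of the smaller group fix m + 1, so j is recovered as the image of m + 1 and
  the factorisation is unique. Each prepended s_j raises the length: the inverse sends j + 1 to m +
  1 but j to at most m. The coset of j thus contributes x^(m + 1 - j).\<close>

lemma poincare_step:
  fixes x :: "'a::comm_semiring_1"
  assumes K0: "\<And>k. k \<in> K0 \<Longrightarrow> k + 1 < a" and am: "a \<le> m" and Kn: "K0 \<union> {a..m} \<subseteq> {1..<n}"
  shows "poincare n (K0 \<union> {a..m}) x = poincare n (K0 \<union> {a..<m}) x * (\<Sum>r\<le>m + 1 - a. x ^ r)"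
proof -
  let ?K' = "K0 \<union> {a..<m}"
  have cosets: "refl_group (K0 \<union> {a..m}) =
      (\<lambda>(j, u). coset_rep m j \<circ> u) ` ({a..m + 1} \<times> refl_group ?K')"
    using K0 am by (rule refl_group_cosets)
  have K'_sub: "?K' \<subseteq> {1..<n}" "?K' \<subseteq> {..<m}" using Kn K0 am by fastforce+
  have u_last: "u (m + 1) = m + 1" if "u \<in> refl_group ?K'" for u
    using that K'_sub(2) by (auto elim!: refl_groupE intro!: word_perm_fixes[of _ ?K'])
  have inj: "inj_on (\<lambda>(j, u). coset_rep m j \<circ> u) ({a..m + 1} \<times> refl_group ?K')"
  proof (rule inj_onI, clarsimp)
    fix j u j' u' assume u: "u \<in> refl_group ?K'" "u' \<in> refl_group ?K'" "j \<le> Suc m" "j' \<le> Suc m"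
      and eq: "coset_rep m j \<circ> u = coset_rep m j' \<circ> u'"
    from fun_cong[OF eq, of "m + 1"] have j: "j = j'" by (simp add: u_last[OF u(1), simplified] u_last[OF u(2), simplified] coset_rep_def)
    have "inj (coset_rep m j)" using u(3) by (auto simp: inj_def coset_rep_def split: if_splits)
    then have "u = u'" using eq j by (metis fun.inj_map_strong injD comp_assoc inj_iff id_comp)
    with j show "j = j' \<and> u = u'" by simp
  qed
  have len: "coxeter_length n (coset_rep m j \<circ> u) = coxeter_length n u + (m + 1 - j)"
    if u: "u \<in> refl_group ?K'" and j: "j \<in> {a..m + 1}" for j u
  proof -
    have "j \<le> m + 1" using j by simp
    then show ?thesis using j
    proof (induction j rule: inc_induct)
      case base
      then show ?case by (simp add: coset_rep_last[unfolded Suc_eq_plus1[symmetric]])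
    next
      case (step j)
      let ?\<sigma> = "coset_rep m (j + 1) \<circ> u"
      have \<sigma>: "?\<sigma> \<in> refl_group {1..<n}"
        using cosets u step refl_group_mono[OF Kn] by fastforce
      have "j \<in> {a..m}" using step by simp
      then have jn: "j \<in> {1..<n}" using Kn by blast
      have eq: "coset_rep m j \<circ> u = simple_refl j \<circ> ?\<sigma>"
        using simple_refl_coset_rep[of "j + 1" m j u] step by simp
      have inv1: "Hilbert_Choice.inv ?\<sigma> (j + 1) = m + 1"
        using refl_group_bij[OF \<sigma>] u_last[OF u] by (intro inv_f_eq) (simp_all add: bij_is_inj coset_rep_def)
      have "Hilbert_Choice.inv ?\<sigma> j = Hilbert_Choice.inv u j"
      proof (rule inv_f_eq)
        have "u (Hilbert_Choice.inv u j) = j" using refl_group_bij[OF u] by (simp add: bij_is_surj surj_f_inv_f)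
        then show "?\<sigma> (Hilbert_Choice.inv u j) = j" using step by (simp add: coset_rep_def)
      qed (use refl_group_bij[OF \<sigma>] in \<open>simp add: bij_is_inj\<close>)
      moreover have "Hilbert_Choice.inv u j \<le> m"
      proof -
        obtain w where w: "set w \<subseteq> ?K'" "Hilbert_Choice.inv u = word_perm w"
          using refl_group_inv[OF u] by (rule refl_groupE)
        show ?thesis unfolding w(2) using step by (intro word_perm_le subset_trans[OF w(1) K'_sub(2)]) simp
      qed
      ultimately have "\<not> descent ?\<sigma> j" using inv1 by simp
      note asc = coxeter_length_ascent[OF \<sigma> jn this]
      have "Suc j \<in> {a..m + 1}" using step by simp
      from step.IH[OF this] have IH: "coxeter_length n ?\<sigma> = coxeter_length n u + (m + 1 - Suc j)"
        unfolding Suc_eq_plus1 .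
      show ?case unfolding eq asc IH using step(1,2) by simp
    qed
  qed
  have "poincare n (K0 \<union> {a..m}) x =
      (\<Sum>(j, u)\<in>{a..m + 1} \<times> refl_group ?K'. x ^ coxeter_length n (coset_rep m j \<circ> u))"
    unfolding poincare_def cosets sum.reindex[OF inj]
    by (intro sum.cong refl) (simp only: comp_apply case_prod_unfold)
  also have "\<dots> = (\<Sum>j\<in>{a..m + 1}. \<Sum>u\<in>refl_group ?K'. x ^ coxeter_length n u * x ^ (m + 1 - j))"
    unfolding sum.cartesian_product[symmetric] by (intro sum.cong refl) (simp only: len power_add)
  also have "\<dots> = poincare n ?K' x * (\<Sum>j\<in>{a..m + 1}. x ^ (m + 1 - j))"
    unfolding poincare_def sum_product by (rule sum.swap)
  also have "(\<Sum>j\<in>{a..m + 1}. x ^ (m + 1 - j)) = (\<Sum>r\<le>m + 1 - a. x ^ r)"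
    by (rule sum.reindex_bij_witness[where i = "\<lambda>r. m + 1 - r" and j = "\<lambda>j. m + 1 - j"]) (use am in auto)
  finally show ?thesis .
qed

lemma q_number_eq_sum:
  assumes "x \<noteq> 1"
  shows "q_number x (Suc k) = (\<Sum>r\<le>k. x ^ r)"
  using assms by (simp add: q_number_def sum_gp0)

text \<open>A run of d consecutive generators generates a symmetric group on d + 1 letters, hence
  the factorial of \<open>Suc d\<close>.\<close>

lemma poincare_run:
  fixes x :: "'a::field"
  assumes K0: "\<And>k. k \<in> K0 \<Longrightarrow> k + 1 < a" and Kn: "K0 \<union> {a..<a + d} \<subseteq> {1..<n}" and x: "x \<noteq> 1"
  shows "poincare n (K0 \<union> {a..<a + d}) x = poincare n K0 x * q_factorial x (Suc d)"
  using Kn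
proof (induction d)
  case 0
  then show ?case using x by (simp add: q_factorial_def q_number_def)
next
  case (Suc d)
  have "{a..<a + Suc d} = {a..a + d}" by auto
  then have "poincare n (K0 \<union> {a..<a + Suc d}) x = poincare n (K0 \<union> {a..<a + d}) x * (\<Sum>r\<le>Suc d. x ^ r)"
    using poincare_step[of K0 a "a + d" n x] K0 Suc.prems by simp
  also have "\<dots> = poincare n K0 x * q_factorial x (Suc d) * q_number x (Suc (Suc d))"
    using Suc by (simp only: q_number_eq_sum[OF x]) auto
  finally show ?case by (simp add: q_factorial_def)
qed

lemma poincare_empty: "poincare n {} x = 1"
proof -
  have "refl_group {} = {id}" by (auto simp: refl_group_def)
  then show ?thesis using coxeter_length_le[of "[]" n] by (simp add: poincare_def)
qed

section \<open>Decomposition into maximal runs\<close>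

lemma maximal_runs_empty: "maximal_runs {} = {}"
  by (auto simp: maximal_runs_def)

lemma maximal_runsI:
  assumes "c \<le> d" "{c..d} \<subseteq> K"
    and "\<And>c' d'. {c..d} \<subseteq> {c'..d'} \<Longrightarrow> {c'..d'} \<subseteq> K \<Longrightarrow> {c'..d'} = {c..d}"
  shows "{c..d} \<in> maximal_runs K"
  unfolding maximal_runs_def mem_Collect_eq
proof (rule exI[of _ c], rule exI[of _ d], intro conjI allI impI)
  fix c' d' assume "{c..d} \<subseteq> {c'..d'} \<and> {c'..d'} \<subseteq> K"
  then show "{c'..d'} = {c..d}" by (elim conjE) (rule assms(3))
qed (fact assms refl)+

lemma maximal_runsE:
  assumes "A \<in> maximal_runs K"
  obtains c d where "c \<le> d" "A = {c..d}" "{c..d} \<subseteq> K"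
    "\<And>c' d'. {c..d} \<subseteq> {c'..d'} \<Longrightarrow> {c'..d'} \<subseteq> K \<Longrightarrow> {c'..d'} = {c..d}"
proof -
  from assms obtain c d where P: "c \<le> d \<and> A = {c..d} \<and> A \<subseteq> K \<and>
      (\<forall>c' d'. A \<subseteq> {c'..d'} \<and> {c'..d'} \<subseteq> K \<longrightarrow> {c'..d'} = A)"
    unfolding maximal_runs_def mem_Collect_eq by (elim exE)
  have A: "A = {c..d}" by (rule P[THEN conjunct2, THEN conjunct1])
  show thesis
  proof (rule that[of c d])
    show "c \<le> d" by (rule P[THEN conjunct1])
    show "A = {c..d}" by (rule A)
    show "{c..d} \<subseteq> K" by (rule P[THEN conjunct2, THEN conjunct2, THEN conjunct1, unfolded A])
    show "{c'..d'} = {c..d}" if "{c..d} \<subseteq> {c'..d'}" "{c'..d'} \<subseteq> K" for c' d'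
      by (rule P[THEN conjunct2, THEN conjunct2, THEN conjunct2, unfolded A, rule_format]) (intro conjI that)
  qed
qed

text \<open>K0 stops before a - 1, and this gap prevents an interval inside the union from meeting
  both parts.\<close>

lemma maximal_runs_insert:
  assumes K0: "\<And>k. k \<in> K0 \<Longrightarrow> k + 1 < a" and am: "a \<le> m"
  shows "maximal_runs (K0 \<union> {a..m}) = insert {a..m} (maximal_runs K0)"
proof -
  have split: "{c..d} \<subseteq> K0 \<or> {c..d} \<subseteq> {a..m}" if "{c..d} \<subseteq> K0 \<union> {a..m}" for c d
  proof (cases "c \<le> d \<and> c < a \<and> a \<le> d")
    case True
    then have "a - 1 \<in> {c..d}" by auto
    then have "a - 1 \<in> K0" using that True by fastforce
    then show ?thesis using K0[of "a - 1"] True by simp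
  next
    case False
    then show ?thesis using that K0 by fastforce
  qed
  have disj: "K0 \<inter> {a..m} = {}" using K0 by fastforce
  show ?thesis
  proof (rule subset_antisym; rule subsetI)
    fix A assume "A \<in> maximal_runs (K0 \<union> {a..m})"
    then obtain c d where cd: "c \<le> d" "A = {c..d}" "{c..d} \<subseteq> K0 \<union> {a..m}"
      and mx: "\<And>c' d'. {c..d} \<subseteq> {c'..d'} \<Longrightarrow> {c'..d'} \<subseteq> K0 \<union> {a..m} \<Longrightarrow> {c'..d'} = {c..d}"
      by (rule maximal_runsE) blast
    from split[OF cd(3)] show "A \<in> insert {a..m} (maximal_runs K0)"
    proof
      assume "{c..d} \<subseteq> K0"
      then have "{c..d} \<in> maximal_runs K0" by (rule maximal_runsI[OF cd(1)]) (rule mx, auto)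
      then show ?thesis by (simp add: cd(2))
    next
      assume "{c..d} \<subseteq> {a..m}"
      then have "{a..m} = {c..d}" by (rule mx) auto
      then show ?thesis unfolding cd(2) by blast
    qed
  next
    fix A assume "A \<in> insert {a..m} (maximal_runs K0)"
    then show "A \<in> maximal_runs (K0 \<union> {a..m})"
    proof
      assume A: "A = {a..m}"
      have "{c..d} = {a..m}" if "{a..m} \<subseteq> {c..d}" "{c..d} \<subseteq> K0 \<union> {a..m}" for c d
        using split[OF that(2)]
      proof
        assume "{c..d} \<subseteq> K0"
        then have "a \<in> K0" using that(1) am by auto
        then show ?thesis using disj am by auto
      qed (use that in auto)
      then show ?thesis unfolding A using am by (intro maximal_runsI) auto
    next
      assume "A \<in> maximal_runs K0"
      then obtain c d where cd: "c \<le> d" "A = {c..d}" "{c..d} \<subseteq> K0"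
        and mx: "\<And>c' d'. {c..d} \<subseteq> {c'..d'} \<Longrightarrow> {c'..d'} \<subseteq> K0 \<Longrightarrow> {c'..d'} = {c..d}"
        by (rule maximal_runsE) blast
      have "{c'..d'} = {c..d}" if "{c..d} \<subseteq> {c'..d'}" "{c'..d'} \<subseteq> K0 \<union> {a..m}" for c' d'
        using split[OF that(2)]
      proof
        assume "{c'..d'} \<subseteq> {a..m}"
        then have "{c..d} \<subseteq> {a..m}" using that(1) by blast
        moreover have "c \<in> {c..d}" using cd(1) by simp
        ultimately show ?thesis using cd(3) disj by blast
      qed (use that mx in blast)
      then show ?thesis unfolding cd(2) using cd by (intro maximal_runsI) auto
    qed
  qed
qed

text \<open>The induction peels off the topmost run. Finiteness of the set of runs is carried along
  because the product must be extended by one factor.\<close>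

lemma poincare_eq_prod_runs:
  fixes x :: "'a::field"
  assumes Kn: "K \<subseteq> {1..<n}" and x: "x \<noteq> 1"
  shows "finite (maximal_runs K) \<and>
    poincare n K x = (\<Prod>A\<in>maximal_runs K. q_factorial x (card (extend_run A)))"
  using Kn
proof (induction "card K" arbitrary: K rule: less_induct)
  case less
  show ?case
  proof (cases "K = {}")
    case True
    then show ?thesis by (simp add: maximal_runs_empty poincare_empty)
  next
    case False
    have fin: "finite K" using less.prems finite_subset by blast
    define m where "m = Max K"
    have m: "m \<in> K" "\<And>k. k \<in> K \<Longrightarrow> k \<le> m" using fin False by (auto simp: m_def)
    \<comment> \<open>The least left end, so that a - 1 is not in K and the rest K0 is separated
      from the run by a gap.\<close>
    define a where "a = (LEAST a. {a..m} \<subseteq> K)"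
    have a: "{a..m} \<subseteq> K" unfolding a_def by (rule LeastI[of _ m]) (use m in auto)
    have am: "a \<le> m" unfolding a_def by (rule Least_le) (use m in auto)
    define K0 where "K0 = K - {a..m}"
    have K: "K = K0 \<union> {a..m}" using a by (auto simp: K0_def)
    have K0: "k + 1 < a" if "k \<in> K0" for k
    proof -
      have "k < a" using that m(2)[of k] by (auto simp: K0_def)
      moreover have "k + 1 \<noteq> a"
      proof
        assume "k + 1 = a"
        then have "{k..m} = insert k {a..m}" using am by auto
        then have "{k..m} \<subseteq> K" using a that by (auto simp: K0_def)
        then have "a \<le> k" unfolding a_def by (rule Least_le)
        then show False using \<open>k < a\<close> by simp
      qed
      ultimately show ?thesis by simp
    qed
    have "card K0 < card K" using fin m am by (intro psubset_card_mono) (auto simp: K0_def)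
    then have IH: "finite (maximal_runs K0)"
      "poincare n K0 x = (\<Prod>A\<in>maximal_runs K0. q_factorial x (card (extend_run A)))"
      using less.hyps[of K0] less.prems by (auto simp: K0_def)
    have notin: "{a..m} \<notin> maximal_runs K0"
    proof
      assume "{a..m} \<in> maximal_runs K0"
      then have "{a..m} \<subseteq> K0" by (auto simp: maximal_runs_def)
      then show False using am by (auto simp: K0_def)
    qed
    have runs: "maximal_runs K = insert {a..m} (maximal_runs K0)"
      unfolding K by (rule maximal_runs_insert[OF K0 am])
    have int: "{a..m} = {a..<a + (m + 1 - a)}" using am by auto
    have "Max {a..m} = m" using am by (intro Max_eqI) auto
    then have ext: "extend_run {a..m} = {a..m + 1}"
      using am by (auto simp: extend_run_def)
    have "poincare n K x = poincare n K0 x * q_factorial x (Suc (m + 1 - a))"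
      using poincare_run[of K0 a "m + 1 - a" n x] K0 less.prems x unfolding K int by blast
    also have "Suc (m + 1 - a) = card (extend_run {a..m})" using am by (simp add: ext)
    finally show ?thesis using IH notin by (simp add: runs mult.commute)
  qed
qed

section \<open>Admissible pairs\<close>

lemma admissible_sub:
  assumes "admissible n I J"
  shows "I \<subseteq> {1..<n}" "J \<subseteq> {1..<n}" "I \<union> J \<subseteq> {1..<n}" "I \<inter> J = {}"
proof -
  have "{1..n - 1} \<subseteq> {1..<n}" by auto
  then show "I \<subseteq> {1..<n}" "J \<subseteq> {1..<n}" "I \<union> J \<subseteq> {1..<n}" "I \<inter> J = {}"
    using assms unfolding admissible_def by blast+
qed

lemma admissible_far:
  assumes "admissible n I J" "i \<in> I" "j \<in> J"
  shows "i + 1 < j \<or> j + 1 < i"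
proof -
  have "i \<noteq> j" "i + 1 \<noteq> j" using assms by (auto simp: admissible_def)
  moreover have "j + 1 \<noteq> i" using assms by (auto simp: admissible_def)
  ultimately show ?thesis by linarith
qed

lemma simple_refl_word_commute:
  assumes "admissible n I J" "j \<in> J" "set v \<subseteq> I"
  shows "simple_refl j \<circ> word_perm v = word_perm v \<circ> simple_refl j"
  using assms(3)
proof (induction v)
  case (Cons i v)
  have "i + 1 < j \<or> j + 1 < i" using admissible_far[OF assms(1) _ assms(2)] Cons.prems by simp
  then have comm: "simple_refl j (simple_refl i x) = simple_refl i (simple_refl j x)" for x
    using simple_refl_commute by metis
  have IH: "simple_refl j (word_perm v x) = word_perm v (simple_refl j x)" for x
    using fun_cong[OF Cons.IH, of x] Cons.prems by simp
  show ?case by (rule ext) (simp only: word_perm_simps comp_apply comm IH)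
qed (simp only: word_perm_simps id_comp comp_id)

text \<open>Letters from I and J differ by at least 2 and so commute; hence any word can be sorted
  with its I-letters first.\<close>

lemma word_perm_filter:
  assumes adm: "admissible n I J" and u: "set u \<subseteq> I \<union> J"
  shows "word_perm u = word_perm (filter (\<lambda>i. i \<in> I) u) \<circ> word_perm (filter (\<lambda>i. i \<in> J) u)"
  using u
proof (induction u)
  case (Cons i u)
  let ?a = "word_perm (filter (\<lambda>i. i \<in> I) u)" and ?b = "word_perm (filter (\<lambda>i. i \<in> J) u)"
  have IH: "word_perm u = ?a \<circ> ?b" by (rule Cons.IH) (use Cons.prems in simp)
  show ?case
  proof (cases "i \<in> I")
    case True
    then have "i \<notin> J" using admissible_sub(4)[OF adm] by blast
    then show ?thesis using True by (simp only: filter.simps if_True if_False word_perm_simps IH comp_assoc)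
  next
    case False
    then have iJ: "i \<in> J" using Cons.prems by simp
    have "simple_refl i \<circ> ?a = ?a \<circ> simple_refl i"
      by (rule simple_refl_word_commute[OF adm iJ]) auto
    then have "simple_refl i \<circ> (?a \<circ> ?b) = ?a \<circ> (simple_refl i \<circ> ?b)" by (metis comp_assoc)
    then show ?thesis using False iJ by (simp only: filter.simps if_True if_False word_perm_simps IH)
  qed
qed (simp only: filter.simps word_perm_simps comp_id)

text \<open>Elements of the first group move only points k, k + 1 with k in I, those of the second
  only such points for J; admissibility makes these sets disjoint.\<close>

lemma refl_group_Int_trivial:
  assumes adm: "admissible n I J" and \<sigma>: "\<sigma> \<in> refl_group I" "\<sigma> \<in> refl_group J"
  shows "\<sigma> = id"
proof (rule ext)
  fix x
  obtain u where u: "set u \<subseteq> I" "\<sigma> = word_perm u" using \<sigma>(1) by (rule refl_groupE)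
  obtain v where v: "set v \<subseteq> J" "\<sigma> = word_perm v" using \<sigma>(2) by (rule refl_groupE)
  show "\<sigma> x = id x"
  proof (cases "x \<in> I \<or> (\<exists>k\<in>I. x = k + 1)")
    case True
    then obtain k where k: "k \<in> I" "x = k \<or> x = k + 1" by blast
    have "x \<notin> J" using admissible_far[OF adm k(1), of x] k(2) by auto
    moreover have "x \<noteq> j + 1" if "j \<in> J" for j using admissible_far[OF adm k(1) that] k(2) by auto
    ultimately show ?thesis using word_perm_fixes[OF v(1), of x] v(2) by simp
  next
    case False
    then show ?thesis using word_perm_fixes[OF u(1), of x] u(2) by simp
  qed
qed

lemma refl_group_decomp_unique:
  assumes adm: "admissible n I J" and a: "a \<in> refl_group I" "a' \<in> refl_group I"
    and b: "b \<in> refl_group J" "b' \<in> refl_group J" and eq: "a \<circ> b = a' \<circ> b'"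
  shows "a = a'" "b = b'"
proof -
  note bij = refl_group_bij[OF a(1)] refl_group_bij[OF a(2)] refl_group_bij[OF b(1)] refl_group_bij[OF b(2)]
  define g where "g = Hilbert_Choice.inv a' \<circ> a"
  have "a (b x) = a' (b' x)" for x using fun_cong[OF eq, of x] by simp
  then have gb: "g (b x) = b' x" for x using bij(2) by (simp add: g_def bij_is_inj)
  have "g = b' \<circ> Hilbert_Choice.inv b"
  proof (rule ext)
    fix x
    show "g x = (b' \<circ> Hilbert_Choice.inv b) x"
      using gb[of "Hilbert_Choice.inv b x"] bij(3) by (simp add: bij_is_surj surj_f_inv_f)
  qed
  then have "g \<in> refl_group J" using b by (metis refl_group_comp refl_group_inv)
  moreover have "g \<in> refl_group I" unfolding g_def using a by (intro refl_group_comp refl_group_inv)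
  ultimately have g: "g = id" using refl_group_Int_trivial[OF adm] by blast
  show "b = b'" using gb by (intro ext) (simp add: g)
  show "a = a'"
  proof (rule ext)
    fix x
    have "Hilbert_Choice.inv a' (a x) = x" using fun_cong[OF g, of x] by (simp add: g_def)
    then show "a x = a' x" using bij(2) by (metis bij_inv_eq_iff)
  qed
qed

lemma J_part_comp:
  assumes adm: "admissible n I J" and ab: "a \<in> refl_group I" "b \<in> refl_group J"
  shows "J_part n I J (a \<circ> b) = b"
  unfolding J_part_def parabolic_eq_refl_group[OF admissible_sub(1)[OF adm]]
    parabolic_eq_refl_group[OF admissible_sub(2)[OF adm]]
proof (rule the_equality)
  show "b \<in> refl_group J \<and> (\<exists>\<omega>I\<in>refl_group I. a \<circ> b = \<omega>I \<circ> b)" using ab by blast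
  fix b' assume "b' \<in> refl_group J \<and> (\<exists>\<omega>I\<in>refl_group I. a \<circ> b = \<omega>I \<circ> b')"
  then show "b' = b" using refl_group_decomp_unique(2)[OF adm ab(1) _ ab(2)] by metis
qed

lemma coxeter_length_comp_le:
  assumes "\<sigma> \<in> refl_group {1..<n}" "\<tau> \<in> refl_group {1..<n}"
  shows "coxeter_length n (\<sigma> \<circ> \<tau>) \<le> coxeter_length n \<sigma> + coxeter_length n \<tau>"
proof -
  obtain u v where u: "reduced_word n \<sigma> u" and v: "reduced_word n \<tau> v"
    using assms reduced_word_exists by metis
  have "word_perm (u @ v) = \<sigma> \<circ> \<tau>" "set (u @ v) \<subseteq> {1..<n}"
    using u v by (auto simp only: word_perm_append reduced_word_def set_append Un_iff subset_iff)
  from coxeter_length_le[OF this(2)] this(1) show ?thesis using u v by (simp add: reduced_word_def)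
qed

lemma length_filter_partition:
  assumes "set u \<subseteq> I \<union> J" "I \<inter> J = {}"
  shows "length (filter (\<lambda>i. i \<in> I) u) + length (filter (\<lambda>i. i \<in> J) u) = length u"
  using assms by (induction u) auto

text \<open>The two filtered words have total length l(\<sigma>). Since length is subadditive,
  neither can be shortened, so both are reduced and the lengths add.\<close>

lemma reduced_word_parts:
  assumes adm: "admissible n I J" and u: "set u \<subseteq> I \<union> J" "reduced_word n \<sigma> u"
  defines "uI \<equiv> filter (\<lambda>i. i \<in> I) u" and "uJ \<equiv> filter (\<lambda>i. i \<in> J) u"
  shows "\<sigma> = word_perm uI \<circ> word_perm uJ"
    "word_perm uI \<in> refl_group I" "word_perm uJ \<in> refl_group J"
    "J_part n I J \<sigma> = word_perm uJ"
    "coxeter_length n (word_perm uI) = length uI" "coxeter_length n (word_perm uJ) = length uJ"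
    "coxeter_length n \<sigma> = length uI + length uJ"
proof -
  have subs: "set uI \<subseteq> I" "set uJ \<subseteq> J" by (auto simp: uI_def uJ_def)
  show \<sigma>: "\<sigma> = word_perm uI \<circ> word_perm uJ"
    using word_perm_filter[OF adm u(1)] u(2) by (simp only: reduced_word_def uI_def uJ_def)
  show gI: "word_perm uI \<in> refl_group I" and gJ: "word_perm uJ \<in> refl_group J"
    using subs by (auto intro: refl_groupI)
  show "J_part n I J \<sigma> = word_perm uJ" unfolding \<sigma> by (rule J_part_comp[OF adm gI gJ])
  have "length uI + length uJ = length u"
    unfolding uI_def uJ_def using u(1) admissible_sub(4)[OF adm] by (rule length_filter_partition)
  then show len: "coxeter_length n \<sigma> = length uI + length uJ" using u(2) by (simp add: reduced_word_def)
  have gn: "word_perm uI \<in> refl_group {1..<n}" "word_perm uJ \<in> refl_group {1..<n}"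
    using gI gJ refl_group_mono[OF admissible_sub(1)[OF adm]] refl_group_mono[OF admissible_sub(2)[OF adm]] by auto
  have "coxeter_length n \<sigma> \<le> coxeter_length n (word_perm uI) + coxeter_length n (word_perm uJ)"
    unfolding \<sigma> by (rule coxeter_length_comp_le[OF gn])
  moreover have "coxeter_length n (word_perm uI) \<le> length uI" "coxeter_length n (word_perm uJ) \<le> length uJ"
    using subs admissible_sub(1,2)[OF adm] by (auto intro!: coxeter_length_le)
  ultimately show "coxeter_length n (word_perm uI) = length uI" "coxeter_length n (word_perm uJ) = length uJ"
    using len by linarith+
qed

lemma t_ind_neq_1: "t_ind \<noteq> 1" "inverse t_ind \<noteq> 1"
proof -
  have "[:[:0, 1:]:] \<noteq> (1 :: rat poly poly)" by (simp add: one_pCons)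
  then show 1: "t_ind \<noteq> 1" unfolding t_ind_def by (metis to_fract_1 to_fract_eq_iff)
  then show "inverse t_ind \<noteq> 1" by (metis inverse_1 inverse_inverse_eq)
qed

text \<open>By additivity the difference of lengths is the length of the I-part. The sum over W_(I
  \<union> J) then factors into the Poincare polynomials of W_I at 1/t and of W_J at t.\<close>

lemma K_const_eq_sum:
  assumes adm: "admissible n I J"
  shows "K_const I J = (\<Sum>\<sigma>\<in>refl_group (I \<union> J). t_ind ^ coxeter_length n (J_part n I J \<sigma>) *
    inverse t_ind ^ (coxeter_length n \<sigma> - coxeter_length n (J_part n I J \<sigma>)))"
proof -
  let ?F = "\<lambda>\<sigma>. t_ind ^ coxeter_length n (J_part n I J \<sigma>) *
    inverse t_ind ^ (coxeter_length n \<sigma> - coxeter_length n (J_part n I J \<sigma>))"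
  let ?f = "\<lambda>(a, b). a \<circ> b"
  have ex: "\<exists>u. set u \<subseteq> I \<union> J \<and> reduced_word n \<sigma> u" if "\<sigma> \<in> refl_group (I \<union> J)" for \<sigma>
    using reduced_word_exists_parabolic[OF admissible_sub(3)[OF adm] that] .
  have inj: "inj_on ?f (refl_group I \<times> refl_group J)"
    by (rule inj_onI) (use refl_group_decomp_unique[OF adm] in force)
  have in_union: "a \<circ> b \<in> refl_group (I \<union> J)" if "a \<in> refl_group I" "b \<in> refl_group J" for a b
    using that refl_group_mono[of I "I \<union> J"] refl_group_mono[of J "I \<union> J"] by (intro refl_group_comp) auto
  have img: "refl_group (I \<union> J) = ?f ` (refl_group I \<times> refl_group J)"
  proof
    show "refl_group (I \<union> J) \<subseteq> ?f ` (refl_group I \<times> refl_group J)"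
    proof
      fix \<sigma> assume "\<sigma> \<in> refl_group (I \<union> J)"
      then obtain u where u: "set u \<subseteq> I \<union> J" "reduced_word n \<sigma> u" using ex by blast
      show "\<sigma> \<in> ?f ` (refl_group I \<times> refl_group J)"
        by (rule image_eqI[OF _ SigmaI[OF reduced_word_parts(2,3)[OF adm u]]])
          (simp only: prod.case reduced_word_parts(1)[OF adm u, symmetric])
    qed
    show "?f ` (refl_group I \<times> refl_group J) \<subseteq> refl_group (I \<union> J)" using in_union by auto
  qed
  have F: "?F (a \<circ> b) = inverse t_ind ^ coxeter_length n a * t_ind ^ coxeter_length n b"
    if ab: "a \<in> refl_group I" "b \<in> refl_group J" for a b
  proof -
    obtain u where u: "set u \<subseteq> I \<union> J" "reduced_word n (a \<circ> b) u" using ex in_union[OF ab] by blast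
    note p = reduced_word_parts[OF adm u]
    have a: "a = word_perm (filter (\<lambda>i. i \<in> I) u)"
      by (rule refl_group_decomp_unique(1)[OF adm ab(1) p(2) ab(2) p(3) p(1)])
    have b: "b = word_perm (filter (\<lambda>i. i \<in> J) u)"
      by (rule refl_group_decomp_unique(2)[OF adm ab(1) p(2) ab(2) p(3) p(1)])
    have "coxeter_length n (a \<circ> b) = coxeter_length n a + coxeter_length n b"
      using p(5-7) a b by metis
    then show ?thesis unfolding J_part_comp[OF adm ab] by simp
  qed
  have "(\<Sum>\<sigma>\<in>refl_group (I \<union> J). ?F \<sigma>) = (\<Sum>p\<in>refl_group I \<times> refl_group J. ?F (?f p))"
    unfolding img sum.reindex[OF inj] by (rule sum.cong[OF refl]) (simp only: comp_apply)
  also have "\<dots> = (\<Sum>(a, b)\<in>refl_group I \<times> refl_group J. inverse t_ind ^ coxeter_length n a * t_ind ^ coxeter_length n b)"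
  proof (rule sum.cong[OF refl])
    fix p assume p: "p \<in> refl_group I \<times> refl_group J"
    obtain a b where "p = (a, b)" by (cases p)
    with p F show "?F (?f p) = (case p of (a, b) \<Rightarrow> inverse t_ind ^ coxeter_length n a * t_ind ^ coxeter_length n b)"
      by (simp only: prod.case mem_Sigma_iff)
  qed
  also have "\<dots> = poincare n I (inverse t_ind) * poincare n J t_ind"
    unfolding poincare_def sum_product sum.cartesian_product ..
  also have "\<dots> = K_const I J"
    using poincare_eq_prod_runs[OF admissible_sub(1)[OF adm] t_ind_neq_1(2)]
      poincare_eq_prod_runs[OF admissible_sub(2)[OF adm] t_ind_neq_1(1)]
    unfolding K_const_def by (simp only: mult.commute)
  finally show ?thesis ..
qed

section \<open>The symmetriser\<close>

lemma T_word_eq_foldr: "T_word w f = foldr T_op w f"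
  by (induction w) (simp_all add: T_word_def)

text \<open>Matsumoto's theorem frees \<open>T_perm\<close> from the reduced word selected by
  \<open>SOME\<close>.\<close>

lemma T_perm_reduced:
  assumes "reduced_word n \<sigma> u"
  shows "T_perm n \<sigma> f = foldr T_op u f"
proof -
  have "reduced_word n \<sigma> (SOME w. reduced_word n \<sigma> w)" using assms by (rule someI)
  from matsumoto[of T_op, OF T_op_commute T_op_braid this assms] show ?thesis
    by (simp add: T_perm_def T_word_eq_foldr)
qed

text \<open>The factor by which the coefficient in O changes when the letter k lengthens the
  permutation. \<open>T_eigen\<close> is the eigenvalue of T_k that goes with it.\<close>

definition T_weight :: "nat set \<Rightarrow> nat \<Rightarrow> ratfun" where
  "T_weight J k = (if k \<in> J then - 1 / t_ind else 1)"

definition T_eigen :: "nat set \<Rightarrow> nat \<Rightarrow> ratfun" where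
  "T_eigen J k = (if k \<in> J then - 1 else t_ind)"

text \<open>By (T_k - t)(T_k + 1) = 0, the image of 1 + T_k is contained in the t-eigenspace and
  that of 1 - T_k / t in the (-1)-eigenspace.\<close>

lemma T_op_symmetrised:
  "T_op k (g + lconst (T_weight J k) * T_op k g) = lconst (T_eigen J k) * (g + lconst (T_weight J k) * T_op k g)"
proof (cases "k \<in> J")
  case True
  have u: "tt * lconst (- 1 / t_ind) = - 1"
    by (simp add: lconst_simps(4)[symmetric] qt_nonzero) (simp add: lconst_simps)
  have "T_op k (g + lconst (- 1 / t_ind) * T_op k g) = T_op k g + lconst (- 1 / t_ind) * ((tt - 1) * T_op k g + tt * g)"
    unfolding T_op_add T_op_mult_lconst T_op_quadratic ..
  also have "\<dots> = - (g + lconst (- 1 / t_ind) * T_op k g)"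
    using u by algebra
  finally show ?thesis using True by (simp add: T_weight_def T_eigen_def lconst_simps)
next
  case False
  then show ?thesis
    by (simp add: T_weight_def T_eigen_def lconst_simps T_op_add T_op_quadratic algebra_simps)
qed

text \<open>\<open>U\<close> collects the elements without left descent k. The group is the disjoint
  union of U and s_k U, so 1 + w_k T_k, with w_k = \<open>T_weight J k\<close>, splits off O on the
  left and \<open>T_op_symmetrised\<close> applies.\<close>

lemma O_op_eigen:
  assumes adm: "admissible n I J" and k: "k \<in> I \<union> J"
  shows "T_op k (O_op n I J f) = lconst (T_eigen J k) * O_op n I J f"
proof -
  let ?W = "refl_group (I \<union> J)"
  note sub = admissible_sub(3)[OF adm]
  define w where "w \<sigma> = (- 1 / t_ind) ^ coxeter_length n (J_part n I J \<sigma>)" for \<sigma>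
  define U where "U = {\<sigma> \<in> ?W. \<not> descent \<sigma> k}"
  have fin: "finite ?W" using finite_refl_group[OF sub] .
  have O: "O_op n I J f = (\<Sum>\<sigma>\<in>?W. lconst (w \<sigma>) * T_perm n \<sigma> f)"
    unfolding O_op_def parabolic_eq_refl_group[OF sub] smul_eq w_def ..
  have kW: "simple_refl k \<circ> \<sigma> \<in> ?W" if "\<sigma> \<in> ?W" for \<sigma>
    using that k by (intro refl_group_comp refl_group_simple)
  have ss: "simple_refl k \<circ> (simple_refl k \<circ> \<sigma>) = \<sigma>" for \<sigma> by (rule simple_refl_comp_self)
  have W: "?W = U \<union> (\<lambda>\<sigma>. simple_refl k \<circ> \<sigma>) ` U"
  proof
    show "?W \<subseteq> U \<union> (\<lambda>\<sigma>. simple_refl k \<circ> \<sigma>) ` U"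
    proof
      fix \<sigma> assume \<sigma>: "\<sigma> \<in> ?W"
      show "\<sigma> \<in> U \<union> (\<lambda>\<sigma>. simple_refl k \<circ> \<sigma>) ` U"
      proof (cases "descent \<sigma> k")
        case True
        then have "\<not> descent (simple_refl k \<circ> \<sigma>) k"
          using descent_simple_refl_comp[OF refl_group_bij[OF \<sigma>]] by blast
        then have "simple_refl k \<circ> \<sigma> \<in> U" unfolding U_def using kW[OF \<sigma>] by blast
        then show ?thesis using ss[of \<sigma>] by (metis UnI2 imageI)
      next
        case False
        then show ?thesis using \<sigma> unfolding U_def by blast
      qed
    qed
    show "U \<union> (\<lambda>\<sigma>. simple_refl k \<circ> \<sigma>) ` U \<subseteq> ?W" using kW unfolding U_def by blast
  qed
  have disj: "U \<inter> (\<lambda>\<sigma>. simple_refl k \<circ> \<sigma>) ` U = {}"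
    using descent_simple_refl_comp[OF refl_group_bij] unfolding U_def by blast
  have inj: "inj_on (\<lambda>\<sigma>. simple_refl k \<circ> \<sigma>) U"
    by (rule inj_onI) (simp only: simple_refl_comp_cancel)
  have finU: "finite U" unfolding U_def using fin by simp
  have up: "w (simple_refl k \<circ> \<sigma>) = T_weight J k * w \<sigma> \<and> T_perm n (simple_refl k \<circ> \<sigma>) f = T_op k (T_perm n \<sigma> f)"
    if \<sigma>: "\<sigma> \<in> U" for \<sigma>
  proof -
    have \<sigma>W: "\<sigma> \<in> ?W" and nd: "\<not> descent \<sigma> k" using \<sigma> by (simp_all add: U_def)
    obtain u where u: "set u \<subseteq> I \<union> J" "reduced_word n \<sigma> u"
      using reduced_word_exists_parabolic[OF sub \<sigma>W] by blast
    have \<sigma>n: "\<sigma> \<in> refl_group {1..<n}" using \<sigma>W refl_group_mono[OF sub] by blast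
    have kn: "k \<in> {1..<n}" using k sub by blast
    have ku: "set (k # u) \<subseteq> I \<union> J" "reduced_word n (simple_refl k \<circ> \<sigma>) (k # u)"
      using u k kn coxeter_length_ascent[OF \<sigma>n kn nd] by (auto simp: reduced_word_def)
    have "w \<sigma> = (- 1 / t_ind) ^ length (filter (\<lambda>i. i \<in> J) u)"
      unfolding w_def reduced_word_parts(4,6)[OF adm u] ..
    moreover have "w (simple_refl k \<circ> \<sigma>) = (- 1 / t_ind) ^ length (filter (\<lambda>i. i \<in> J) (k # u))"
      unfolding w_def reduced_word_parts(4,6)[OF adm ku] ..
    ultimately have "w (simple_refl k \<circ> \<sigma>) = T_weight J k * w \<sigma>" by (simp add: T_weight_def)
    then show ?thesis using T_perm_reduced[OF ku(2)] T_perm_reduced[OF u(2)] by simp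
  qed
  have "O_op n I J f = (\<Sum>\<sigma>\<in>U. lconst (w \<sigma>) * T_perm n \<sigma> f) +
      (\<Sum>\<sigma>\<in>(\<lambda>\<sigma>. simple_refl k \<circ> \<sigma>) ` U. lconst (w \<sigma>) * T_perm n \<sigma> f)"
    unfolding O by (subst W, rule sum.union_disjoint[OF finU finite_imageI[OF finU] disj])
  also have "(\<Sum>\<sigma>\<in>(\<lambda>\<sigma>. simple_refl k \<circ> \<sigma>) ` U. lconst (w \<sigma>) * T_perm n \<sigma> f) =
      (\<Sum>\<sigma>\<in>U. lconst (w \<sigma>) * (lconst (T_weight J k) * T_op k (T_perm n \<sigma> f)))"
    unfolding sum.reindex[OF inj]
    by (rule sum.cong[OF refl]) (simp only: comp_apply up lconst_simps mult_ac)
  also have "(\<Sum>\<sigma>\<in>U. lconst (w \<sigma>) * T_perm n \<sigma> f) +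
      (\<Sum>\<sigma>\<in>U. lconst (w \<sigma>) * (lconst (T_weight J k) * T_op k (T_perm n \<sigma> f))) =
      (\<Sum>\<sigma>\<in>U. lconst (w \<sigma>) * (T_perm n \<sigma> f + lconst (T_weight J k) * T_op k (T_perm n \<sigma> f)))"
    by (simp only: sum.distrib distrib_left)
  finally have O': "O_op n I J f =
    (\<Sum>\<sigma>\<in>U. lconst (w \<sigma>) * (T_perm n \<sigma> f + lconst (T_weight J k) * T_op k (T_perm n \<sigma> f)))" .
  show ?thesis
    unfolding O' T_op_sum T_op_mult_lconst T_op_symmetrised sum_distrib_left
    by (rule sum.cong[OF refl]) (simp only: mult_ac)
qed

lemma T_perm_eigen:
  assumes adm: "admissible n I J" and \<sigma>: "\<sigma> \<in> refl_group (I \<union> J)"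
    and S: "\<And>k. k \<in> I \<union> J \<Longrightarrow> T_op k S = lconst (T_eigen J k) * S"
  defines "lJ \<equiv> coxeter_length n (J_part n I J \<sigma>)"
  shows "T_perm n \<sigma> S = smul (t_ind ^ (coxeter_length n \<sigma> - lJ) * (- 1) ^ lJ) S"
proof -
  obtain u where u: "set u \<subseteq> I \<union> J" "reduced_word n \<sigma> u"
    using reduced_word_exists_parabolic[OF admissible_sub(3)[OF adm] \<sigma>] by blast
  note p = reduced_word_parts[OF adm u]
  have "foldr T_op u S = lconst (t_ind ^ length (filter (\<lambda>i. i \<in> I) u) * (- 1) ^ length (filter (\<lambda>i. i \<in> J) u)) * S"
    using u(1)
  proof (induction u)
    case (Cons k u)
    let ?X = "\<lambda>u. t_ind ^ length (filter (\<lambda>i. i \<in> I) u) * (- 1) ^ length (filter (\<lambda>i. i \<in> J) u)"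
    have "foldr T_op (k # u) S = T_op k (lconst (?X u) * S)" using Cons by simp
    also have "\<dots> = lconst (?X u) * (lconst (T_eigen J k) * S)"
      using Cons.prems by (simp only: T_op_mult_lconst) (simp add: S)
    also have "\<dots> = lconst (?X u * T_eigen J k) * S" by (simp only: lconst_simps(4) mult.assoc)
    also have "?X u * T_eigen J k = ?X (k # u)"
      using Cons.prems admissible_sub(4)[OF adm] by (auto simp: T_eigen_def)
    finally show ?case .
  qed (simp add: lconst_simps)
  then show ?thesis
    unfolding T_perm_reduced[OF u(2)] smul_eq lJ_def p(4) p(6) p(7) by simp
qed

section \<open>Compositions in an orbit and the norm formula\<close>

lemma lookup_perm_act: "bij \<sigma> \<Longrightarrow> Poly_Mapping.lookup (perm_act \<sigma> \<alpha>) i = Poly_Mapping.lookup \<alpha> (Hilbert_Choice.inv \<sigma> i)"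
  by (simp add: perm_act_def map_key.rep_eq bij_imp_bij_inv bij_is_inj)

lemma composition_perm_act:
  assumes "composition n \<alpha>" "\<sigma> permutes {1..n}"
  shows "composition n (perm_act \<sigma> \<alpha>)"
proof -
  have bij: "bij \<sigma>" using assms(2) by (rule permutes_bij)
  note \<alpha> = assms(1)[unfolded composition_def]
  show ?thesis
    unfolding composition_def
  proof (intro conjI subsetI allI)
    fix i
    show "0 \<le> Poly_Mapping.lookup (perm_act \<sigma> \<alpha>) i" using \<alpha> unfolding lookup_perm_act[OF bij] by blast
    assume "i \<in> Poly_Mapping.keys (perm_act \<sigma> \<alpha>)"
    then have "Hilbert_Choice.inv \<sigma> i \<in> Poly_Mapping.keys \<alpha>"
      unfolding in_keys_iff lookup_perm_act[OF bij] .
    then have "Hilbert_Choice.inv \<sigma> i \<in> {1..n}" using \<alpha> by blast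
    then show "i \<in> {1..n}" unfolding permutes_in_image[OF permutes_inv[OF assms(2)]] .
  qed
qed

theorem theorem7:
  fixes n :: nat and I J :: "nat set"
    and \<eta>s \<eta> :: expo
    and E :: "expo \<Rightarrow> ratfun laurent"
    and S :: "ratfun laurent"
    and a c :: "expo \<Rightarrow> ratfun"
  assumes "n \<ge> 1"
    and "admissible n I J"
    and "composition n \<eta>s"
    and "\<forall>i\<in>I. Poly_Mapping.lookup \<eta>s i \<ge> Poly_Mapping.lookup \<eta>s (i + 1)"
    and "\<forall>j\<in>J. Poly_Mapping.lookup \<eta>s j > Poly_Mapping.lookup \<eta>s (j + 1)"
    and "\<eta> \<in> orbit_of n (I \<union> J) \<eta>s"
    and "\<forall>\<nu>. composition n \<nu> \<longrightarrow> nonsymmetric_macdonald n \<nu> (E \<nu>)"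
    and "prescribed_symmetry_macdonald n I J E \<eta>s S a"
    and "S = (\<Sum>\<mu>\<in>orbit_of n (I \<union> J) \<eta>s. smul (c \<mu>) (E \<mu>))"
  shows "inner_qt n S S =
    embed_qt (K_const I J * (c \<eta> / qt_invert (a \<eta>))) * inner_qt n (E \<eta>) (E \<eta>)"
proof -
  note adm = assms(2)
  let ?W = "refl_group (I \<union> J)" and ?orb = "orbit_of n (I \<union> J) \<eta>s"
  note sub = admissible_sub(3)[OF adm]
  have orb: "?orb = (\<lambda>\<sigma>. perm_act \<sigma> \<eta>s) ` ?W"
    by (simp only: orbit_of_def parabolic_eq_refl_group[OF sub])
  have fin: "finite ?orb" unfolding orb using finite_refl_group[OF sub] by (rule finite_imageI)
  have comp: "composition n \<mu>" if "\<mu> \<in> ?orb" for \<mu>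
  proof -
    obtain \<sigma> where "\<sigma> \<in> ?W" "\<mu> = perm_act \<sigma> \<eta>s" using \<open>\<mu> \<in> ?orb\<close> unfolding orb by blast
    moreover obtain w where "set w \<subseteq> I \<union> J" "\<sigma> = word_perm w" using \<open>\<sigma> \<in> ?W\<close> by (rule refl_groupE)
    ultimately show ?thesis
      using composition_perm_act[OF assms(3) word_perm_permutes[of w n]] sub by blast
  qed
  have a: "a \<eta> \<noteq> 0" and OE: "O_op n I J (E \<eta>) = smul (a \<eta>) S"
    using assms(6,8) by (auto simp: prescribed_symmetry_macdonald_def)
  \<comment> \<open>S is a nonzero multiple of an image of O, so the scalar a_\<eta>
    cancels.\<close>
  have eig: "T_op k S = lconst (T_eigen J k) * S" if "k \<in> I \<union> J" for k
  proof -
    have "lconst (a \<eta>) * T_op k S = lconst (a \<eta>) * (lconst (T_eigen J k) * S)"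
      using O_op_eigen[OF adm that, of "E \<eta>"] unfolding OE smul_eq T_op_mult_lconst by (simp only: mult_ac)
    then show ?thesis using a by (simp add: lconst_eq_0_iff)
  qed
  define lJ where "lJ \<sigma> = coxeter_length n (J_part n I J \<sigma>)" for \<sigma>
  define lI where "lI \<sigma> = coxeter_length n \<sigma> - lJ \<sigma>" for \<sigma>
  have SE: "inner_qt n S (E \<eta>) = embed_qt (c \<eta>) * inner_qt n (E \<eta>) (E \<eta>)"
  proof -
    have orth: "inner_qt n (E \<mu>) (E \<eta>) = 0" if "\<mu> \<in> ?orb" "\<mu> \<noteq> \<eta>" for \<mu>
      using nonsymmetric_macdonald_orthogonal[of n \<mu> "E \<mu>" \<eta> "E \<eta>"] assms(7) comp that assms(6) by blast
    have "inner_qt n S (E \<eta>) = (\<Sum>\<mu>\<in>?orb. embed_qt (c \<mu>) * inner_qt n (E \<mu>) (E \<eta>))"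
      by (subst assms(9)) (simp add: inner_qt_sum inner_qt_smul)
    also have "\<dots> = (\<Sum>\<mu>\<in>?orb. if \<mu> = \<eta> then embed_qt (c \<eta>) * inner_qt n (E \<eta>) (E \<eta>) else 0)"
      using orth by (intro sum.cong refl) auto
    also have "\<dots> = embed_qt (c \<eta>) * inner_qt n (E \<eta>) (E \<eta>)" using fin assms(6) by simp
    finally show ?thesis .
  qed
  \<comment> \<open>Unitarity gives <S, E> = <T S, T E>, and T S is a multiple of S. The scalar
    leaves the first argument unconjugated, so its inverse appears here; the sign is its own
    inverse.\<close>
  have T: "inner_qt n S (T_perm n \<sigma> (E \<eta>)) = embed_qt (inverse t_ind ^ lI \<sigma> * (- 1) ^ lJ \<sigma>) * inner_qt n S (E \<eta>)"
    if \<sigma>: "\<sigma> \<in> ?W" for \<sigma>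
  proof -
    have TS: "T_perm n \<sigma> S = smul (t_ind ^ lI \<sigma> * (- 1) ^ lJ \<sigma>) S"
      unfolding lI_def lJ_def using adm \<sigma> eig by (rule T_perm_eigen)
    have "\<sigma> \<in> refl_group {1..<n}" using \<sigma> refl_group_mono[OF sub] by blast
    then have "reduced_word n \<sigma> (SOME w. reduced_word n \<sigma> w)"
      by (rule someI_ex[OF reduced_word_exists])
    then have "set (SOME w. reduced_word n \<sigma> w) \<subseteq> {1..<n}" unfolding reduced_word_def[of n \<sigma> "Eps _"] by (rule conjunct1)
    then have "unitary n (T_perm n \<sigma>)"
      unfolding T_perm_def by (rule unitary_T_word)
    then have "inner_qt n S (E \<eta>) = inner_qt n (T_perm n \<sigma> S) (T_perm n \<sigma> (E \<eta>))"
      by (simp add: unitary_def)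
    also have "\<dots> = embed_qt (t_ind ^ lI \<sigma> * (- 1) ^ lJ \<sigma>) * inner_qt n S (T_perm n \<sigma> (E \<eta>))"
      unfolding TS inner_qt_smul ..
    finally have "embed_qt (inverse t_ind ^ lI \<sigma> * (- 1) ^ lJ \<sigma>) * inner_qt n S (E \<eta>) =
      embed_qt ((inverse t_ind ^ lI \<sigma> * (- 1) ^ lJ \<sigma>) * (t_ind ^ lI \<sigma> * (- 1) ^ lJ \<sigma>)) * inner_qt n S (T_perm n \<sigma> (E \<eta>))"
      by (simp only: embed_qt_simps(4) mult.assoc)
    also have "(inverse t_ind ^ lI \<sigma> * (- 1) ^ lJ \<sigma>) * (t_ind ^ lI \<sigma> * (- 1) ^ lJ \<sigma>) = 1"
      by (simp add: qt_nonzero power_inverse field_simps flip: power_mult_distrib)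
    finally show ?thesis by (simp add: embed_qt_simps)
  qed
  have "embed_qt (qt_invert (a \<eta>)) * inner_qt n S S = inner_qt n S (O_op n I J (E \<eta>))"
    unfolding OE inner_qt_smul ..
  also have "\<dots> = (\<Sum>\<sigma>\<in>?W. embed_qt (qt_invert ((- 1 / t_ind) ^ lJ \<sigma>)) * inner_qt n S (T_perm n \<sigma> (E \<eta>)))"
    unfolding O_op_def parabolic_eq_refl_group[OF sub] inner_qt_sum inner_qt_smul lJ_def ..
  \<comment> \<open>The sign in the conjugated weight (-t)^lJ cancels against the sign of the
    inverse eigenvalue, leaving the summand of \<open>K_const_eq_sum\<close>.\<close>
  also have "\<dots> = (\<Sum>\<sigma>\<in>?W. embed_qt (t_ind ^ lJ \<sigma> * inverse t_ind ^ lI \<sigma>) * inner_qt n S (E \<eta>))"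
  proof (rule sum.cong[OF refl])
    fix \<sigma> assume \<sigma>: "\<sigma> \<in> ?W"
    have q: "qt_invert ((- 1 / t_ind) ^ lJ \<sigma>) = (- 1) ^ lJ \<sigma> * t_ind ^ lJ \<sigma>"
    proof -
      have "qt_invert (- 1 / t_ind) = - 1 * t_ind"
        by (simp only: qt_invert_simps qt_invert_q_t divide_inverse inverse_inverse_eq)
      then show ?thesis by (simp only: qt_invert_simps(9) power_mult_distrib)
    qed
    have sq: "(- 1 :: ratfun) ^ lJ \<sigma> * (- 1) ^ lJ \<sigma> = 1" by (simp flip: power_mult_distrib)
    have "qt_invert ((- 1 / t_ind) ^ lJ \<sigma>) * (inverse t_ind ^ lI \<sigma> * (- 1) ^ lJ \<sigma>) = t_ind ^ lJ \<sigma> * inverse t_ind ^ lI \<sigma>"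
    proof -
      have "(- 1) ^ lJ \<sigma> * x * (y * (- 1) ^ lJ \<sigma>) = ((- 1) ^ lJ \<sigma> * (- 1) ^ lJ \<sigma>) * (x * y)" for x y :: ratfun
        by (simp only: mult_ac)
      then show ?thesis unfolding q sq by simp
    qed
    then show "embed_qt (qt_invert ((- 1 / t_ind) ^ lJ \<sigma>)) * inner_qt n S (T_perm n \<sigma> (E \<eta>)) =
        embed_qt (t_ind ^ lJ \<sigma> * inverse t_ind ^ lI \<sigma>) * inner_qt n S (E \<eta>)"
      unfolding T[OF \<sigma>] by (simp only: mult.assoc[symmetric] embed_qt_simps(4)[symmetric])
  qed
  also have "\<dots> = embed_qt (K_const I J) * inner_qt n S (E \<eta>)"
    unfolding K_const_eq_sum[OF adm] lI_def lJ_def embed_qt_simps(11) sum_distrib_right ..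
  finally have main: "embed_qt (qt_invert (a \<eta>)) * inner_qt n S S = embed_qt (K_const I J) * inner_qt n S (E \<eta>)" .
  have nz: "embed_qt (qt_invert (a \<eta>)) \<noteq> 0" using a by (simp add: embed_qt_simps(13) qt_invert_simps(13))
  then have "inner_qt n S S = embed_qt (K_const I J) * inner_qt n S (E \<eta>) / embed_qt (qt_invert (a \<eta>))"
    using main by (simp add: nonzero_eq_divide_eq mult.commute)
  then show ?thesis unfolding SE by (simp add: embed_qt_simps)
qed

end
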